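(* The category of d-Boolean algebras and d-lattice homomorphisms is dually equivalent to the category of d-Boolean spaces and continuous maps.
   Context: Distributive lattices are bounded (with top $1$ and bottom $0$), and lattice homomorphisms preserve $0$ and $1$. Let $(L,\sqsubseteq)$ be a distributive lattice with meet $\sqcap$ and join $\sqcup$, and let $\mathit{tt},\mathit{ff}\in L$ be complementary: $\mathit{tt}\sqcup\mathit{ff}=1$, $\mathit{tt}\sqcap\mathit{ff}=0$. It is always assumed that the complementary pair $\{\mathit{tt},\mathit{ff}\}$ is different from $\{1,0\}$. Put $L_+=\{a\in L:a\sqsubseteq\mathit{tt}\}$ and $L_-=\{b\in L:b\sqsubseteq\mathit{ff}\}$. Each $x\in L$ is uniquely $a\sqcup b$ with $a\in L_+$, $b\in L_-$. The information order is $\sqsubseteq$. The logic order $\le$ on $L$ is: $x\le y$ iff $x\sqcap\mathit{tt}\sqsubseteq y\sqcap\mathit{tt}$ and $x\sqcap\mathit{ff}\sqsupseteq y\sqcap\mathit{ff}$. It is a lattice order with $x\wedge y=(x\sqcap\mathit{ff})\sqcup(y\sqcap\mathit{ff})\sqcup(x\sqcap y)$ and $x\vee y=(x\sqcap\mathit{tt})\sqcup(y\sqcap\mathit{tt})\sqcup(x\sqcap y)$. A d-lattice is a structure $(L;\mathit{tt},\mathit{ff};\mathbf{con},\mathbf{tot})$, where $(L,\sqsubseteq)$ is a distributive lattice, $\mathit{tt},\mathit{ff}\in L$ are complementary elements with $\{\mathit{tt},\mathit{ff}\}\neq\{1,0\}$, and $\mathbf{con},\mathbf{tot}\subseteq L$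 are such that: $\mathit{tt},\mathit{ff}\in\mathbf{con}$ and $\mathit{tt},\mathit{ff}\in\mathbf{tot}$; $\mathbf{con}$ is a lower set and $\mathbf{tot}$ is an upper set for $\sqsubseteq$; $\mathbf{con}$ and $\mathbf{tot}$ are sublattices of $L$ for the logic order, i.e. closed under $\wedge$ and $\vee$; and if $\alpha\in\mathbf{con}$, $\beta\in\mathbf{tot}$ and ($\alpha\sqcap\mathit{tt}=\beta\sqcap\mathit{tt}$ or $\alpha\sqcap\mathit{ff}=\beta\sqcap\mathit{ff}$), then $\alpha\sqsubseteq\beta$. A d-lattice homomorphism from $(L;\mathit{tt},\mathit{ff};\mathbf{con},\mathbf{tot})$ to $(L';\mathit{tt}',\mathit{ff}';\mathbf{con}',\mathbf{tot}')$ is a lattice homomorphism $f\colon L\to L'$ (for $\sqsubseteq$) with $f(\mathit{tt})=\mathit{tt}'$, $f(\mathit{ff})=\mathit{ff}'$, $f(\mathbf{con})\subseteq\mathbf{con}'$, $f(\mathbf{tot})\subseteq\mathbf{tot}'$. A d-Boolean algebra is a d-lattice in which every $a\in L_+$ has some $a^\dag\in L_-$ with $a\sqcup a^\dag\in\mathbf{con}\cap\mathbf{tot}$, and every $b\in L_-$ has some $b^\dag\in L_+$ with $b^\dag\sqcup b\in\mathbf{con}\cap\mathbf{tot}$. A bitopological space $(X,\tau_+,\tau_-)$ is a set with two topologies; a continuous map of bitopological spaces is a map continuous for both the $\tau_+$- and the $\tau_-$-topologies. It is $T_0$ if for each pair of distinct points there is a $\tau_+$-open or a $\tau_-$-open set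 containing one of the points but not the other; compact if every cover of $X$ by members of $\tau_+\cup\tau_-$ has a finite subcover; zero-dimensional if $\tau_+$ has a base of $\tau_-$-closed sets and $\tau_-$ has a base of $\tau_+$-closed sets. A d-Boolean space is a $T_0$, compact and zero-dimensional bitopological space.
   Formalization: d-Boolean spaces are required to be nonempty: the empty space is T0, compact and zero-dimensional, but its dual, the one-element algebra, is excluded by {tt,ff} ≠ {1,0}, so with the empty space admitted the claimed dual equivalence fails. *)

theory Defs
  imports
    "HOL-Analysis.Abstract_Topology"
    "HOL-Algebra.Lattice"
    "HOL-Library.Equipollence"
    "HOL-Library.FuncSet"
begin

section \<open>Categories, functors and dual equivalence\<close>

text \<open>
  A category has a set of objects of type \<open>'o\<close> and hom-sets of arrows of type \<open>'m\<close>. Arrows do not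
  record their domain and codomain, so composition (and the arrow part of a functor) takes the
  objects as arguments: \<open>cat_comp C X Y Z g f\<close> is \<open>g \<circ> f\<close> for \<open>f : X \<rightarrow> Y\<close> and \<open>g : Y \<rightarrow> Z\<close>.
\<close>

record ('o, 'm) cat =
  cat_obj :: "'o set"
  cat_hom :: "'o \<Rightarrow> 'o \<Rightarrow> 'm set"
  cat_id :: "'o \<Rightarrow> 'm"
  cat_comp :: "'o \<Rightarrow> 'o \<Rightarrow> 'o \<Rightarrow> 'm \<Rightarrow> 'm \<Rightarrow> 'm"

definition is_category :: "('o, 'm) cat \<Rightarrow> bool" where
  "is_category C \<longleftrightarrow>
     (\<forall>X\<in>cat_obj C. cat_id C X \<in> cat_hom C X X) \<and>
     (\<forall>X\<in>cat_obj C. \<forall>Y\<in>cat_obj C. \<forall>Z\<in>cat_obj C.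
        \<forall>f\<in>cat_hom C X Y. \<forall>g\<in>cat_hom C Y Z. cat_comp C X Y Z g f \<in> cat_hom C X Z) \<and>
     (\<forall>X\<in>cat_obj C. \<forall>Y\<in>cat_obj C. \<forall>f\<in>cat_hom C X Y.
        cat_comp C X X Y f (cat_id C X) = f \<and> cat_comp C X Y Y (cat_id C Y) f = f) \<and>
     (\<forall>W\<in>cat_obj C. \<forall>X\<in>cat_obj C. \<forall>Y\<in>cat_obj C. \<forall>Z\<in>cat_obj C.
        \<forall>f\<in>cat_hom C W X. \<forall>g\<in>cat_hom C X Y. \<forall>h\<in>cat_hom C Y Z.
          cat_comp C W Y Z h (cat_comp C W X Y g f) = cat_comp C W X Z (cat_comp C X Y Z h g) f)"

definition op_cat :: "('o, 'm) cat \<Rightarrow> ('o, 'm) cat" where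
  "op_cat C = \<lparr>cat_obj = cat_obj C,
               cat_hom = (\<lambda>X Y. cat_hom C Y X),
               cat_id = cat_id C,
               cat_comp = (\<lambda>X Y Z g f. cat_comp C Z Y X f g)\<rparr>"

definition is_functor ::
  "('o, 'm) cat \<Rightarrow> ('p, 'n) cat \<Rightarrow> ('o \<Rightarrow> 'p) \<Rightarrow> ('o \<Rightarrow> 'o \<Rightarrow> 'm \<Rightarrow> 'n) \<Rightarrow> bool" where
  "is_functor C D F Fm \<longleftrightarrow> is_category C \<and> is_category D \<and>
     (\<forall>X\<in>cat_obj C. F X \<in> cat_obj D) \<and>
     (\<forall>X\<in>cat_obj C. \<forall>Y\<in>cat_obj C. \<forall>f\<in>cat_hom C X Y. Fm X Y f \<in> cat_hom D (F X) (F Y)) \<and>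
     (\<forall>X\<in>cat_obj C. Fm X X (cat_id C X) = cat_id D (F X)) \<and>
     (\<forall>X\<in>cat_obj C. \<forall>Y\<in>cat_obj C. \<forall>Z\<in>cat_obj C. \<forall>f\<in>cat_hom C X Y. \<forall>g\<in>cat_hom C Y Z.
        Fm X Z (cat_comp C X Y Z g f) = cat_comp D (F X) (F Y) (F Z) (Fm Y Z g) (Fm X Y f))"

definition cat_iso :: "('o, 'm) cat \<Rightarrow> 'o \<Rightarrow> 'o \<Rightarrow> 'm set" where
  "cat_iso C X Y = {f \<in> cat_hom C X Y. \<exists>g\<in>cat_hom C Y X.
     cat_comp C X Y X g f = cat_id C X \<and> cat_comp C Y X Y f g = cat_id C Y}"

text \<open>\<open>\<eta>\<close> is a natural isomorphism between the functors \<open>(F, Fm)\<close> and \<open>(G, Gm)\<close> from \<open>C\<close> to \<open>D\<close>.\<close>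

definition is_natural_iso ::
  "('o, 'm) cat \<Rightarrow> ('p, 'n) cat \<Rightarrow> ('o \<Rightarrow> 'p) \<Rightarrow> ('o \<Rightarrow> 'o \<Rightarrow> 'm \<Rightarrow> 'n) \<Rightarrow>
   ('o \<Rightarrow> 'p) \<Rightarrow> ('o \<Rightarrow> 'o \<Rightarrow> 'm \<Rightarrow> 'n) \<Rightarrow> ('o \<Rightarrow> 'n) \<Rightarrow> bool" where
  "is_natural_iso C D F Fm G Gm \<eta> \<longleftrightarrow>
     (\<forall>X\<in>cat_obj C. \<eta> X \<in> cat_iso D (F X) (G X)) \<and>
     (\<forall>X\<in>cat_obj C. \<forall>Y\<in>cat_obj C. \<forall>f\<in>cat_hom C X Y.
        cat_comp D (F X) (F Y) (G Y) (\<eta> Y) (Fm X Y f) =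
        cat_comp D (F X) (G X) (G Y) (Gm X Y f) (\<eta> X))"

definition equivalent_categories :: "('o, 'm) cat \<Rightarrow> ('p, 'n) cat \<Rightarrow> bool" where
  "equivalent_categories C D \<longleftrightarrow>
     (\<exists>F Fm G Gm. is_functor C D F Fm \<and> is_functor D C G Gm \<and>
        (\<exists>\<eta>. is_natural_iso C C (\<lambda>X. X) (\<lambda>X Y f. f)
               (\<lambda>X. G (F X)) (\<lambda>X Y f. Gm (F X) (F Y) (Fm X Y f)) \<eta>) \<and>
        (\<exists>\<epsilon>. is_natural_iso D D (\<lambda>X. X) (\<lambda>X Y f. f)
               (\<lambda>X. F (G X)) (\<lambda>X Y f. Fm (G X) (G Y) (Gm X Y f)) \<epsilon>))"

definition dually_equivalent :: "('o, 'm) cat \<Rightarrow> ('p, 'n) cat \<Rightarrow> bool" where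
  "dually_equivalent C D \<longleftrightarrow> equivalent_categories (op_cat C) D"

section \<open>d-Boolean algebras\<close>

record 'a dlat = "'a gorder" +
  tt :: 'a
  ff :: 'a
  con :: "'a set"
  tot :: "'a set"

definition logic_meet :: "'a dlat \<Rightarrow> 'a \<Rightarrow> 'a \<Rightarrow> 'a" where
  "logic_meet L x y = (x \<sqinter>\<^bsub>L\<^esub> ff L) \<squnion>\<^bsub>L\<^esub> (y \<sqinter>\<^bsub>L\<^esub> ff L) \<squnion>\<^bsub>L\<^esub> (x \<sqinter>\<^bsub>L\<^esub> y)"

definition logic_join :: "'a dlat \<Rightarrow> 'a \<Rightarrow> 'a \<Rightarrow> 'a" where
  "logic_join L x y = (x \<sqinter>\<^bsub>L\<^esub> tt L) \<squnion>\<^bsub>L\<^esub> (y \<sqinter>\<^bsub>L\<^esub> tt L) \<squnion>\<^bsub>L\<^esub> (x \<sqinter>\<^bsub>L\<^esub> y)"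

locale d_lattice = bounded_lattice L for L :: "'a dlat" (structure) +
  assumes distrib: "\<lbrakk>x \<in> carrier L; y \<in> carrier L; z \<in> carrier L\<rbrakk> \<Longrightarrow>
      x \<sqinter> (y \<squnion> z) = (x \<sqinter> y) \<squnion> (x \<sqinter> z)"
    and tt_carrier: "tt L \<in> carrier L"
    and ff_carrier: "ff L \<in> carrier L"
    and tt_join_ff: "tt L \<squnion> ff L = \<top>"
    and tt_meet_ff: "tt L \<sqinter> ff L = \<bottom>"
    and nondegenerate: "{tt L, ff L} \<noteq> {\<top>, \<bottom>}"
    and con_carrier: "con L \<subseteq> carrier L"
    and tot_carrier: "tot L \<subseteq> carrier L"
    and tt_con: "tt L \<in> con L"
    and ff_con: "ff L \<in> con L"
    and tt_tot: "tt L \<in> tot L"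
    and ff_tot: "ff L \<in> tot L"
    and con_lower: "\<lbrakk>x \<in> con L; y \<in> carrier L; y \<sqsubseteq> x\<rbrakk> \<Longrightarrow> y \<in> con L"
    and tot_upper: "\<lbrakk>x \<in> tot L; y \<in> carrier L; x \<sqsubseteq> y\<rbrakk> \<Longrightarrow> y \<in> tot L"
    and con_logic_meet: "\<lbrakk>x \<in> con L; y \<in> con L\<rbrakk> \<Longrightarrow> logic_meet L x y \<in> con L"
    and con_logic_join: "\<lbrakk>x \<in> con L; y \<in> con L\<rbrakk> \<Longrightarrow> logic_join L x y \<in> con L"
    and tot_logic_meet: "\<lbrakk>x \<in> tot L; y \<in> tot L\<rbrakk> \<Longrightarrow> logic_meet L x y \<in> tot L"
    and tot_logic_join: "\<lbrakk>x \<in> tot L; y \<in> tot L\<rbrakk> \<Longrightarrow> logic_join L x y \<in> tot L"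
    and con_tot: "\<lbrakk>\<alpha> \<in> con L; \<beta> \<in> tot L;
        \<alpha> \<sqinter> tt L = \<beta> \<sqinter> tt L \<or> \<alpha> \<sqinter> ff L = \<beta> \<sqinter> ff L\<rbrakk> \<Longrightarrow> \<alpha> \<sqsubseteq> \<beta>"

definition pos_part :: "'a dlat \<Rightarrow> 'a set" where
  "pos_part L = {a \<in> carrier L. a \<sqsubseteq>\<^bsub>L\<^esub> tt L}"

definition neg_part :: "'a dlat \<Rightarrow> 'a set" where
  "neg_part L = {b \<in> carrier L. b \<sqsubseteq>\<^bsub>L\<^esub> ff L}"

definition d_boolean_algebra :: "'a dlat \<Rightarrow> bool" where
  "d_boolean_algebra L \<longleftrightarrow> d_lattice L \<and>
     (\<forall>a\<in>pos_part L. \<exists>a'\<in>neg_part L. a \<squnion>\<^bsub>L\<^esub> a' \<in> con L \<inter> tot L) \<and>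
     (\<forall>b\<in>neg_part L. \<exists>b'\<in>pos_part L. b' \<squnion>\<^bsub>L\<^esub> b \<in> con L \<inter> tot L)"

text \<open>
  Arrows are extensional functions (\<open>undefined\<close> off the carrier), so that two arrows are equal
  iff they agree on the carrier.
\<close>

definition dlat_hom :: "'a dlat \<Rightarrow> 'b dlat \<Rightarrow> ('a \<Rightarrow> 'b) set" where
  "dlat_hom A B = {f \<in> carrier A \<rightarrow>\<^sub>E carrier B.
     (\<forall>x\<in>carrier A. \<forall>y\<in>carrier A. f (x \<squnion>\<^bsub>A\<^esub> y) = f x \<squnion>\<^bsub>B\<^esub> f y) \<and>
     (\<forall>x\<in>carrier A. \<forall>y\<in>carrier A. f (x \<sqinter>\<^bsub>A\<^esub> y) = f x \<sqinter>\<^bsub>B\<^esub> f y) \<and>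
     f \<top>\<^bsub>A\<^esub> = \<top>\<^bsub>B\<^esub> \<and> f \<bottom>\<^bsub>A\<^esub> = \<bottom>\<^bsub>B\<^esub> \<and>
     f (tt A) = tt B \<and> f (ff A) = ff B \<and>
     f ` con A \<subseteq> con B \<and> f ` tot A \<subseteq> tot B}"

definition dlat_iso :: "'a dlat \<Rightarrow> 'b dlat \<Rightarrow> ('a \<Rightarrow> 'b) set" where
  "dlat_iso A B = {f \<in> dlat_hom A B. \<exists>g\<in>dlat_hom B A.
     (\<forall>x\<in>carrier A. g (f x) = x) \<and> (\<forall>y\<in>carrier B. f (g y) = y)}"

text \<open>
  The category of d-Boolean algebras whose carrier belongs to \<open>\<U>\<close>; for \<open>\<U> = UNIV\<close> these are all
  the d-Boolean algebras that live on subsets of the type \<open>'a\<close>.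
\<close>

definition dBA :: "'a set set \<Rightarrow> ('a dlat, 'a \<Rightarrow> 'a) cat" where
  "dBA \<U> = \<lparr>cat_obj = {A. d_boolean_algebra A \<and> carrier A \<in> \<U>},
            cat_hom = dlat_hom,
            cat_id = (\<lambda>A. \<lambda>x\<in>carrier A. x),
            cat_comp = (\<lambda>A B D g f. compose (carrier A) g f)\<rparr>"

section \<open>d-Boolean spaces\<close>

record 'a bitop =
  pos_top :: "'a topology"
  neg_top :: "'a topology"

definition bitopological_space :: "'a bitop \<Rightarrow> bool" where
  "bitopological_space X \<longleftrightarrow> topspace (pos_top X) = topspace (neg_top X)"

definition points :: "'a bitop \<Rightarrow> 'a set" where
  "points X = topspace (pos_top X)"

definition bitop_T0 :: "'a bitop \<Rightarrow> bool" where
  "bitop_T0 X \<longleftrightarrow> (\<forall>x\<in>points X. \<forall>y\<in>points X. x \<noteq> y \<longrightarrow>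
     (\<exists>U. (openin (pos_top X) U \<or> openin (neg_top X) U) \<and> (x \<in> U \<longleftrightarrow> y \<notin> U)))"

definition bitop_compact :: "'a bitop \<Rightarrow> bool" where
  "bitop_compact X \<longleftrightarrow>
     (\<forall>\<C>. (\<forall>U\<in>\<C>. openin (pos_top X) U \<or> openin (neg_top X) U) \<and> points X \<subseteq> \<Union>\<C> \<longrightarrow>
        (\<exists>\<F>. finite \<F> \<and> \<F> \<subseteq> \<C> \<and> points X \<subseteq> \<Union>\<F>))"

definition has_base_of_closed :: "'a topology \<Rightarrow> 'a topology \<Rightarrow> bool" where
  "has_base_of_closed S T \<longleftrightarrow>
     (\<exists>\<B>. (\<forall>B\<in>\<B>. openin S B \<and> closedin T B) \<and>
        (\<forall>U. openin S U \<longrightarrow> (\<exists>\<B>'\<subseteq>\<B>. U = \<Union>\<B>')))"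

definition bitop_zero_dimensional :: "'a bitop \<Rightarrow> bool" where
  "bitop_zero_dimensional X \<longleftrightarrow>
     has_base_of_closed (pos_top X) (neg_top X) \<and> has_base_of_closed (neg_top X) (pos_top X)"

text \<open>
  Spaces are nonempty. This is the counterpart of the requirement
  \<open>{tt, ff} \<noteq> {\<top>, \<bottom>}\<close> on d-lattices: the empty space would be dual to the one-element algebra,
  which that requirement excludes.
\<close>

definition d_boolean_space :: "'a bitop \<Rightarrow> bool" where
  "d_boolean_space X \<longleftrightarrow> bitopological_space X \<and> points X \<noteq> {} \<and>
     bitop_T0 X \<and> bitop_compact X \<and> bitop_zero_dimensional X"

definition bitop_hom :: "'a bitop \<Rightarrow> 'b bitop \<Rightarrow> ('a \<Rightarrow> 'b) set" where
  "bitop_hom X Y = {f \<in> extensional (points X).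
     continuous_map (pos_top X) (pos_top Y) f \<and> continuous_map (neg_top X) (neg_top Y) f}"

definition bitop_iso :: "'a bitop \<Rightarrow> 'b bitop \<Rightarrow> ('a \<Rightarrow> 'b) set" where
  "bitop_iso X Y = {f \<in> bitop_hom X Y. \<exists>g\<in>bitop_hom Y X.
     (\<forall>x\<in>points X. g (f x) = x) \<and> (\<forall>y\<in>points Y. f (g y) = y)}"

definition dBS :: "'a set set \<Rightarrow> ('a bitop, 'a \<Rightarrow> 'a) cat" where
  "dBS \<U> = \<lparr>cat_obj = {X. d_boolean_space X \<and> points X \<in> \<U>},
            cat_hom = bitop_hom,
            cat_id = (\<lambda>X. \<lambda>x\<in>points X. x),
            cat_comp = (\<lambda>X Y Z g f. compose (points X) g f)\<rparr>"

section \<open>The spectrum and the clopen algebra\<close>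

text \<open>
  The four-element d-lattice; a pair records the components below \<open>tt\<close> and below \<open>ff\<close>.
\<close>

definition dfour :: "(bool \<times> bool) dlat" where
  "dfour = \<lparr>carrier = UNIV, eq = (=),
            le = (\<lambda>x y. (fst x \<longrightarrow> fst y) \<and> (snd x \<longrightarrow> snd y)),
            tt = (True, False), ff = (False, True),
            con = {x. \<not> (fst x \<and> snd x)}, tot = {x. fst x \<or> snd x}\<rparr>"

text \<open>
  The points of the spectrum of \<open>A\<close> are the homomorphisms \<open>p\<close> from \<open>A\<close> to \<open>dfour\<close>. The two
  topologies are generated by the sets of all \<open>p\<close> with \<open>tt \<sqsubseteq> p a\<close>, respectively \<open>ff \<sqsubseteq> p a\<close>.
\<close>

definition dspec :: "'a dlat \<Rightarrow> ('a \<Rightarrow> bool \<times> bool) bitop" where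
  "dspec A = \<lparr>
     pos_top = topology_generated_by ((\<lambda>a. {p \<in> dlat_hom A dfour. fst (p a)}) ` carrier A),
     neg_top = topology_generated_by ((\<lambda>a. {p \<in> dlat_hom A dfour. snd (p a)}) ` carrier A)\<rparr>"

text \<open>For \<open>f : A \<rightarrow> B\<close>, \<open>dspec_map B A f\<close> maps the spectrum of \<open>B\<close> to that of \<open>A\<close>: as an arrow of
  the opposite category, \<open>f\<close> has domain \<open>B\<close> and codomain \<open>A\<close>.\<close>

definition dspec_map ::
  "'b dlat \<Rightarrow> 'a dlat \<Rightarrow> ('a \<Rightarrow> 'b) \<Rightarrow> ('b \<Rightarrow> bool \<times> bool) \<Rightarrow> ('a \<Rightarrow> bool \<times> bool)" where
  "dspec_map B A f = (\<lambda>p\<in>dlat_hom B dfour. compose (carrier A) p f)"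

definition dclop :: "'a bitop \<Rightarrow> ('a set \<times> 'a set) dlat" where
  "dclop X = \<lparr>
     carrier = {(U, V). openin (pos_top X) U \<and> closedin (neg_top X) U \<and>
                        openin (neg_top X) V \<and> closedin (pos_top X) V},
     eq = (=),
     le = (\<lambda>x y. fst x \<subseteq> fst y \<and> snd x \<subseteq> snd y),
     tt = (points X, {}), ff = ({}, points X),
     con = {(U, V). openin (pos_top X) U \<and> closedin (neg_top X) U \<and>
                    openin (neg_top X) V \<and> closedin (pos_top X) V \<and> U \<inter> V = {}},
     tot = {(U, V). openin (pos_top X) U \<and> closedin (neg_top X) U \<and>
                    openin (neg_top X) V \<and> closedin (pos_top X) V \<and> U \<union> V = points X}\<rparr>"

definition dclop_map ::
  "'b bitop \<Rightarrow> 'a bitop \<Rightarrow> ('a \<Rightarrow> 'b) \<Rightarrow> ('b set \<times> 'b set) \<Rightarrow> ('a set \<times> 'a set)" where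
  "dclop_map Y X f =
     (\<lambda>(U, V)\<in>carrier (dclop Y). (f -` U \<inter> points X, f -` V \<inter> points X))"

section \<open>Size\<close>

text \<open>
  A duality needs a universe of sets closed under powersets, which a type need not provide. There
  are two ways out, and the theorem asserts both. (1) Fix a type whose cardinality is a strong
  limit and call the sets of smaller cardinality small (a Grothendieck-style universe); then the
  categories of small objects are dually equivalent in the literal sense. (2) Make no assumption
  on sizes and let the two functors change the underlying type: \<open>dspec\<close> and \<open>dclop\<close> are defined
  polymorphically on the d-Boolean algebras and d-Boolean spaces over any type, and the units of the
  dual equivalence compare objects over different types.
\<close>

definition small :: "'u set set" where
  "small = {A. A \<prec> (UNIV :: 'u set)}"

definition strong_limit :: "'u itself \<Rightarrow> bool" where
  "strong_limit (_ :: 'u itself) \<longleftrightarrow>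
     (\<forall>A :: 'u set. A \<prec> (UNIV :: 'u set) \<longrightarrow> Pow A \<prec> (UNIV :: 'u set))"

end

theory Submission
  imports Defs
begin

text \<open>
  In a d-Boolean algebra the partners of the elements below \<open>tt\<close> and below \<open>ff\<close> are unique and
  order-reversing, and together they form an antitone involution \<open>star\<close> of the whole lattice that
  fixes \<open>tt\<close> and \<open>ff\<close> and determines \<open>con\<close> and \<open>tot\<close>. Hence a homomorphism to the
  four-element algebra amounts to a prime filter containing \<open>tt\<close>, and the prime filter theorem
  gives enough of them to recover the order, \<open>con\<close> and \<open>tot\<close>. Compactness of the spectrum is
  the same theorem applied to the filter and the ideal generated by a cover without finite
  subcover; it also shows that every clopen set comes from an element of the algebra. In the other
  direction, the points of a d-Boolean space are separated by clopen sets, and a homomorphism on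
  the clopen algebra that is not evaluation at a point would produce a finite clopen cover on which
  it vanishes, contradicting preservation of \<open>tot\<close>.
\<close>

section \<open>Lattices of sets\<close>

text \<open>The decisive axiom is \<open>con_tot\<close>: a member of \<open>con\<close> and a
  member of \<open>tot\<close> that share their part below \<open>tt\<close> or below
  \<open>ff\<close> are comparable. With \<open>con\<close> being a lower set, this forces
  uniqueness and antitonicity of partners. Each prime filter contains exactly one of
  \<open>tt\<close> and \<open>ff\<close>, and \<open>star\<close> links the two kinds: if
  \<open>M\<close> contains \<open>tt\<close>, the elements whose star lies outside \<open>M\<close>
  form a prime filter containing \<open>ff\<close>. These two filters are the two coordinates of one
  homomorphism to \<open>dfour\<close>. The obstacle is typing. A spectrum consists of functions and
  a clopen algebra of pairs of sets, so neither construction stays within its type, whereas the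
  literal dual equivalence has both categories over the same \<open>'u\<close>. Hence both
  constructions are developed up to a bijective coding of points or elements and used twice: with
  the identity for \<open>dspec\<close> and \<open>dclop\<close>, and with codings into
  \<open>'u\<close> for small objects. In the latter case the spectrum functor is shown fully
  faithful and essentially surjective, and the inverse functor arises by choice.\<close>

lemma (in partial_order) join_eqI:
  assumes "least L u (Upper L {x, y})"
  shows "x \<squnion> y = u"
  unfolding join_def sup_def using assms by (blast intro: least_unique)

lemma (in partial_order) meet_eqI:
  assumes "greatest L u (Lower L {x, y})"
  shows "x \<sqinter> y = u"
  unfolding meet_def inf_def using assms by (blast intro: greatest_unique)

text \<open>Joins and meets in HOL-Algebra are chosen bounds, awkward to compute from the order. A
  representation by a ring of sets containing the empty set and \<open>S\<close> supplies the bounds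
  and identifies the operations with union and intersection. It serves both the four-element algebra
  and the clopen algebras.\<close>

locale lattice_of_sets =
  fixes L :: "('a, 'b) gorder_scheme" (structure) and \<phi> :: "'a \<Rightarrow> 's set" and S :: "'s set"
  assumes eq_eq: "eq L = (=)"
    and rep_inj: "inj_on \<phi> (carrier L)"
    and rep_le: "\<lbrakk>x \<in> carrier L; y \<in> carrier L\<rbrakk> \<Longrightarrow> x \<sqsubseteq> y \<longleftrightarrow> \<phi> x \<subseteq> \<phi> y"
    and rep_Un: "\<lbrakk>x \<in> carrier L; y \<in> carrier L\<rbrakk> \<Longrightarrow> \<exists>z\<in>carrier L. \<phi> z = \<phi> x \<union> \<phi> y"
    and rep_Int: "\<lbrakk>x \<in> carrier L; y \<in> carrier L\<rbrakk> \<Longrightarrow> \<exists>z\<in>carrier L. \<phi> z = \<phi> x \<inter> \<phi> y"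
    and rep_empty: "\<exists>z\<in>carrier L. \<phi> z = {}"
    and rep_space: "\<exists>z\<in>carrier L. \<phi> z = S"
    and rep_bounded: "x \<in> carrier L \<Longrightarrow> \<phi> x \<subseteq> S"
begin

sublocale partial_order L
proof
  show "x .= y" if "x \<sqsubseteq> y" "y \<sqsubseteq> x" "x \<in> carrier L" "y \<in> carrier L" for x y
    using that rep_inj by (auto simp: eq_eq rep_le inj_on_def)
qed (use rep_inj in \<open>auto simp: eq_eq rep_le inj_on_def\<close>)

lemma join_least:
  assumes "x \<in> carrier L" "y \<in> carrier L" "z \<in> carrier L" "\<phi> z = \<phi> x \<union> \<phi> y"
  shows "least L z (Upper L {x, y})"
proof (rule least_UpperI)
  fix u assume "u \<in> Upper L {x, y}"
  then have "x \<sqsubseteq> u" "y \<sqsubseteq> u" "u \<in> carrier L"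
    using Upper_memD[of u L "{x, y}"] assms by auto
  then show "z \<sqsubseteq> u"
    using assms by (simp add: rep_le)
qed (use assms in \<open>auto simp: rep_le\<close>)

lemma meet_greatest:
  assumes "x \<in> carrier L" "y \<in> carrier L" "z \<in> carrier L" "\<phi> z = \<phi> x \<inter> \<phi> y"
  shows "greatest L z (Lower L {x, y})"
proof (rule greatest_LowerI)
  fix u assume "u \<in> Lower L {x, y}"
  then have "u \<sqsubseteq> x" "u \<sqsubseteq> y" "u \<in> carrier L"
    using Lower_memD[of u L "{x, y}"] assms by auto
  then show "u \<sqsubseteq> z"
    using assms by (simp add: rep_le)
qed (use assms in \<open>auto simp: rep_le\<close>)

sublocale bounded_lattice L
proof
  show "\<exists>s. least L s (Upper L {x, y})" if "x \<in> carrier L" "y \<in> carrier L" for x y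
    using that rep_Un join_least by meson
  show "\<exists>s. greatest L s (Lower L {x, y})" if "x \<in> carrier L" "y \<in> carrier L" for x y
    using that rep_Int meet_greatest by meson
  show "\<exists>x. least L x (carrier L)"
    unfolding least_def using rep_empty rep_le by (metis subset_iff empty_subsetI)
  show "\<exists>x. greatest L x (carrier L)"
    unfolding greatest_def using rep_space rep_bounded rep_le by (metis subset_iff)
qed

lemma rep_join: "\<lbrakk>x \<in> carrier L; y \<in> carrier L\<rbrakk> \<Longrightarrow> \<phi> (x \<squnion> y) = \<phi> x \<union> \<phi> y"
  using rep_Un[of x y] join_least join_eqI by metis

lemma rep_meet: "\<lbrakk>x \<in> carrier L; y \<in> carrier L\<rbrakk> \<Longrightarrow> \<phi> (x \<sqinter> y) = \<phi> x \<inter> \<phi> y"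
  using rep_Int[of x y] meet_greatest meet_eqI by metis

lemma rep_top: "\<phi> \<top> = S"
  using rep_space rep_bounded top_higher top_closed rep_le by (metis subset_antisym)

lemma rep_bottom: "\<phi> \<bottom> = {}"
  using rep_empty bottom_lower bottom_closed rep_le by (metis subset_empty)

end

section \<open>Prime filters\<close>

locale bounded_distributive_lattice = bounded_lattice +
  assumes distributive: "\<lbrakk>x \<in> carrier L; y \<in> carrier L; z \<in> carrier L\<rbrakk> \<Longrightarrow>
      x \<sqinter> (y \<squnion> z) = (x \<sqinter> y) \<squnion> (x \<sqinter> z)"

definition lattice_filter :: "('a, 'b) gorder_scheme \<Rightarrow> 'a set \<Rightarrow> bool" where
  "lattice_filter L F \<longleftrightarrow> F \<subseteq> carrier L \<and> \<top>\<^bsub>L\<^esub> \<in> F \<and> (\<forall>x\<in>F. \<forall>y\<in>F. x \<sqinter>\<^bsub>L\<^esub> y \<in> F) \<and>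
     (\<forall>x\<in>F. \<forall>y\<in>carrier L. x \<sqsubseteq>\<^bsub>L\<^esub> y \<longrightarrow> y \<in> F)"

text \<open>An ideal is a filter of the reversed order, so results on filters dualize through
  \<open>inv_gorder\<close>.\<close>

abbreviation lattice_ideal :: "('a, 'b) gorder_scheme \<Rightarrow> 'a set \<Rightarrow> bool" where
  "lattice_ideal L \<equiv> lattice_filter (inv_gorder L)"

text \<open>That the complement is an ideal packs properness (bottom is outside) and primeness
  (joins of outside elements stay outside) into one condition.\<close>

definition prime_filter :: "('a, 'b) gorder_scheme \<Rightarrow> 'a set \<Rightarrow> bool" where
  "prime_filter L F \<longleftrightarrow> lattice_filter L F \<and> lattice_ideal L (carrier L - F)"

lemma lattice_filterD:
  assumes "lattice_filter L F"
  shows "F \<subseteq> carrier L" "\<top>\<^bsub>L\<^esub> \<in> F"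
    and "x \<in> F \<Longrightarrow> y \<in> F \<Longrightarrow> x \<sqinter>\<^bsub>L\<^esub> y \<in> F"
    and "x \<in> F \<Longrightarrow> y \<in> carrier L \<Longrightarrow> x \<sqsubseteq>\<^bsub>L\<^esub> y \<Longrightarrow> y \<in> F"
  using assms by (simp_all add: lattice_filter_def)

lemma lattice_filterI:
  assumes "F \<subseteq> carrier L" "\<top>\<^bsub>L\<^esub> \<in> F"
    and "\<And>x y. x \<in> F \<Longrightarrow> y \<in> F \<Longrightarrow> x \<sqinter>\<^bsub>L\<^esub> y \<in> F"
    and "\<And>x y. x \<in> F \<Longrightarrow> y \<in> carrier L \<Longrightarrow> x \<sqsubseteq>\<^bsub>L\<^esub> y \<Longrightarrow> y \<in> F"
  shows "lattice_filter L F"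
  using assms by (simp add: lattice_filter_def)

lemma lattice_idealD:
  assumes "lattice_ideal L I"
  shows "I \<subseteq> carrier L" "\<bottom>\<^bsub>L\<^esub> \<in> I"
    and "x \<in> I \<Longrightarrow> y \<in> I \<Longrightarrow> x \<squnion>\<^bsub>L\<^esub> y \<in> I"
    and "x \<in> I \<Longrightarrow> y \<in> carrier L \<Longrightarrow> y \<sqsubseteq>\<^bsub>L\<^esub> x \<Longrightarrow> y \<in> I"
  using assms by (simp_all add: lattice_filter_def)

lemma lattice_idealI:
  assumes "I \<subseteq> carrier L" "\<bottom>\<^bsub>L\<^esub> \<in> I"
    and "\<And>x y. x \<in> I \<Longrightarrow> y \<in> I \<Longrightarrow> x \<squnion>\<^bsub>L\<^esub> y \<in> I"
    and "\<And>x y. x \<in> I \<Longrightarrow> y \<in> carrier L \<Longrightarrow> y \<sqsubseteq>\<^bsub>L\<^esub> x \<Longrightarrow> y \<in> I"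
  shows "lattice_ideal L I"
  using assms by (simp add: lattice_filter_def)

text \<open>The inductive form, in place of the usual description by finite meets, makes minimality
  and the finite dependence on generators plain inductions.\<close>

inductive_set generated_filter :: "('a, 'b) gorder_scheme \<Rightarrow> 'a set \<Rightarrow> 'a set"
  for L (structure) and S where
  top: "\<top> \<in> generated_filter L S"
| base: "x \<in> S \<Longrightarrow> x \<in> generated_filter L S"
| meet: "x \<in> generated_filter L S \<Longrightarrow> y \<in> generated_filter L S \<Longrightarrow> x \<sqinter> y \<in> generated_filter L S"
| up: "x \<in> generated_filter L S \<Longrightarrow> y \<in> carrier L \<Longrightarrow> x \<sqsubseteq> y \<Longrightarrow> y \<in> generated_filter L S"

abbreviation generated_ideal :: "('a, 'b) gorder_scheme \<Rightarrow> 'a set \<Rightarrow> 'a set" where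
  "generated_ideal L \<equiv> generated_filter (inv_gorder L)"

lemma generated_filter_least:
  assumes "lattice_filter L F" "S \<subseteq> F"
  shows "generated_filter L S \<subseteq> F"
proof
  fix x assume "x \<in> generated_filter L S"
  then show "x \<in> F"
    by induction (use assms in \<open>auto simp: lattice_filter_def\<close>)
qed

lemma generated_filter_mono: 
  assumes "S \<subseteq> T" shows "generated_filter L S \<subseteq> generated_filter L T"
proof
  fix x assume "x \<in> generated_filter L S"
  then show "x \<in> generated_filter L T"
    by induction (use assms in \<open>auto intro: generated_filter.intros\<close>)
qed

text \<open>A derivation of membership uses only finitely many generators. This is the source of
  compactness of the spectrum.\<close>

lemma generated_filter_finitary:
  assumes "x \<in> generated_filter L S"
  shows "\<exists>T. finite T \<and> T \<subseteq> S \<and> x \<in> generated_filter L T"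
  using assms
proof induction
  case top
  then show ?case
    by (meson empty_subsetI finite.emptyI generated_filter.top)
next
  case (base x)
  then show ?case
    by (intro exI[of _ "{x}"]) (auto intro: generated_filter.base)
next
  case (meet x y)
  then obtain T U where "finite T" "T \<subseteq> S" "x \<in> generated_filter L T"
    "finite U" "U \<subseteq> S" "y \<in> generated_filter L U"
    by blast
  then show ?case
    using generated_filter_mono[of T "T \<union> U" L] generated_filter_mono[of U "T \<union> U" L]
    by (intro exI[of _ "T \<union> U"]) (auto intro: generated_filter.meet)
next
  case (up x y)
  then show ?case
    by (meson generated_filter.up)
qed

context bounded_lattice
begin

lemma generated_filter_is_filter:
  assumes "S \<subseteq> carrier L"
  shows "lattice_filter L (generated_filter L S)"
proof -
  have closed: "x \<in> carrier L" if "x \<in> generated_filter L S" for x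
    using that
  proof induction
    case (base x)
    then show ?case using assms by blast
  qed simp_all
  show ?thesis
    unfolding lattice_filter_def
    by (intro conjI ballI impI subsetI;
        (erule closed | rule generated_filter.top | erule (1) generated_filter.meet
          | erule (2) generated_filter.up))
qed

lemma meet_mono:
  assumes "x \<sqsubseteq> x'" "y \<sqsubseteq> y'" "x \<in> carrier L" "y \<in> carrier L" "x' \<in> carrier L" "y' \<in> carrier L"
  shows "x \<sqinter> y \<sqsubseteq> x' \<sqinter> y'"
proof (rule meet_le)
  show "x \<sqinter> y \<sqsubseteq> x'"
    by (rule le_trans[of _ x]) (simp_all add: assms meet_left)
  show "x \<sqinter> y \<sqsubseteq> y'"
    by (rule le_trans[of _ y]) (simp_all add: assms meet_right)
qed (simp_all add: assms)

lemma dual_bounded_lattice: "bounded_lattice (inv_gorder L)"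
proof -
  interpret dual: lattice "inv_gorder L"
    by (rule dual_lattice)
  show ?thesis
    by unfold_locales (use bottom_exists top_exists in auto)
qed

lemma generated_ideal_is_ideal:
  assumes "S \<subseteq> carrier L"
  shows "lattice_ideal L (generated_ideal L S)"
  using bounded_lattice.generated_filter_is_filter[OF dual_bounded_lattice] assms by simp

lemma principal_filter: "x \<in> carrier L \<Longrightarrow> lattice_filter L {y \<in> carrier L. x \<sqsubseteq> y}"
  by (auto simp: lattice_filter_def intro: meet_le le_trans)

lemma principal_ideal: "x \<in> carrier L \<Longrightarrow> lattice_ideal L {y \<in> carrier L. y \<sqsubseteq> x}"
  using bounded_lattice.principal_filter[OF dual_bounded_lattice] by simp

lemma prime_filterD:
  assumes "prime_filter L F"
  shows "F \<subseteq> carrier L" "\<top> \<in> F" "\<bottom> \<notin> F"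
    and "\<lbrakk>x \<in> carrier L; y \<in> carrier L\<rbrakk> \<Longrightarrow> x \<sqinter> y \<in> F \<longleftrightarrow> x \<in> F \<and> y \<in> F"
    and "\<lbrakk>x \<in> carrier L; y \<in> carrier L\<rbrakk> \<Longrightarrow> x \<squnion> y \<in> F \<longleftrightarrow> x \<in> F \<or> y \<in> F"
proof -
  have F: "lattice_filter L F" and I: "lattice_ideal L (carrier L - F)"
    using assms by (simp_all add: prime_filter_def)
  show "F \<subseteq> carrier L" "\<top> \<in> F" "\<bottom> \<notin> F"
    using lattice_filterD(1,2)[OF F] lattice_idealD(2)[OF I] by simp_all
  assume xy: "x \<in> carrier L" "y \<in> carrier L"
  show "x \<sqinter> y \<in> F \<longleftrightarrow> x \<in> F \<and> y \<in> F"
    using lattice_filterD(3)[OF F, of x y] lattice_filterD(4)[OF F _ xy(1), of "x \<sqinter> y"]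
      lattice_filterD(4)[OF F _ xy(2), of "x \<sqinter> y"] meet_left[OF xy] meet_right[OF xy] by blast
  show "x \<squnion> y \<in> F \<longleftrightarrow> x \<in> F \<or> y \<in> F"
    using lattice_filterD(4)[OF F _ join_closed[OF xy], of x] join_left[OF xy] join_right[OF xy]
      lattice_filterD(4)[OF F _ join_closed[OF xy], of y] lattice_idealD(3)[OF I, of x y] xy by blast
qed

end

text \<open>This is the filter generated by \<open>F\<close> and \<open>x\<close>, in the form in
  which it contradicts maximality in the prime filter theorem.\<close>

lemma (in bounded_distributive_lattice) filter_adjoin:
  assumes F: "lattice_filter L F" and x: "x \<in> carrier L"
  shows "lattice_filter L {z \<in> carrier L. \<exists>m\<in>F. m \<sqinter> x \<sqsubseteq> z}"
  unfolding lattice_filter_def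
proof (intro conjI ballI impI)
  show "\<top> \<in> {z \<in> carrier L. \<exists>m\<in>F. m \<sqinter> x \<sqsubseteq> z}"
    using F x by (auto simp: lattice_filter_def intro: bexI[of _ \<top>])
next
  fix y z assume "y \<in> {z \<in> carrier L. \<exists>m\<in>F. m \<sqinter> x \<sqsubseteq> z}" "z \<in> {z \<in> carrier L. \<exists>m\<in>F. m \<sqinter> x \<sqsubseteq> z}"
  then obtain m n where m: "m \<in> F" "m \<sqinter> x \<sqsubseteq> y" "y \<in> carrier L"
    and n: "n \<in> F" "n \<sqinter> x \<sqsubseteq> z" "z \<in> carrier L" by blast
  have c: "m \<in> carrier L" "n \<in> carrier L" "m \<sqinter> n \<in> F"
    using F m n by (auto simp: lattice_filter_def)
  have "(m \<sqinter> n) \<sqinter> x \<sqsubseteq> m \<sqinter> x" "(m \<sqinter> n) \<sqinter> x \<sqsubseteq> n \<sqinter> x"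
    using c x by (auto intro!: meet_mono meet_left meet_right)
  then have "(m \<sqinter> n) \<sqinter> x \<sqsubseteq> y \<sqinter> z"
    using c x m n by (meson le_trans meet_closed meet_le)
  then show "y \<sqinter> z \<in> {z \<in> carrier L. \<exists>m\<in>F. m \<sqinter> x \<sqsubseteq> z}"
    using c m n by auto
next
  fix y z assume *: "y \<in> {z \<in> carrier L. \<exists>m\<in>F. m \<sqinter> x \<sqsubseteq> z}" "z \<in> carrier L" "y \<sqsubseteq> z"
  then obtain m where m: "m \<in> F" "m \<sqinter> x \<sqsubseteq> y" "m \<in> carrier L"
    using F by (auto simp: lattice_filter_def)
  then have "m \<sqinter> x \<sqsubseteq> z"
    using * x by (auto intro: le_trans)
  then show "z \<in> {z \<in> carrier L. \<exists>m\<in>F. m \<sqinter> x \<sqsubseteq> z}"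
    using * m by blast
qed auto

text \<open>Zorn's lemma gives a filter maximal among those that contain \<open>F\<close> and miss
  \<open>I\<close>. Maximality together with distributivity forces it to be prime.\<close>

theorem (in bounded_distributive_lattice) prime_filter_exists:
  assumes F: "lattice_filter L F" and I: "lattice_ideal L I" and FI: "F \<inter> I = {}"
  obtains M where "prime_filter L M" "F \<subseteq> M" "M \<inter> I = {}"
proof -
  define \<A> where "\<A> = {M. lattice_filter L M \<and> F \<subseteq> M \<and> M \<inter> I = {}}"
  have "\<exists>M\<in>\<A>. \<forall>X\<in>\<A>. M \<subseteq> X \<longrightarrow> X = M"
  proof (rule subset_Zorn_nonempty)
    show "\<A> \<noteq> {}" using F FI by (auto simp: \<A>_def)
  next
    fix \<C> assume ne: "\<C> \<noteq> {}" and ch: "subset.chain \<A> \<C>"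
    have mem: "lattice_filter L X" "F \<subseteq> X" "X \<inter> I = {}" if "X \<in> \<C>" for X
      using ch that by (auto simp: subset.chain_def \<A>_def)
    have tot: "X \<subseteq> Y \<or> Y \<subseteq> X" if "X \<in> \<C>" "Y \<in> \<C>" for X Y
      using ch that by (auto simp: subset.chain_def)
    have "x \<sqinter> y \<in> \<Union>\<C>" if xy: "x \<in> \<Union>\<C>" "y \<in> \<Union>\<C>" for x y
    proof -
      obtain X Y where "X \<in> \<C>" "Y \<in> \<C>" "x \<in> X" "y \<in> Y"
        using xy by blast
      then obtain Z where Z: "Z \<in> \<C>" "x \<in> Z" "y \<in> Z"
        using tot[of X Y] by (meson subsetD)
      then have "x \<sqinter> y \<in> Z"
        using mem(1)[OF Z(1)] by (simp add: lattice_filter_def)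
      then show ?thesis
        using Z by blast
    qed
    moreover obtain X where X: "X \<in> \<C>"
      using ne by blast
    then have "\<top> \<in> \<Union>\<C>" "F \<subseteq> \<Union>\<C>"
      using mem[OF X] by (auto simp: lattice_filter_def)
    moreover have "y \<in> \<Union>\<C>" if "x \<in> \<Union>\<C>" "y \<in> carrier L" "x \<sqsubseteq> y" for x y
      using that mem(1) unfolding lattice_filter_def by (meson Union_iff)
    moreover have "\<Union>\<C> \<inter> I = {}"
      using mem(3) by blast
    moreover have "\<Union>\<C> \<subseteq> carrier L"
      using mem(1) unfolding lattice_filter_def by blast
    ultimately show "\<Union>\<C> \<in> \<A>"
      unfolding \<A>_def lattice_filter_def by blast
  qed
  then obtain M where MA: "M \<in> \<A>" and maxA: "\<forall>X\<in>\<A>. M \<subseteq> X \<longrightarrow> X = M"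
    by (rule bexE)
  have M: "lattice_filter L M" "F \<subseteq> M" "M \<inter> I = {}"
    using MA by (simp_all add: \<A>_def)
  have max: "X = M" if "lattice_filter L X" "M \<subseteq> X" "X \<inter> I = {}" for X
    using that M(2) maxA by (simp add: \<A>_def)
  have Mc: "\<And>x. x \<in> M \<Longrightarrow> x \<in> carrier L" and Ic: "\<And>x. x \<in> I \<Longrightarrow> x \<in> carrier L"
    using lattice_filterD(1)[OF M(1)] lattice_idealD(1)[OF I] by (simp_all add: subset_iff)
  \<comment> \<open>By maximality the filter obtained by adjoining \<open>x\<close> meets
    \<open>I\<close>; since \<open>I\<close> is a lower set, some \<open>m \<sqinter> x\<close> lies
    in \<open>I\<close> itself.\<close>
  have meets_I: "\<exists>m\<in>M. m \<sqinter> x \<in> I" if x: "x \<in> carrier L" "x \<notin> M" for x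
  proof -
    let ?X = "{z \<in> carrier L. \<exists>m\<in>M. m \<sqinter> x \<sqsubseteq> z}"
    have "\<top> \<sqinter> x \<sqsubseteq> x"
      using x by (simp add: meet_right)
    then have xX: "x \<in> ?X"
      using x lattice_filterD(2)[OF M(1)] by blast
    have MX: "M \<subseteq> ?X"
      using Mc x meet_left by blast
    have "?X \<inter> I \<noteq> {}"
    proof
      assume "?X \<inter> I = {}"
      then have "?X = M"
        by (rule max[OF filter_adjoin[OF M(1) x(1)] MX])
      then show False
        using xX x(2) by simp
    qed
    then obtain z m where zm: "z \<in> I" "m \<in> M" "m \<sqinter> x \<sqsubseteq> z"
      by blast
    then have "m \<sqinter> x \<in> I"
      using lattice_idealD(4)[OF I zm(1)] Mc x by simp
    then show ?thesis
      using zm by blast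
  qed
  have prime: "x \<squnion> y \<notin> M" if x: "x \<in> carrier L" "x \<notin> M" and y: "y \<in> carrier L" "y \<notin> M" for x y
  proof
    assume xy: "x \<squnion> y \<in> M"
    obtain m where m: "m \<in> M" "m \<sqinter> x \<in> I"
      using meets_I[OF x] by blast
    obtain n where n: "n \<in> M" "n \<sqinter> y \<in> I"
      using meets_I[OF y] by blast
    have c: "m \<in> carrier L" "n \<in> carrier L" "m \<sqinter> n \<in> carrier L"
      using m n Mc by simp_all
    have mn: "(m \<sqinter> n) \<sqinter> (x \<squnion> y) \<in> M"
      by (intro lattice_filterD(3)[OF M(1)] m n xy)
    have "(m \<sqinter> n) \<sqinter> x \<sqsubseteq> m \<sqinter> x" "(m \<sqinter> n) \<sqinter> y \<sqsubseteq> n \<sqinter> y"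
      using c x y by (simp_all add: meet_mono meet_left meet_right)
    then have "(m \<sqinter> n) \<sqinter> x \<in> I" "(m \<sqinter> n) \<sqinter> y \<in> I"
      using lattice_idealD(4)[OF I m(2)] lattice_idealD(4)[OF I n(2)] c x y by simp_all
    \<comment> \<open>Distributivity splits this element into two members of \<open>I\<close>, yet
      it also belongs to \<open>M\<close>, which misses \<open>I\<close>.\<close>
    then have "(m \<sqinter> n) \<sqinter> (x \<squnion> y) \<in> I"
      using lattice_idealD(3)[OF I] c x y by (simp add: distributive)
    then show False
      using mn M(3) by blast
  qed
  have "lattice_ideal L (carrier L - M)"
  proof (rule lattice_idealI)
    show "\<bottom> \<in> carrier L - M"
      using M(3) lattice_idealD(2)[OF I] by auto
    show "x \<squnion> y \<in> carrier L - M" if "x \<in> carrier L - M" "y \<in> carrier L - M" for x y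
      using prime that by simp
    show "y \<in> carrier L - M" if "x \<in> carrier L - M" "y \<in> carrier L" "y \<sqsubseteq> x" for x y
      using lattice_filterD(4)[OF M(1)] that by blast
  qed simp
  then have "prime_filter L M"
    using M by (simp add: prime_filter_def)
  then show ?thesis
    using that M by blast
qed

context bounded_distributive_lattice
begin

text \<open>If \<open>x\<close> is not below \<open>y\<close>, the principal filter of
  \<open>x\<close> misses the principal ideal of \<open>y\<close>, and a prime filter separates
  them. From here on, many lattice identities and inequalities are verified as propositional facts
  about membership in a prime filter.\<close>

lemma le_iff_prime_filters:
  assumes "x \<in> carrier L" "y \<in> carrier L"
  shows "x \<sqsubseteq> y \<longleftrightarrow> (\<forall>M. prime_filter L M \<longrightarrow> x \<in> M \<longrightarrow> y \<in> M)"
proof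
  assume "x \<sqsubseteq> y"
  then show "\<forall>M. prime_filter L M \<longrightarrow> x \<in> M \<longrightarrow> y \<in> M"
    using assms lattice_filterD(4) unfolding prime_filter_def by metis
next
  assume *: "\<forall>M. prime_filter L M \<longrightarrow> x \<in> M \<longrightarrow> y \<in> M"
  show "x \<sqsubseteq> y"
  proof (rule ccontr)
    assume "\<not> x \<sqsubseteq> y"
    then have "{z \<in> carrier L. x \<sqsubseteq> z} \<inter> {z \<in> carrier L. z \<sqsubseteq> y} = {}"
      using assms by (auto intro: le_trans)
    from prime_filter_exists[OF principal_filter[OF assms(1)] principal_ideal[OF assms(2)] this]
    obtain M where "prime_filter L M" "{z \<in> carrier L. x \<sqsubseteq> z} \<subseteq> M"
      "M \<inter> {z \<in> carrier L. z \<sqsubseteq> y} = {}" .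
    then show False
      using * assms le_refl by blast
  qed
qed

lemma eq_iff_prime_filters:
  assumes "x \<in> carrier L" "y \<in> carrier L"
  shows "x = y \<longleftrightarrow> (\<forall>M. prime_filter L M \<longrightarrow> (x \<in> M \<longleftrightarrow> y \<in> M))"
proof
  assume "\<forall>M. prime_filter L M \<longrightarrow> (x \<in> M \<longleftrightarrow> y \<in> M)"
  then have "x \<sqsubseteq> y" "y \<sqsubseteq> x"
    by (simp_all add: le_iff_prime_filters assms)
  then show "x = y"
    using assms by (rule le_antisym)
qed simp

end

section \<open>The involution of a d-Boolean algebra\<close>

sublocale d_lattice \<subseteq> bounded_distributive_lattice
  by unfold_locales (rule distrib)

context d_lattice
begin

text \<open>A prime filter picks exactly one member of a complementary pair, so prime filters come
  in two kinds, those over \<open>tt\<close> and those over \<open>ff\<close>.\<close>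

lemma ff_in_prime_iff:
  assumes "prime_filter L M"
  shows "ff L \<in> M \<longleftrightarrow> tt L \<notin> M"
  using prime_filterD(2,3)[OF assms] prime_filterD(4,5)[OF assms tt_carrier ff_carrier]
    tt_join_ff tt_meet_ff by auto

text \<open>In the decomposition of the lattice into the product of its parts below
  \<open>tt\<close> and below \<open>ff\<close>, this element has the first coordinate of
  \<open>x\<close> and the second of \<open>y\<close>.\<close>

definition mix :: "'a \<Rightarrow> 'a \<Rightarrow> 'a" where
  "mix x y = (x \<sqinter> tt L) \<squnion> (y \<sqinter> ff L)"

lemma mix_closed [simp]: "\<lbrakk>x \<in> carrier L; y \<in> carrier L\<rbrakk> \<Longrightarrow> mix x y \<in> carrier L"
  by (simp add: mix_def tt_carrier ff_carrier)

lemma mix_in_prime_iff: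
  assumes "prime_filter L M" "x \<in> carrier L" "y \<in> carrier L"
  shows "mix x y \<in> M \<longleftrightarrow> (if tt L \<in> M then x \<in> M else y \<in> M)"
  using assms by (simp add: mix_def prime_filterD tt_carrier ff_carrier ff_in_prime_iff)

lemmas prime_simps = prime_filterD(4,5) ff_in_prime_iff mix_in_prime_iff tt_carrier ff_carrier

lemma mix_mono:
  assumes "x \<sqsubseteq> x'" "y \<sqsubseteq> y'" "x \<in> carrier L" "y \<in> carrier L" "x' \<in> carrier L" "y' \<in> carrier L"
  shows "mix x y \<sqsubseteq> mix x' y'"
  using assms by (simp add: le_iff_prime_filters prime_simps)

lemma mix_self [simp]: "x \<in> carrier L \<Longrightarrow> mix x x = x"
  by (simp add: eq_iff_prime_filters prime_simps)

lemma mix_meet_tt: "\<lbrakk>x \<in> carrier L; y \<in> carrier L\<rbrakk> \<Longrightarrow> mix x y \<sqinter> tt L = x \<sqinter> tt L"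
  by (auto simp: eq_iff_prime_filters prime_simps)

lemma mix_meet_ff: "\<lbrakk>x \<in> carrier L; y \<in> carrier L\<rbrakk> \<Longrightarrow> mix x y \<sqinter> ff L = y \<sqinter> ff L"
  by (auto simp: eq_iff_prime_filters prime_simps)

lemma mix_le_iff:
  assumes "x \<in> carrier L" "y \<in> carrier L" "z \<in> carrier L"
  shows "mix x y \<sqsubseteq> z \<longleftrightarrow> x \<sqinter> tt L \<sqsubseteq> z \<and> y \<sqinter> ff L \<sqsubseteq> z"
  using assms by (auto simp: le_iff_prime_filters prime_simps)

lemma le_mixI:
  assumes "x \<sqinter> tt L \<sqsubseteq> y" "x \<sqinter> ff L \<sqsubseteq> y'" "x \<in> carrier L" "y \<in> carrier L" "y' \<in> carrier L"
  shows "x \<sqsubseteq> mix y y'"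
  using assms by (simp add: le_iff_prime_filters prime_simps)

text \<open>The axiom \<open>con_tot\<close> in coordinates: a common first coordinate makes the
  second ones comparable. \<open>con_tot_left\<close> is the mirror image.\<close>

lemma con_tot_right:
  assumes "mix x y \<in> con L" "mix x y' \<in> tot L" "x \<in> carrier L" "y \<in> carrier L" "y' \<in> carrier L"
  shows "y \<sqinter> ff L \<sqsubseteq> y'"
proof -
  have "mix x y \<sqsubseteq> mix x y'"
    using con_tot[OF assms(1,2)] assms by (simp add: mix_meet_tt)
  then show ?thesis
    using assms by (auto simp: le_iff_prime_filters prime_simps)
qed

lemma con_tot_left:
  assumes "mix x y \<in> con L" "mix x' y \<in> tot L" "x \<in> carrier L" "x' \<in> carrier L" "y \<in> carrier L"
  shows "x \<sqinter> tt L \<sqsubseteq> x'"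
proof -
  have "mix x y \<sqsubseteq> mix x' y"
    using con_tot[OF assms(1,2)] assms by (simp add: mix_meet_ff)
  then show ?thesis
    using assms by (auto simp: le_iff_prime_filters prime_simps)
qed

end

locale d_boolean = d_lattice +
  assumes pos_partner: "a \<in> pos_part L \<Longrightarrow> \<exists>a'\<in>neg_part L. a \<squnion> a' \<in> con L \<inter> tot L"
    and neg_partner: "b \<in> neg_part L \<Longrightarrow> \<exists>b'\<in>pos_part L. b' \<squnion> b \<in> con L \<inter> tot L"

lemma d_boolean_algebra_iff: "d_boolean_algebra L \<longleftrightarrow> d_boolean L"
  by (simp add: d_boolean_algebra_def d_boolean_def d_boolean_axioms_def Ball_def)

context d_boolean
begin

text \<open>
  A conjugate of \<open>x\<close> has the partner of \<open>x \<sqinter> ff\<close> as its part below \<open>tt\<close>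
  and the partner of \<open>x \<sqinter> tt\<close> as its part below \<open>ff\<close>.
\<close>

definition conjugate :: "'a \<Rightarrow> 'a \<Rightarrow> bool" where
  "conjugate x y \<longleftrightarrow> x \<in> carrier L \<and> y \<in> carrier L \<and>
     mix x y \<in> con L \<inter> tot L \<and> mix y x \<in> con L \<inter> tot L"

lemma conjugate_sym: "conjugate x y \<Longrightarrow> conjugate y x"
  by (simp add: conjugate_def)

lemma conjugate_exists:
  assumes x: "x \<in> carrier L"
  shows "\<exists>y. conjugate x y"
proof -
  have "x \<sqinter> tt L \<in> pos_part L" "x \<sqinter> ff L \<in> neg_part L"
    using x by (simp_all add: pos_part_def neg_part_def tt_carrier ff_carrier meet_right)
  then obtain a b where a: "a \<in> neg_part L" "(x \<sqinter> tt L) \<squnion> a \<in> con L \<inter> tot L"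
    and b: "b \<in> pos_part L" "b \<squnion> (x \<sqinter> ff L) \<in> con L \<inter> tot L"
    using pos_partner neg_partner by blast
  have ca: "a \<in> carrier L" "a \<sqsubseteq> ff L" and cb: "b \<in> carrier L" "b \<sqsubseteq> tt L"
    using a b by (simp_all add: neg_part_def pos_part_def)
  \<comment> \<open>As \<open>b\<close> is below \<open>tt\<close> and \<open>a\<close> below
    \<open>ff\<close>, restricting \<open>b \<squnion> a\<close> to \<open>ff\<close> leaves
    \<open>a\<close> and restricting it to \<open>tt\<close> leaves \<open>b\<close>. So one element
    carries both partners.\<close>
  have "mix x (b \<squnion> a) = (x \<sqinter> tt L) \<squnion> a" "mix (b \<squnion> a) x = b \<squnion> (x \<sqinter> ff L)"
    using x ca cb by (auto simp: eq_iff_prime_filters le_iff_prime_filters prime_simps)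
  then show ?thesis
    using x a b ca cb by (intro exI[of _ "b \<squnion> a"]) (simp add: conjugate_def)
qed

text \<open>Lowering \<open>x'\<close> to \<open>x\<close> keeps \<open>mix x y'\<close> in
  \<open>con\<close>, while \<open>mix x y\<close> is in \<open>tot\<close> and has the same first
  coordinate; hence the \<open>ff\<close> part of \<open>y'\<close> is below \<open>y\<close>. The
  mirrored argument treats the \<open>tt\<close> part. With equal \<open>x\<close> and
  \<open>x'\<close> this yields uniqueness of the conjugate.\<close>

lemma conjugate_antimono:
  assumes "conjugate x y" "conjugate x' y'" "x \<sqsubseteq> x'"
  shows "y' \<sqsubseteq> y"
proof -
  have c: "x \<in> carrier L" "y \<in> carrier L" "x' \<in> carrier L" "y' \<in> carrier L"
    using assms by (simp_all add: conjugate_def)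
  have "mix x y' \<sqsubseteq> mix x' y'" "mix y' x \<sqsubseteq> mix y' x'"
    using assms(3) c by (simp_all add: mix_mono)
  then have "mix x y' \<in> con L" "mix y' x \<in> con L"
    using con_lower[of "mix x' y'" "mix x y'"] con_lower[of "mix y' x'" "mix y' x"] assms(2) c
    by (simp_all add: conjugate_def)
  then have "y' \<sqinter> ff L \<sqsubseteq> y" "y' \<sqinter> tt L \<sqsubseteq> y"
    using con_tot_right[of x y' y] con_tot_left[of y' x y] assms(1) c
    by (simp_all add: conjugate_def)
  then have "y' \<sqsubseteq> mix y y"
    using c by (intro le_mixI) simp_all
  then show ?thesis
    using c by simp
qed

definition star :: "'a \<Rightarrow> 'a" where
  "star x = (SOME y. conjugate x y)"

lemma conjugate_star: "x \<in> carrier L \<Longrightarrow> conjugate x (star x)"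
  unfolding star_def by (rule someI_ex) (rule conjugate_exists)

lemma star_closed [simp]: "x \<in> carrier L \<Longrightarrow> star x \<in> carrier L"
  using conjugate_star[of x] by (simp add: conjugate_def)

lemma star_eqI:
  assumes "conjugate x y"
  shows "star x = y"
proof -
  have c: "x \<in> carrier L" "y \<in> carrier L"
    using assms by (simp_all add: conjugate_def)
  then have "star x \<sqsubseteq> y" "y \<sqsubseteq> star x"
    using conjugate_antimono[OF assms conjugate_star] conjugate_antimono[OF conjugate_star assms]
    by simp_all
  then show ?thesis
    using c by (intro le_antisym) simp_all
qed

lemma star_star [simp]: "x \<in> carrier L \<Longrightarrow> star (star x) = x"
  by (rule star_eqI[OF conjugate_sym[OF conjugate_star]])

lemma star_antimono: "\<lbrakk>x \<sqsubseteq> y; x \<in> carrier L; y \<in> carrier L\<rbrakk> \<Longrightarrow> star y \<sqsubseteq> star x"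
  by (rule conjugate_antimono[OF conjugate_star conjugate_star])

lemma le_star_swap: "\<lbrakk>x \<sqsubseteq> star y; x \<in> carrier L; y \<in> carrier L\<rbrakk> \<Longrightarrow> y \<sqsubseteq> star x"
  using star_antimono[of x "star y"] by simp

text \<open>De Morgan's law holds for any antitone involution.\<close>

lemma star_join:
  assumes "x \<in> carrier L" "y \<in> carrier L"
  shows "star (x \<squnion> y) = star x \<sqinter> star y"
proof (rule le_antisym)
  show "star (x \<squnion> y) \<sqsubseteq> star x \<sqinter> star y"
    using assms by (intro meet_le star_antimono) (simp_all add: join_left join_right)
  have "x \<squnion> y \<sqsubseteq> star (star x \<sqinter> star y)"
    using assms by (intro join_le le_star_swap[of "star x \<sqinter> star y"]) (simp_all add: meet_left meet_right)
  then show "star x \<sqinter> star y \<sqsubseteq> star (x \<squnion> y)"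
    using assms by (intro le_star_swap[of "x \<squnion> y"]) simp_all
qed (use assms in simp_all)

lemma star_meet:
  assumes "x \<in> carrier L" "y \<in> carrier L"
  shows "star (x \<sqinter> y) = star x \<squnion> star y"
  using star_join[of "star x" "star y"] star_star[of "star x \<squnion> star y"] assms by simp

lemma star_tt [simp]: "star (tt L) = tt L"
  by (rule star_eqI) (simp add: conjugate_def tt_carrier tt_con tt_tot)

lemma star_ff [simp]: "star (ff L) = ff L"
  by (rule star_eqI) (simp add: conjugate_def ff_carrier ff_con ff_tot)

lemma star_top [simp]: "star \<top> = \<bottom>"
proof (rule star_eqI)
  have "mix \<top> \<bottom> = tt L" "mix \<bottom> \<top> = ff L"
    by (simp_all add: eq_iff_prime_filters prime_simps prime_filterD)
  then show "conjugate \<top> \<bottom>"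
    by (simp add: conjugate_def tt_con tt_tot ff_con ff_tot)
qed

lemma star_bottom [simp]: "star \<bottom> = \<top>"
  using star_star[of \<top>] by simp

lemma mix_star_con: "x \<in> carrier L \<Longrightarrow> mix x (star x) \<in> con L"
  and mix_star_tot: "x \<in> carrier L \<Longrightarrow> mix x (star x) \<in> tot L"
  and star_mix_con: "x \<in> carrier L \<Longrightarrow> mix (star x) x \<in> con L"
  and star_mix_tot: "x \<in> carrier L \<Longrightarrow> mix (star x) x \<in> tot L"
  using conjugate_star[of x] by (simp_all add: conjugate_def)

text \<open>The elements \<open>x\<close> and \<open>mix (star x) x\<close> share their
  \<open>ff\<close> part, and the latter lies in both \<open>con\<close> and \<open>tot\<close>. So
  \<open>con_tot\<close> gives one direction and the lower set property the other. The right-hand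
  side can be tested on prime filters over \<open>tt\<close>, which is why points detect
  \<open>con\<close>.\<close>

lemma con_iff:
  assumes x: "x \<in> carrier L"
  shows "x \<in> con L \<longleftrightarrow> x \<sqinter> tt L \<sqsubseteq> star x"
proof
  assume "x \<in> con L"
  then show "x \<sqinter> tt L \<sqsubseteq> star x"
    using con_tot_left[of x x "star x"] star_mix_tot[OF x] x by simp
next
  assume "x \<sqinter> tt L \<sqsubseteq> star x"
  then have "x \<sqsubseteq> mix (star x) x"
    by (rule le_mixI[OF _ meet_left[OF x ff_carrier] x star_closed[OF x] x])
  then show "x \<in> con L"
    using con_lower[OF star_mix_con[OF x] x] by simp
qed

lemma tot_iff:
  assumes x: "x \<in> carrier L"
  shows "x \<in> tot L \<longleftrightarrow> star x \<sqinter> tt L \<sqsubseteq> x"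
proof
  assume "x \<in> tot L"
  then show "star x \<sqinter> tt L \<sqsubseteq> x"
    using con_tot_left[of "star x" x x] star_mix_con[OF x] x by simp
next
  assume "star x \<sqinter> tt L \<sqsubseteq> x"
  then have "mix (star x) x \<sqsubseteq> x"
    using mix_le_iff[OF star_closed[OF x] x x] meet_left[OF x ff_carrier] by blast
  then show "x \<in> tot L"
    using tot_upper[OF star_mix_tot[OF x] x] by simp
qed

end

section \<open>Homomorphisms to the four-element algebra\<close>

text \<open>A pair of truth values is read as the characteristic function of a subset of
  \<open>bool\<close>, which makes the four-element algebra a lattice of sets.\<close>

definition flags :: "bool \<times> bool \<Rightarrow> bool set" where
  "flags x = {b. if b then fst x else snd x}"

lemma flags_subset_iff: "flags x \<subseteq> flags y \<longleftrightarrow> (fst x \<longrightarrow> fst y) \<and> (snd x \<longrightarrow> snd y)"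
  by (auto simp: flags_def subset_iff)

lemma flags_eq_iff: "flags x = flags y \<longleftrightarrow> x = y"
  by (auto simp: set_eq_subset flags_subset_iff prod_eq_iff)

lemma flags_simps:
  "flags x \<union> flags y = flags (fst x \<or> fst y, snd x \<or> snd y)"
  "flags x \<inter> flags y = flags (fst x \<and> fst y, snd x \<and> snd y)"
  "{} = flags (False, False)"
  "UNIV = flags (True, True)"
  by (auto simp: flags_def)

interpretation dfour: lattice_of_sets dfour flags UNIV
  by unfold_locales
    (auto simp: dfour_def inj_on_def flags_subset_iff flags_eq_iff flags_simps)

lemma dfour_simps [simp]:
  "carrier dfour = UNIV"
  "tt dfour = (True, False)"
  "ff dfour = (False, True)"
  "x \<in> con dfour \<longleftrightarrow> \<not> (fst x \<and> snd x)"
  "x \<in> tot dfour \<longleftrightarrow> fst x \<or> snd x"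
  by (simp_all add: dfour_def)

lemma dfour_join [simp]: "x \<squnion>\<^bsub>dfour\<^esub> y = (fst x \<or> fst y, snd x \<or> snd y)"
  using dfour.rep_join[of x y] by (simp add: flags_simps flags_eq_iff)

lemma dfour_meet [simp]: "x \<sqinter>\<^bsub>dfour\<^esub> y = (fst x \<and> fst y, snd x \<and> snd y)"
  using dfour.rep_meet[of x y] by (simp add: flags_simps flags_eq_iff)

lemma dfour_top [simp]: "\<top>\<^bsub>dfour\<^esub> = (True, True)"
  using dfour.rep_top by (simp add: flags_simps flags_eq_iff)

lemma dfour_bottom [simp]: "\<bottom>\<^bsub>dfour\<^esub> = (False, False)"
  using dfour.rep_bottom by (simp add: flags_simps flags_eq_iff)

lemma dlat_homD:
  assumes "f \<in> dlat_hom A B"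
  shows "f \<in> carrier A \<rightarrow>\<^sub>E carrier B"
    and "x \<in> carrier A \<Longrightarrow> f x \<in> carrier B"
    and "\<lbrakk>x \<in> carrier A; y \<in> carrier A\<rbrakk> \<Longrightarrow> f (x \<squnion>\<^bsub>A\<^esub> y) = f x \<squnion>\<^bsub>B\<^esub> f y"
    and "\<lbrakk>x \<in> carrier A; y \<in> carrier A\<rbrakk> \<Longrightarrow> f (x \<sqinter>\<^bsub>A\<^esub> y) = f x \<sqinter>\<^bsub>B\<^esub> f y"
    and "f \<top>\<^bsub>A\<^esub> = \<top>\<^bsub>B\<^esub>" "f \<bottom>\<^bsub>A\<^esub> = \<bottom>\<^bsub>B\<^esub>" "f (tt A) = tt B" "f (ff A) = ff B"
    and "x \<in> con A \<Longrightarrow> f x \<in> con B" "x \<in> tot A \<Longrightarrow> f x \<in> tot B"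
  using assms by (auto simp: dlat_hom_def)

abbreviation homs4 :: "'a dlat \<Rightarrow> ('a \<Rightarrow> bool \<times> bool) set" where
  "homs4 A \<equiv> dlat_hom A dfour"

context d_boolean
begin

lemma homs4_simps:
  assumes "p \<in> homs4 L" "x \<in> carrier L" "y \<in> carrier L"
  shows "p (x \<squnion> y) = (fst (p x) \<or> fst (p y), snd (p x) \<or> snd (p y))"
    and "p (x \<sqinter> y) = (fst (p x) \<and> fst (p y), snd (p x) \<and> snd (p y))"
  using dlat_homD[OF assms(1)] assms(2,3) by simp_all

lemma homs4_consts:
  assumes "p \<in> homs4 L"
  shows "p \<top> = (True, True)" "p \<bottom> = (False, False)" "p (tt L) = (True, False)" "p (ff L) = (False, True)"
  using dlat_homD(5-8)[OF assms] by simp_all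

lemma homs4_mix:
  assumes "p \<in> homs4 L" "x \<in> carrier L" "y \<in> carrier L"
  shows "p (mix x y) = (fst (p x), snd (p y))"
  using assms by (simp add: mix_def homs4_simps homs4_consts tt_carrier ff_carrier)

text \<open>The values of \<open>p\<close> at \<open>mix x (star x)\<close> and
  \<open>mix (star x) x\<close> lie in both \<open>con\<close> and \<open>tot\<close> of
  \<open>dfour\<close>, so each has exactly one true coordinate. Hence the first coordinate of
  \<open>p\<close> determines the second.\<close>

lemma homs4_star:
  assumes "p \<in> homs4 L" "x \<in> carrier L"
  shows "fst (p (star x)) \<longleftrightarrow> \<not> snd (p x)" "snd (p (star x)) \<longleftrightarrow> \<not> fst (p x)"
  using dlat_homD(9,10)[OF assms(1)] mix_star_con[OF assms(2)] mix_star_tot[OF assms(2)]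
    star_mix_con[OF assms(2)] star_mix_tot[OF assms(2)] homs4_mix[OF assms(1)] assms(2)
  by (metis dfour_simps(4,5) fst_conv snd_conv star_closed)+

lemma homs4_filter:
  assumes p: "p \<in> homs4 L"
  shows "prime_filter L {x \<in> carrier L. fst (p x)}"
  unfolding prime_filter_def
proof
  have mono: "fst (p y)" if "x \<in> carrier L" "y \<in> carrier L" "x \<sqsubseteq> y" "fst (p x)" for x y
    using homs4_simps(2)[OF p that(1,2)] le_iff_join[OF that(1,2)] that(3,4) by (metis fst_conv)
  show "lattice_filter L {x \<in> carrier L. fst (p x)}"
  proof (rule lattice_filterI)
    show "y \<in> {x \<in> carrier L. fst (p x)}"
      if "x \<in> {x \<in> carrier L. fst (p x)}" "y \<in> carrier L" "x \<sqsubseteq> y" for x y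
      using mono[of x y] that by simp
  qed (auto simp: homs4_simps[OF p] homs4_consts[OF p])
  show "lattice_ideal L (carrier L - {x \<in> carrier L. fst (p x)})"
  proof (rule lattice_idealI)
    show "y \<in> carrier L - {x \<in> carrier L. fst (p x)}"
      if "x \<in> carrier L - {x \<in> carrier L. fst (p x)}" "y \<in> carrier L" "y \<sqsubseteq> x" for x y
      using mono[of y x] that by auto
  qed (auto simp: homs4_simps[OF p] homs4_consts[OF p])
qed

text \<open>The second coordinate is forced: by \<open>homs4_star\<close>, that of a homomorphism is
  true at \<open>x\<close> iff the first one is false at \<open>star x\<close>.\<close>

definition point :: "'a set \<Rightarrow> 'a \<Rightarrow> bool \<times> bool" where
  "point M = (\<lambda>x\<in>carrier L. (x \<in> M, star x \<notin> M))"

text \<open>\<open>star\<close> exchanges joins and meets and negation exchanges them back, so the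
  second coordinate again preserves both. Preservation of \<open>con\<close> and \<open>tot\<close>
  is \<open>con_iff\<close> and \<open>tot_iff\<close> read inside a filter containing
  \<open>tt\<close>.\<close>

lemma point_in_homs4:
  assumes M: "prime_filter L M" "tt L \<in> M"
  shows "point M \<in> homs4 L"
proof -
  have "point M x \<in> con dfour" if "x \<in> con L" for x
  proof -
    have x: "x \<in> carrier L" using that con_carrier by blast
    then have "x \<sqinter> tt L \<in> M \<longrightarrow> star x \<in> M"
      using that con_iff[OF x] M le_iff_prime_filters[of "x \<sqinter> tt L" "star x"] tt_carrier by simp
    then show ?thesis
      using x M by (simp add: point_def prime_simps)
  qed
  moreover have "point M x \<in> tot dfour" if "x \<in> tot L" for x
  proof -
    have x: "x \<in> carrier L" using that tot_carrier by blast
    then have "star x \<sqinter> tt L \<in> M \<longrightarrow> x \<in> M"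
      using that tot_iff[OF x] M le_iff_prime_filters[of "star x \<sqinter> tt L" x] tt_carrier by simp
    then show ?thesis
      using x M by (auto simp add: point_def prime_simps)
  qed
  moreover have "ff L \<notin> M"
    using ff_in_prime_iff[OF M(1)] M(2) by simp
  ultimately show ?thesis
    using M prime_filterD(2,3)[OF M(1)]
    by (simp add: dlat_hom_def point_def star_join star_meet prime_simps image_subset_iff)
qed

text \<open>Points come from prime filters over \<open>tt\<close>; the information on filters over
  \<open>ff\<close> is recovered from the second coordinate by applying \<open>star\<close>.\<close>

lemma le_iff_homs4:
  assumes x: "x \<in> carrier L" and y: "y \<in> carrier L"
  shows "x \<sqsubseteq> y \<longleftrightarrow> (\<forall>p\<in>homs4 L. (fst (p x) \<longrightarrow> fst (p y)) \<and> (snd (p x) \<longrightarrow> snd (p y)))"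
proof
  assume le: "x \<sqsubseteq> y"
  show "\<forall>p\<in>homs4 L. (fst (p x) \<longrightarrow> fst (p y)) \<and> (snd (p x) \<longrightarrow> snd (p y))"
  proof
    fix p assume p: "p \<in> homs4 L"
    have "x \<squnion> y = y"
      using le le_iff_meet x y by simp
    then show "(fst (p x) \<longrightarrow> fst (p y)) \<and> (snd (p x) \<longrightarrow> snd (p y))"
      using homs4_simps(1)[OF p x y] by (metis fst_conv snd_conv)
  qed
next
  assume *: "\<forall>p\<in>homs4 L. (fst (p x) \<longrightarrow> fst (p y)) \<and> (snd (p x) \<longrightarrow> snd (p y))"
  have point: "(x \<in> M \<longrightarrow> y \<in> M) \<and> (star y \<in> M \<longrightarrow> star x \<in> M)" if "prime_filter L M" "tt L \<in> M" for M
    using bspec[OF * point_in_homs4[OF that]] x y by (simp add: point_def) blast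
  have "x \<sqinter> tt L \<sqsubseteq> y" "star y \<sqinter> tt L \<sqsubseteq> star x"
    using point x y by (simp_all add: le_iff_prime_filters prime_simps)
  \<comment> \<open>Applying \<open>star\<close> to the second inequality gives a bound by
    \<open>y \<squnion> tt L\<close>, which settles the prime filters omitting \<open>tt\<close>;
    the first inequality settles those containing it.\<close>
  moreover from this(2) have "x \<sqsubseteq> y \<squnion> tt L"
    using le_star_swap[of "star y \<sqinter> tt L" x] x y by (simp add: star_meet tt_carrier)
  ultimately show "x \<sqsubseteq> y"
    using x y by (simp add: le_iff_prime_filters prime_simps) blast
qed

lemma eq_iff_homs4:
  assumes x: "x \<in> carrier L" and y: "y \<in> carrier L"
  shows "x = y \<longleftrightarrow> (\<forall>p\<in>homs4 L. p x = p y)"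
proof
  assume "\<forall>p\<in>homs4 L. p x = p y"
  then have "x \<sqsubseteq> y" "y \<sqsubseteq> x"
    by (auto simp: le_iff_homs4 x y)
  then show "x = y"
    using x y by (rule le_antisym)
qed simp

text \<open>At a point \<open>p\<close>, the inequality of \<open>con_iff\<close> says that a true
  first coordinate of \<open>p x\<close> excludes a true second one.\<close>

lemma con_iff_homs4:
  assumes x: "x \<in> carrier L"
  shows "x \<in> con L \<longleftrightarrow> (\<forall>p\<in>homs4 L. \<not> (fst (p x) \<and> snd (p x)))"
proof
  show "x \<in> con L \<Longrightarrow> \<forall>p\<in>homs4 L. \<not> (fst (p x) \<and> snd (p x))"
    using dlat_homD(9)[of _ L dfour x] by simp
  assume "\<forall>p\<in>homs4 L. \<not> (fst (p x) \<and> snd (p x))"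
  then have "x \<sqinter> tt L \<sqsubseteq> star x"
    using x by (simp add: le_iff_homs4 homs4_simps homs4_consts homs4_star tt_carrier)
  then show "x \<in> con L"
    using con_iff[OF x] by simp
qed

lemma tot_iff_homs4:
  assumes x: "x \<in> carrier L"
  shows "x \<in> tot L \<longleftrightarrow> (\<forall>p\<in>homs4 L. fst (p x) \<or> snd (p x))"
proof
  show "x \<in> tot L \<Longrightarrow> \<forall>p\<in>homs4 L. fst (p x) \<or> snd (p x)"
    using dlat_homD(10)[of _ L dfour x] by simp
  assume "\<forall>p\<in>homs4 L. fst (p x) \<or> snd (p x)"
  then have "star x \<sqinter> tt L \<sqsubseteq> x"
    using x by (auto simp add: le_iff_homs4 homs4_simps homs4_consts homs4_star tt_carrier)
  then show "x \<in> tot L"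
    using tot_iff[OF x] by simp
qed

lemma homs4_compact:
  assumes S: "S \<subseteq> carrier L" and T: "T \<subseteq> carrier L"
    and cover: "\<And>p. p \<in> homs4 L \<Longrightarrow> (\<exists>a\<in>S. fst (p a)) \<or> (\<exists>b\<in>T. snd (p b))"
  obtains S' T' where "finite S'" "S' \<subseteq> S" "finite T'" "T' \<subseteq> T"
    "\<And>p. p \<in> homs4 L \<Longrightarrow> (\<exists>a\<in>S'. fst (p a)) \<or> (\<exists>b\<in>T'. snd (p b))"
proof -
  \<comment> \<open>A point avoids the whole cover iff its filter contains every
    \<open>star b\<close> with \<open>b\<close> in \<open>T\<close> and omits every element of
    \<open>S\<close>. These conditions, with \<open>tt\<close> and \<open>ff\<close> to single out
    filters over \<open>tt\<close>, seed the filter and the ideal.\<close>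
  let ?X = "insert (tt L) (star ` T)" and ?Y = "insert (ff L) S"
  have X: "?X \<subseteq> carrier L" and Y: "?Y \<subseteq> carrier L"
    using S T tt_carrier ff_carrier by auto
  have "generated_filter L ?X \<inter> generated_ideal L ?Y \<noteq> {}"
  proof
    assume "generated_filter L ?X \<inter> generated_ideal L ?Y = {}"
    then obtain M where M: "prime_filter L M" "generated_filter L ?X \<subseteq> M"
        "M \<inter> generated_ideal L ?Y = {}"
      using prime_filter_exists[OF generated_filter_is_filter[OF X] generated_ideal_is_ideal[OF Y]]
      by metis
    have XM: "x \<in> M" if "x \<in> ?X" for x
      using M(2) generated_filter.base[OF that] by (rule subsetD)
    have YM: "y \<notin> M" if "y \<in> ?Y" for y
      using M(3) generated_filter.base[OF that] by blast
    have "point M \<in> homs4 L"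
      using point_in_homs4[OF M(1)] XM by simp
    then show False
      using cover[of "point M"] XM YM S T by (auto simp: point_def subset_iff)
  qed
  then obtain y where y: "y \<in> generated_filter L ?X" "y \<in> generated_ideal L ?Y"
    by blast
  obtain X' where X': "finite X'" "X' \<subseteq> ?X" "y \<in> generated_filter L X'"
    using generated_filter_finitary[OF y(1)] by blast
  obtain Y' where Y': "finite Y'" "Y' \<subseteq> ?Y" "y \<in> generated_ideal L Y'"
    using generated_filter_finitary[OF y(2)] by blast
  obtain T' where T': "finite T'" "T' \<subseteq> T" "X' - {tt L} = star ` T'"
    using finite_subset_image[of "X' - {tt L}" star T] X'(1,2) by blast
  show thesis
  proof (rule that)
    \<comment> \<open>Discarding \<open>tt\<close> and \<open>ff\<close> is harmless, as every point
      has a true first coordinate at \<open>tt\<close> and a false one at \<open>ff\<close>.\<close>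
    show "finite (Y' - {ff L})" "Y' - {ff L} \<subseteq> S" "finite T'" "T' \<subseteq> T"
      using Y' T' by auto
    fix p assume p: "p \<in> homs4 L"
    show "(\<exists>a\<in>Y' - {ff L}. fst (p a)) \<or> (\<exists>b\<in>T'. snd (p b))"
    proof (rule ccontr)
      \<comment> \<open>The common element \<open>y\<close> would lie in the filter of
        \<open>p\<close>, being derived from \<open>X'\<close>, and outside it, being derived from
        \<open>Y'\<close>.\<close>
      assume none: "\<not> ?thesis"
      let ?F = "{x \<in> carrier L. fst (p x)}"
      have F: "lattice_filter L ?F" "lattice_ideal L (carrier L - ?F)"
        using homs4_filter[OF p] by (simp_all add: prime_filter_def)
      have "x \<in> ?F" if xX': "x \<in> X'" for x
      proof (cases "x = tt L")
        case False
        then obtain b where "b \<in> T'" "x = star b"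
          using T'(3) xX' by blast
        moreover have "b \<in> carrier L"
          using calculation T'(2) T by blast
        ultimately show ?thesis
          using none homs4_star(1)[OF p] by simp
      qed (simp add: homs4_consts[OF p] tt_carrier)
      then have "y \<in> ?F"
        using generated_filter_least[OF F(1), of X'] X'(3) by blast
      moreover have "Y' \<subseteq> carrier L - ?F"
        using none Y'(2) Y homs4_consts(4)[OF p] by auto
      then have "y \<in> carrier L - ?F"
        using generated_filter_least[OF F(2), of Y'] Y'(3) by blast
      ultimately show False
        by blast
    qed
  qed
qed

text \<open>Without points \<open>eq_iff_homs4\<close> would identify all elements, against
  nondegeneracy. This supplies the nonemptiness required of spaces.\<close>

lemma homs4_nonempty: "homs4 L \<noteq> {}"
proof
  assume empty: "homs4 L = {}"
  have "tt L = \<top>" "ff L = \<top>" "\<bottom> = \<top>"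
    using empty by (simp_all add: eq_iff_homs4 tt_carrier ff_carrier)
  then show False
    using nondegenerate by simp
qed

end

section \<open>The spectrum\<close>

text \<open>Closure under binary intersections turns the generating family from a subbase into a
  base.\<close>

lemma openin_generated_by_family:
  assumes "\<And>a b. a \<in> C \<Longrightarrow> b \<in> C \<Longrightarrow> \<exists>c\<in>C. \<phi> c = \<phi> a \<inter> \<phi> b"
  shows "openin (topology_generated_by (\<phi> ` C)) U \<longleftrightarrow> (\<exists>S\<subseteq>C. U = \<Union>(\<phi> ` S))"
proof
  assume "openin (topology_generated_by (\<phi> ` C)) U"
  then have "generate_topology_on (\<phi> ` C) U"
    by (rule openin_topology_generated_by)
  then show "\<exists>S\<subseteq>C. U = \<Union>(\<phi> ` S)"
  proof induction
    case Empty
    then show ?case by blast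
  next
    case (Int a b)
    then obtain S T where S: "S \<subseteq> C" "a = \<Union>(\<phi> ` S)" and T: "T \<subseteq> C" "b = \<Union>(\<phi> ` T)"
      by blast
    let ?R = "{c \<in> C. \<phi> c \<subseteq> a \<inter> b}"
    have "x \<in> \<Union>(\<phi> ` ?R)" if x: "x \<in> a \<inter> b" for x
    proof -
      obtain s t where st: "s \<in> S" "t \<in> T" "x \<in> \<phi> s" "x \<in> \<phi> t"
        using x S T by blast
      then obtain c where "c \<in> C" "\<phi> c = \<phi> s \<inter> \<phi> t"
        using assms S T by blast
      then show ?thesis
        using st S T by blast
    qed
    then have "a \<inter> b = \<Union>(\<phi> ` ?R)"
      by blast
    then show ?case
      by (intro exI[of _ ?R]) blast
  next
    case (UN K)
    let ?R = "{c \<in> C. \<phi> c \<subseteq> \<Union>K}"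
    have "k \<subseteq> \<Union>(\<phi> ` ?R)" if "k \<in> K" for k
      using UN[OF that] that by blast
    then have "\<Union>K = \<Union>(\<phi> ` ?R)"
      by blast
    then show ?case
      by (intro exI[of _ ?R]) blast
  next
    case (Basis s)
    then obtain c where "c \<in> C" "s = \<phi> c"
      by blast
    then show ?case
      by (intro exI[of _ "{c}"]) simp
  qed
next
  assume "\<exists>S\<subseteq>C. U = \<Union>(\<phi> ` S)"
  then obtain S where "S \<subseteq> C" "U = \<Union>(\<phi> ` S)"
    by blast
  then show "openin (topology_generated_by (\<phi> ` C)) U"
    using topology_generated_by_Basis by (metis (no_types) image_mono openin_Union subsetD)
qed

definition spectrum_via :: "'q set \<Rightarrow> ('q \<Rightarrow> 'a \<Rightarrow> bool \<times> bool) \<Rightarrow> 'a dlat \<Rightarrow> 'q bitop" where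
  "spectrum_via Q h A = \<lparr>
     pos_top = topology_generated_by ((\<lambda>a. {q \<in> Q. fst (h q a)}) ` carrier A),
     neg_top = topology_generated_by ((\<lambda>a. {q \<in> Q. snd (h q a)}) ` carrier A)\<rparr>"

lemma dspec_eq_spectrum_via: "dspec A = spectrum_via (homs4 A) (\<lambda>p. p) A"
  by (simp add: dspec_def spectrum_via_def)

text \<open>
  The points of the spectrum are coded by elements of an arbitrary type: the identity coding gives
  \<open>dspec\<close>, a coding in the type of the algebra gives a small space.
\<close>

locale encoded_spectrum = d_boolean +
  fixes Q :: "'q set" and h :: "'q \<Rightarrow> 'a \<Rightarrow> bool \<times> bool"
  assumes code_bij: "bij_betw h Q (homs4 L)"
begin

abbreviation "X \<equiv> spectrum_via Q h L"

definition pos_set :: "'a \<Rightarrow> 'q set" where "pos_set a = {q \<in> Q. fst (h q a)}"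

definition neg_set :: "'a \<Rightarrow> 'q set" where "neg_set a = {q \<in> Q. snd (h q a)}"

lemma code_hom: "q \<in> Q \<Longrightarrow> h q \<in> homs4 L"
  using code_bij by (auto simp: bij_betw_def)

lemma ball_homs4: "(\<forall>p\<in>homs4 L. P p) \<longleftrightarrow> (\<forall>q\<in>Q. P (h q))"
  by (simp flip: bij_betw_imp_surj_on[OF code_bij])

lemma sets_join:
  assumes "a \<in> carrier L" "b \<in> carrier L"
  shows "pos_set (a \<squnion> b) = pos_set a \<union> pos_set b" "neg_set (a \<squnion> b) = neg_set a \<union> neg_set b"
  using assms homs4_simps(1)[OF code_hom] by (auto simp: pos_set_def neg_set_def)

lemma sets_meet:
  assumes "a \<in> carrier L" "b \<in> carrier L"
  shows "pos_set (a \<sqinter> b) = pos_set a \<inter> pos_set b" "neg_set (a \<sqinter> b) = neg_set a \<inter> neg_set b"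
  using assms homs4_simps(2)[OF code_hom] by (auto simp: pos_set_def neg_set_def)

lemma sets_consts:
  "pos_set \<top> = Q" "pos_set \<bottom> = {}" "pos_set (tt L) = Q" "pos_set (ff L) = {}"
  "neg_set \<top> = Q" "neg_set \<bottom> = {}" "neg_set (tt L) = {}" "neg_set (ff L) = Q"
  using homs4_consts[OF code_hom] by (auto simp: pos_set_def neg_set_def)

text \<open>The involution realizes complementation between the two topologies inside the algebra.
  This is the source of zero-dimensionality, and it lets \<open>neg_clopen\<close> follow from
  \<open>pos_clopen\<close>.\<close>

lemma sets_star:
  assumes "a \<in> carrier L"
  shows "pos_set (star a) = Q - neg_set a" "neg_set (star a) = Q - pos_set a"
  using homs4_star[OF code_hom assms] by (auto simp: pos_set_def neg_set_def)

lemma sets_mix: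
  assumes "a \<in> carrier L" "b \<in> carrier L"
  shows "pos_set (mix a b) = pos_set a" "neg_set (mix a b) = neg_set b"
  using homs4_mix[OF code_hom assms] by (auto simp: pos_set_def neg_set_def)

lemma sets_subset: "pos_set a \<subseteq> Q" "neg_set a \<subseteq> Q"
  by (auto simp: pos_set_def neg_set_def)

lemma le_iff_sets:
  "\<lbrakk>a \<in> carrier L; b \<in> carrier L\<rbrakk> \<Longrightarrow> a \<sqsubseteq> b \<longleftrightarrow> pos_set a \<subseteq> pos_set b \<and> neg_set a \<subseteq> neg_set b"
  by (auto simp: le_iff_homs4 ball_homs4 pos_set_def neg_set_def)

lemma con_iff_sets: "a \<in> carrier L \<Longrightarrow> a \<in> con L \<longleftrightarrow> pos_set a \<inter> neg_set a = {}"
  by (auto simp: con_iff_homs4 ball_homs4 pos_set_def neg_set_def)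

lemma tot_iff_sets: "a \<in> carrier L \<Longrightarrow> a \<in> tot L \<longleftrightarrow> pos_set a \<union> neg_set a = Q"
  by (auto simp: tot_iff_homs4 ball_homs4 pos_set_def neg_set_def)

lemma openin_pos_iff: "openin (pos_top X) U \<longleftrightarrow> (\<exists>S\<subseteq>carrier L. U = \<Union>(pos_set ` S))"
proof -
  have "\<exists>c\<in>carrier L. pos_set c = pos_set a \<inter> pos_set b" if "a \<in> carrier L" "b \<in> carrier L" for a b
    using sets_meet(1)[OF that] meet_closed[OF that] by blast
  then have "openin (topology_generated_by (pos_set ` carrier L)) U \<longleftrightarrow>
      (\<exists>S\<subseteq>carrier L. U = \<Union>(pos_set ` S))"
    by (rule openin_generated_by_family)
  then show ?thesis
    by (simp add: spectrum_via_def pos_set_def[abs_def])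
qed

lemma openin_neg_iff: "openin (neg_top X) U \<longleftrightarrow> (\<exists>S\<subseteq>carrier L. U = \<Union>(neg_set ` S))"
proof -
  have "\<exists>c\<in>carrier L. neg_set c = neg_set a \<inter> neg_set b" if "a \<in> carrier L" "b \<in> carrier L" for a b
    using sets_meet(2)[OF that] meet_closed[OF that] by blast
  then have "openin (topology_generated_by (neg_set ` carrier L)) U \<longleftrightarrow>
      (\<exists>S\<subseteq>carrier L. U = \<Union>(neg_set ` S))"
    by (rule openin_generated_by_family)
  then show ?thesis
    by (simp add: spectrum_via_def neg_set_def[abs_def])
qed

lemma openin_sets:
  assumes "a \<in> carrier L"
  shows "openin (pos_top X) (pos_set a)" "openin (neg_top X) (neg_set a)"
  using assms by (auto simp: openin_pos_iff openin_neg_iff intro!: exI[of _ "{a}"])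

lemma topspace_pos: "topspace (pos_top X) = Q"
proof -
  obtain S where "topspace (pos_top X) = \<Union>(pos_set ` S)"
    using iffD1[OF openin_pos_iff openin_topspace] by (elim exE conjE)
  then have "topspace (pos_top X) \<subseteq> Q"
    using UN_least[of S pos_set Q] sets_subset(1) by simp
  moreover have "Q \<subseteq> topspace (pos_top X)"
    using openin_subset[OF openin_sets(1)[OF tt_carrier]] sets_consts(3) by simp
  ultimately show ?thesis
    by (rule equalityI)
qed

lemma topspace_neg: "topspace (neg_top X) = Q"
proof -
  obtain S where "topspace (neg_top X) = \<Union>(neg_set ` S)"
    using iffD1[OF openin_neg_iff openin_topspace] by (elim exE conjE)
  then have "topspace (neg_top X) \<subseteq> Q"
    using UN_least[of S neg_set Q] sets_subset(2) by simp
  moreover have "Q \<subseteq> topspace (neg_top X)"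
    using openin_subset[OF openin_sets(2)[OF ff_carrier]] sets_consts(8) by simp
  ultimately show ?thesis
    by (rule equalityI)
qed

lemma points_spectrum: "points X = Q"
  by (simp add: points_def topspace_pos)

lemma closedin_sets:
  assumes "a \<in> carrier L"
  shows "closedin (neg_top X) (pos_set a)" "closedin (pos_top X) (neg_set a)"
  using openin_sets[OF star_closed[OF assms]] sets_subset
  by (simp_all add: closedin_def topspace_pos topspace_neg sets_star assms)

lemma sets_compact:
  assumes S: "S \<subseteq> carrier L" and T: "T \<subseteq> carrier L"
    and cover: "Q \<subseteq> \<Union>(pos_set ` S) \<union> \<Union>(neg_set ` T)"
  obtains S' T' where "finite S'" "S' \<subseteq> S" "finite T'" "T' \<subseteq> T"
    "Q \<subseteq> \<Union>(pos_set ` S') \<union> \<Union>(neg_set ` T')"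
proof -
  have "\<forall>q\<in>Q. (\<exists>a\<in>S. fst (h q a)) \<or> (\<exists>b\<in>T. snd (h q b))"
    using cover unfolding pos_set_def neg_set_def by blast
  then have *: "(\<exists>a\<in>S. fst (p a)) \<or> (\<exists>b\<in>T. snd (p b))" if "p \<in> homs4 L" for p
    using ball_homs4[of "\<lambda>p. (\<exists>a\<in>S. fst (p a)) \<or> (\<exists>b\<in>T. snd (p b))"] that by simp
  obtain S' T' where ST: "finite S'" "S' \<subseteq> S" "finite T'" "T' \<subseteq> T"
    "\<And>p. p \<in> homs4 L \<Longrightarrow> (\<exists>a\<in>S'. fst (p a)) \<or> (\<exists>b\<in>T'. snd (p b))"
    using homs4_compact[OF S T *] by metis
  have "Q \<subseteq> \<Union>(pos_set ` S') \<union> \<Union>(neg_set ` T')"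
    using ST(5)[OF code_hom] unfolding pos_set_def neg_set_def by blast
  then show thesis
    using that ST by blast
qed

lemma pos_open_basic:
  assumes "openin (pos_top X) U" "q \<in> U"
  shows "\<exists>a\<in>carrier L. q \<in> pos_set a \<and> pos_set a \<subseteq> U"
proof -
  obtain S where S: "S \<subseteq> carrier L" "U = \<Union>(pos_set ` S)"
    using iffD1[OF openin_pos_iff assms(1)] by (elim exE conjE)
  then obtain a where "a \<in> S" "q \<in> pos_set a"
    using assms(2) by blast
  then show ?thesis
    using S by blast
qed

lemma neg_open_basic:
  assumes "openin (neg_top X) U" "q \<in> U"
  shows "\<exists>a\<in>carrier L. q \<in> neg_set a \<and> neg_set a \<subseteq> U"
proof -
  obtain S where S: "S \<subseteq> carrier L" "U = \<Union>(neg_set ` S)"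
    using iffD1[OF openin_neg_iff assms(1)] by (elim exE conjE)
  then obtain a where "a \<in> S" "q \<in> neg_set a"
    using assms(2) by blast
  then show ?thesis
    using S by blast
qed

section \<open>The spectrum is a d-Boolean space\<close>

lemma spectrum_T0: "bitop_T0 X"
  unfolding bitop_T0_def points_spectrum
proof (intro ballI impI)
  fix x y assume xy: "x \<in> Q" "y \<in> Q" "x \<noteq> y"
  then have "h x \<noteq> h y"
    using code_bij by (auto simp: bij_betw_def inj_on_def)
  then obtain a where a: "a \<in> carrier L" "h x a \<noteq> h y a"
    using PiE_ext[OF dlat_homD(1) dlat_homD(1)] code_hom xy by metis
  then have "(x \<in> pos_set a) \<noteq> (y \<in> pos_set a) \<or> (x \<in> neg_set a) \<noteq> (y \<in> neg_set a)"
    using xy by (auto simp: pos_set_def neg_set_def prod_eq_iff)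
  then show "\<exists>U. (openin (pos_top X) U \<or> openin (neg_top X) U) \<and> (x \<in> U) = (y \<notin> U)"
    using openin_sets[OF a(1)] by meson
qed

lemma spectrum_compact: "bitop_compact X"
  unfolding bitop_compact_def points_spectrum
proof (intro allI impI, elim conjE)
  fix \<C> assume op: "\<forall>U\<in>\<C>. openin (pos_top X) U \<or> openin (neg_top X) U" and cover: "Q \<subseteq> \<Union>\<C>"
  \<comment> \<open>The cover is refined to all basic sets contained in some member of it;
    \<open>sets_compact\<close> extracts finitely many of them, and a member of the cover is then
    chosen around each.\<close>
  let ?S = "{a \<in> carrier L. \<exists>U\<in>\<C>. pos_set a \<subseteq> U}"
  let ?T = "{a \<in> carrier L. \<exists>U\<in>\<C>. neg_set a \<subseteq> U}"
  have cov: "Q \<subseteq> \<Union>(pos_set ` ?S) \<union> \<Union>(neg_set ` ?T)"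
  proof
    fix q assume "q \<in> Q"
    then obtain U where U: "U \<in> \<C>" "q \<in> U" 
      using cover by blast
    then have "openin (pos_top X) U \<or> openin (neg_top X) U"
      using op by blast
    then have "(\<exists>a\<in>carrier L. q \<in> pos_set a \<and> pos_set a \<subseteq> U) \<or>
        (\<exists>a\<in>carrier L. q \<in> neg_set a \<and> neg_set a \<subseteq> U)"
      using pos_open_basic[OF _ U(2)] neg_open_basic[OF _ U(2)] by blast
    then show "q \<in> \<Union>(pos_set ` ?S) \<union> \<Union>(neg_set ` ?T)"
      using U(1) by blast
  qed
  obtain S T where ST: "finite S" "S \<subseteq> ?S" "finite T" "T \<subseteq> ?T"
    "Q \<subseteq> \<Union>(pos_set ` S) \<union> \<Union>(neg_set ` T)"
    by (rule sets_compact[OF Collect_restrict Collect_restrict cov])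
  have "\<forall>a\<in>S. \<exists>U. U \<in> \<C> \<and> pos_set a \<subseteq> U"
    using ST(2) by auto
  from bchoice[OF this] obtain u where u: "\<forall>a\<in>S. u a \<in> \<C> \<and> pos_set a \<subseteq> u a"
    by (elim exE)
  have "\<forall>a\<in>T. \<exists>U. U \<in> \<C> \<and> neg_set a \<subseteq> U"
    using ST(4) by auto
  from bchoice[OF this] obtain v where v: "\<forall>a\<in>T. v a \<in> \<C> \<and> neg_set a \<subseteq> v a"
    by (elim exE)
  show "\<exists>\<F>. finite \<F> \<and> \<F> \<subseteq> \<C> \<and> Q \<subseteq> \<Union>\<F>"
  proof (intro exI[of _ "u ` S \<union> v ` T"] conjI)
    show "Q \<subseteq> \<Union>(u ` S \<union> v ` T)"
    proof
      fix q assume "q \<in> Q"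
      then have "q \<in> \<Union>(pos_set ` S) \<union> \<Union>(neg_set ` T)"
        by (rule subsetD[OF ST(5)])
      moreover have "q \<in> u a" if "a \<in> S" "q \<in> pos_set a" for a
        using u that by (auto dest!: bspec[of S])
      moreover have "q \<in> v a" if "a \<in> T" "q \<in> neg_set a" for a
        using v that by (auto dest!: bspec[of T])
      ultimately have "(\<exists>a\<in>S. q \<in> u a) \<or> (\<exists>b\<in>T. q \<in> v b)"
        by auto
      then show "q \<in> \<Union>(u ` S \<union> v ` T)"
        by auto
    qed
  qed (use ST u v in auto)
qed

lemma spectrum_zero_dimensional: "bitop_zero_dimensional X"
  unfolding bitop_zero_dimensional_def has_base_of_closed_def
proof
  show "\<exists>\<B>. (\<forall>B\<in>\<B>. openin (pos_top X) B \<and> closedin (neg_top X) B) \<and>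
      (\<forall>U. openin (pos_top X) U \<longrightarrow> (\<exists>\<B>'\<subseteq>\<B>. U = \<Union>\<B>'))"
  proof (rule exI[of _ "pos_set ` carrier L"], intro conjI ballI allI impI)
    fix B assume "B \<in> pos_set ` carrier L"
    then show "openin (pos_top X) B" "closedin (neg_top X) B"
      using openin_sets(1) closedin_sets(1) by (elim imageE; simp)+
  next
    fix U assume "openin (pos_top X) U"
    then obtain S where "S \<subseteq> carrier L" "U = \<Union>(pos_set ` S)"
      unfolding openin_pos_iff by (elim exE conjE)
    then show "\<exists>\<B>'\<subseteq>pos_set ` carrier L. U = \<Union>\<B>'"
      by (intro exI[of _ "pos_set ` S"] conjI image_mono)
  qed
  show "\<exists>\<B>. (\<forall>B\<in>\<B>. openin (neg_top X) B \<and> closedin (pos_top X) B) \<and>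
      (\<forall>U. openin (neg_top X) U \<longrightarrow> (\<exists>\<B>'\<subseteq>\<B>. U = \<Union>\<B>'))"
  proof (rule exI[of _ "neg_set ` carrier L"], intro conjI ballI allI impI)
    fix B assume "B \<in> neg_set ` carrier L"
    then show "openin (neg_top X) B" "closedin (pos_top X) B"
      using openin_sets(2) closedin_sets(2) by (elim imageE; simp)+
  next
    fix U assume "openin (neg_top X) U"
    then obtain S where "S \<subseteq> carrier L" "U = \<Union>(neg_set ` S)"
      unfolding openin_neg_iff by (elim exE conjE)
    then show "\<exists>\<B>'\<subseteq>neg_set ` carrier L. U = \<Union>\<B>'"
      by (intro exI[of _ "neg_set ` S"] conjI image_mono)
  qed
qed

theorem d_boolean_space_spectrum: "d_boolean_space X"
proof -
  have "Q \<noteq> {}"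
    using homs4_nonempty code_bij by (auto simp: bij_betw_def)
  then show ?thesis
    by (simp add: d_boolean_space_def bitopological_space_def topspace_pos topspace_neg
        points_spectrum spectrum_T0 spectrum_compact spectrum_zero_dimensional)
qed

section \<open>Clopen sets of the spectrum come from elements of the algebra\<close>

lemma pos_set_Union:
  assumes "finite S" "S \<subseteq> carrier L"
  shows "\<exists>a\<in>carrier L. pos_set a = \<Union>(pos_set ` S)"
  using assms
proof (induction S)
  case empty
  then show ?case
    using sets_consts(2) bottom_closed by auto
next
  case (insert x S)
  then have S: "S \<subseteq> carrier L" "x \<in> carrier L"
    by simp_all
  obtain a where "a \<in> carrier L" "pos_set a = \<Union>(pos_set ` S)"
    using insert.IH[OF S(1)] by (elim bexE)
  then show ?case
    using S by (intro bexI[of _ "x \<squnion> a"]) (simp_all add: sets_join)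
qed

text \<open>Writing \<open>U\<close> and its complement as unions of basic sets of the two
  topologies gives a cover of the spectrum. In a finite subcover the positive sets must already
  exhaust \<open>U\<close>, and their union belongs to a finite join.\<close>

lemma pos_clopen:
  assumes "openin (pos_top X) U" "closedin (neg_top X) U"
  obtains a where "a \<in> carrier L" "U = pos_set a"
proof -
  obtain S where S: "S \<subseteq> carrier L" "U = \<Union>(pos_set ` S)"
    using iffD1[OF openin_pos_iff assms(1)] by (elim exE conjE)
  have "openin (neg_top X) (Q - U)"
    using assms(2) by (simp add: closedin_def topspace_neg)
  then obtain T where T: "T \<subseteq> carrier L" "Q - U = \<Union>(neg_set ` T)"
    unfolding openin_neg_iff by (elim exE conjE)
  have cov: "Q \<subseteq> \<Union>(pos_set ` S) \<union> \<Union>(neg_set ` T)"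
    using S(2) T(2) by blast
  obtain S' T' where ST: "finite S'" "S' \<subseteq> S" "finite T'" "T' \<subseteq> T"
    "Q \<subseteq> \<Union>(pos_set ` S') \<union> \<Union>(neg_set ` T')"
    by (rule sets_compact[OF S(1) T(1) cov])
  have "U \<subseteq> Q"
    using openin_subset[OF assms(1)] topspace_pos by simp
  moreover have "\<Union>(pos_set ` S') \<subseteq> U"
    unfolding S(2) by (intro Union_mono image_mono ST(2))
  moreover have "\<Union>(neg_set ` T') \<subseteq> Q - U"
    unfolding T(2) by (intro Union_mono image_mono ST(4))
  moreover have "U = A" if "U \<subseteq> Q" "A \<subseteq> U" "B \<subseteq> Q - U" "Q \<subseteq> A \<union> B" for A B
    using that by blast
  ultimately have "U = \<Union>(pos_set ` S')"
    using ST(5) by metis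
  moreover obtain a where "a \<in> carrier L" "pos_set a = \<Union>(pos_set ` S')"
    using pos_set_Union[OF ST(1)] ST(2) S(1) by blast
  ultimately show thesis
    using that by metis
qed

lemma neg_clopen:
  assumes "openin (neg_top X) V" "closedin (pos_top X) V"
  obtains b where "b \<in> carrier L" "V = neg_set b"
proof -
  have V: "V \<subseteq> Q"
    using openin_subset[OF assms(1)] topspace_neg by simp
  have "openin (pos_top X) (Q - V)" "closedin (neg_top X) (Q - V)"
    using assms V topspace_pos topspace_neg
    by (auto simp: closedin_def double_diff)
  then obtain a where a: "a \<in> carrier L" "Q - V = pos_set a"
    by (rule pos_clopen)
  have "V = Q - (Q - V)"
    using V by blast
  then show thesis
    using that[of "star a"] sets_star(2)[OF a(1)] a by simp
qed

definition eta :: "'a \<Rightarrow> 'q set \<times> 'q set" where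
  "eta = (\<lambda>a\<in>carrier L. (pos_set a, neg_set a))"

lemma eta_bij: "bij_betw eta (carrier L) (carrier (dclop X))"
proof (rule bij_betw_imageI)
  show "inj_on eta (carrier L)"
    by (rule inj_onI) (simp add: eta_def le_iff_sets le_antisym)
  show "eta ` carrier L = carrier (dclop X)"
  proof
    show "eta ` carrier L \<subseteq> carrier (dclop X)"
      using openin_sets closedin_sets by (auto simp: eta_def dclop_def)
    show "carrier (dclop X) \<subseteq> eta ` carrier L"
    proof
      fix c assume "c \<in> carrier (dclop X)"
      then obtain U V where c: "c = (U, V)" "openin (pos_top X) U" "closedin (neg_top X) U"
          "openin (neg_top X) V" "closedin (pos_top X) V"
        by (auto simp: dclop_def)
      obtain a where a: "a \<in> carrier L" "U = pos_set a"
        by (rule pos_clopen[OF c(2,3)])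
      obtain b where b: "b \<in> carrier L" "V = neg_set b"
        by (rule neg_clopen[OF c(4,5)])
      \<comment> \<open>The two components are represented separately, and \<open>mix\<close>
        combines the representatives.\<close>
      have "c = eta (mix a b)" "mix a b \<in> carrier L"
        using a b c by (simp_all add: eta_def sets_mix)
      then show "c \<in> eta ` carrier L"
        by blast
    qed
  qed
qed

end

section \<open>The clopen algebra\<close>

lemma Plus_subset_iff: "A <+> B \<subseteq> C <+> D \<longleftrightarrow> A \<subseteq> C \<and> B \<subseteq> D"
  by auto

lemma Plus_eq_iff: "A <+> B = C <+> D \<longleftrightarrow> A = C \<and> B = D"
  by (auto simp: set_eq_subset Plus_subset_iff)

lemma Plus_Un: "(A <+> B) \<union> (C <+> D) = (A \<union> C) <+> (B \<union> D)"
  by auto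

lemma Plus_Int: "(A <+> B) \<inter> (C <+> D) = (A \<inter> C) <+> (B \<inter> D)"
  by auto

text \<open>The clopen algebra up to a renaming \<open>\<phi>\<close> of its elements, mirroring the
  coded points of the spectrum: the identity gives \<open>dclop X\<close>, and a coding in the type
  of the space gives a small algebra.\<close>

locale encoded_clopens =
  fixes X :: "'b bitop" and B :: "'c dlat" and \<phi> :: "'c \<Rightarrow> 'b set \<times> 'b set"
  assumes space: "d_boolean_space X"
    and clop_bij: "bij_betw \<phi> (carrier B) (carrier (dclop X))"
    and eq_B: "eq B = (=)"
    and le_B: "\<lbrakk>x \<in> carrier B; y \<in> carrier B\<rbrakk> \<Longrightarrow>
      x \<sqsubseteq>\<^bsub>B\<^esub> y \<longleftrightarrow> fst (\<phi> x) \<subseteq> fst (\<phi> y) \<and> snd (\<phi> x) \<subseteq> snd (\<phi> y)"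
    and tt_B: "tt B \<in> carrier B" "\<phi> (tt B) = (points X, {})"
    and ff_B: "ff B \<in> carrier B" "\<phi> (ff B) = ({}, points X)"
    and con_B: "con B = {c \<in> carrier B. fst (\<phi> c) \<inter> snd (\<phi> c) = {}}"
    and tot_B: "tot B = {c \<in> carrier B. fst (\<phi> c) \<union> snd (\<phi> c) = points X}"
begin

lemma topspaces: "topspace (pos_top X) = points X" "topspace (neg_top X) = points X"
  using space by (simp_all add: d_boolean_space_def bitopological_space_def points_def)

lemma clop_clopen:
  assumes "c \<in> carrier B"
  shows "openin (pos_top X) (fst (\<phi> c))" "closedin (neg_top X) (fst (\<phi> c))"
    "openin (neg_top X) (snd (\<phi> c))" "closedin (pos_top X) (snd (\<phi> c))"
  using bij_betw_apply[OF clop_bij assms] by (auto simp: dclop_def)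

lemma clop_exists:
  assumes "openin (pos_top X) U" "closedin (neg_top X) U" "openin (neg_top X) V" "closedin (pos_top X) V"
  shows "\<exists>c\<in>carrier B. \<phi> c = (U, V)"
proof -
  have "(U, V) \<in> \<phi> ` carrier B"
    unfolding bij_betw_imp_surj_on[OF clop_bij] using assms by (simp add: dclop_def)
  then show ?thesis
    by (metis imageE)
qed

lemma clop_subset:
  assumes "c \<in> carrier B"
  shows "fst (\<phi> c) \<subseteq> points X" "snd (\<phi> c) \<subseteq> points X"
  using openin_subset[OF clop_clopen(1)[OF assms]] openin_subset[OF clop_clopen(3)[OF assms]]
  by (simp_all add: topspaces)

lemma clop_eq_iff:
  "\<lbrakk>x \<in> carrier B; y \<in> carrier B\<rbrakk> \<Longrightarrow> x = y \<longleftrightarrow> fst (\<phi> x) = fst (\<phi> y) \<and> snd (\<phi> x) = snd (\<phi> y)"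
  using bij_betw_imp_inj_on[OF clop_bij] by (auto simp: inj_on_def prod_eq_iff)

text \<open>A pair of sets is encoded as a disjoint sum, which turns the componentwise order into
  inclusion.\<close>

sublocale lattice_of_sets B "\<lambda>c. fst (\<phi> c) <+> snd (\<phi> c)" "points X <+> points X"
proof
  fix x y assume x: "x \<in> carrier B" and y: "y \<in> carrier B"
  show "x \<sqsubseteq>\<^bsub>B\<^esub> y \<longleftrightarrow> fst (\<phi> x) <+> snd (\<phi> x) \<subseteq> fst (\<phi> y) <+> snd (\<phi> y)"
    using x y by (simp add: le_B Plus_subset_iff)
  obtain z where "z \<in> carrier B" "\<phi> z = (fst (\<phi> x) \<union> fst (\<phi> y), snd (\<phi> x) \<union> snd (\<phi> y))"
    using clop_exists clop_clopen[OF x] clop_clopen[OF y] by (meson closedin_Un openin_Un)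
  then show "\<exists>z\<in>carrier B. fst (\<phi> z) <+> snd (\<phi> z) =
      (fst (\<phi> x) <+> snd (\<phi> x)) \<union> (fst (\<phi> y) <+> snd (\<phi> y))"
    by (intro bexI[of _ z]) (simp_all add: Plus_Un)
  obtain z where "z \<in> carrier B" "\<phi> z = (fst (\<phi> x) \<inter> fst (\<phi> y), snd (\<phi> x) \<inter> snd (\<phi> y))"
    using clop_exists clop_clopen[OF x] clop_clopen[OF y] by (meson closedin_Int openin_Int)
  then show "\<exists>z\<in>carrier B. fst (\<phi> z) <+> snd (\<phi> z) =
      (fst (\<phi> x) <+> snd (\<phi> x)) \<inter> (fst (\<phi> y) <+> snd (\<phi> y))"
    by (intro bexI[of _ z]) (simp_all add: Plus_Int)
next
  obtain z where "z \<in> carrier B" "\<phi> z = ({}, {})"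
    using clop_exists[of "{}" "{}"] by auto
  then show "\<exists>z\<in>carrier B. fst (\<phi> z) <+> snd (\<phi> z) = {}"
    by (intro bexI[of _ z]) auto
  obtain z where "z \<in> carrier B" "\<phi> z = (points X, points X)"
    using clop_exists[of "points X" "points X"] topspaces by (metis closedin_topspace openin_topspace)
  then show "\<exists>z\<in>carrier B. fst (\<phi> z) <+> snd (\<phi> z) = points X <+> points X"
    by (intro bexI[of _ z]) auto
next
  show "fst (\<phi> x) <+> snd (\<phi> x) \<subseteq> points X <+> points X" if "x \<in> carrier B" for x
    using clop_subset[OF that] by (simp add: Plus_subset_iff)
  show "inj_on (\<lambda>c. fst (\<phi> c) <+> snd (\<phi> c)) (carrier B)"
    by (auto intro!: inj_onI simp: Plus_eq_iff clop_eq_iff)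
qed (rule eq_B)

lemma clop_join:
  "\<lbrakk>x \<in> carrier B; y \<in> carrier B\<rbrakk> \<Longrightarrow> \<phi> (x \<squnion>\<^bsub>B\<^esub> y) = (fst (\<phi> x) \<union> fst (\<phi> y), snd (\<phi> x) \<union> snd (\<phi> y))"
  using rep_join[of x y] by (simp add: Plus_Un Plus_eq_iff prod_eq_iff)

lemma clop_meet:
  "\<lbrakk>x \<in> carrier B; y \<in> carrier B\<rbrakk> \<Longrightarrow> \<phi> (x \<sqinter>\<^bsub>B\<^esub> y) = (fst (\<phi> x) \<inter> fst (\<phi> y), snd (\<phi> x) \<inter> snd (\<phi> y))"
  using rep_meet[of x y] by (simp add: Plus_Int Plus_eq_iff prod_eq_iff)

lemma clop_top: "\<phi> \<top>\<^bsub>B\<^esub> = (points X, points X)"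
  using rep_top by (simp add: Plus_eq_iff prod_eq_iff)

lemma clop_bottom: "\<phi> \<bottom>\<^bsub>B\<^esub> = ({}, {})"
  using rep_bottom Plus_eq_iff[of "fst (\<phi> \<bottom>\<^bsub>B\<^esub>)" "snd (\<phi> \<bottom>\<^bsub>B\<^esub>)" "{}" "{}"] by (simp add: prod_eq_iff)

lemmas clop_simps = clop_join clop_meet clop_top clop_bottom tt_B ff_B

text \<open>Intersection on one side and union on the other preserve disjointness as well as
  covering, whence \<open>con\<close> and \<open>tot\<close> are closed under the logic
  operations.\<close>

lemma clop_logic_meet:
  assumes "x \<in> carrier B" "y \<in> carrier B"
  shows "\<phi> (logic_meet B x y) = (fst (\<phi> x) \<inter> fst (\<phi> y), snd (\<phi> x) \<union> snd (\<phi> y))"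
  using assms clop_subset[of x] clop_subset[of y] by (auto simp: logic_meet_def clop_simps)

lemma clop_logic_join:
  assumes "x \<in> carrier B" "y \<in> carrier B"
  shows "\<phi> (logic_join B x y) = (fst (\<phi> x) \<union> fst (\<phi> y), snd (\<phi> x) \<inter> snd (\<phi> y))"
  using assms clop_subset[of x] clop_subset[of y] by (auto simp: logic_join_def clop_simps)

lemma logic_closed:
  assumes "x \<in> carrier B" "y \<in> carrier B"
  shows "logic_meet B x y \<in> carrier B" "logic_join B x y \<in> carrier B"
  using assms by (simp_all add: logic_meet_def logic_join_def tt_B ff_B)

lemma points_nonempty: "points X \<noteq> {}"
  using space by (simp add: d_boolean_space_def)

text \<open>Complements swap the two kinds of clopen sets and so supply the partners demanded in a
  d-Boolean algebra.\<close>

lemma clop_complement: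
  assumes "c \<in> carrier B"
  shows "\<exists>a\<in>carrier B. \<phi> a = ({}, points X - fst (\<phi> c))"
    and "\<exists>b\<in>carrier B. \<phi> b = (points X - snd (\<phi> c), {})"
proof -
  have "openin (neg_top X) (points X - fst (\<phi> c))" "closedin (pos_top X) (points X - fst (\<phi> c))"
    "openin (pos_top X) (points X - snd (\<phi> c))" "closedin (neg_top X) (points X - snd (\<phi> c))"
    using clop_clopen[OF assms] clop_subset[OF assms]
      openin_diff[OF openin_topspace, of "pos_top X"] openin_diff[OF openin_topspace, of "neg_top X"]
      closedin_diff[OF closedin_topspace, of "pos_top X"] closedin_diff[OF closedin_topspace, of "neg_top X"]
    by (simp_all add: topspaces)
  then show "\<exists>a\<in>carrier B. \<phi> a = ({}, points X - fst (\<phi> c))"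
    "\<exists>b\<in>carrier B. \<phi> b = (points X - snd (\<phi> c), {})"
    by (auto intro!: clop_exists)
qed

sublocale d_boolean B
proof
  show "x \<sqinter>\<^bsub>B\<^esub> (y \<squnion>\<^bsub>B\<^esub> z) = (x \<sqinter>\<^bsub>B\<^esub> y) \<squnion>\<^bsub>B\<^esub> (x \<sqinter>\<^bsub>B\<^esub> z)"
    if "x \<in> carrier B" "y \<in> carrier B" "z \<in> carrier B" for x y z
    using that by (simp add: clop_eq_iff clop_simps Int_Un_distrib)
  show "tt B \<squnion>\<^bsub>B\<^esub> ff B = \<top>\<^bsub>B\<^esub>" "tt B \<sqinter>\<^bsub>B\<^esub> ff B = \<bottom>\<^bsub>B\<^esub>"
    by (simp_all add: clop_eq_iff clop_simps)
  \<comment> \<open>Nonemptiness of the space enters here: it separates \<open>tt\<close> from top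
    and from bottom.\<close>
  show "{tt B, ff B} \<noteq> {\<top>\<^bsub>B\<^esub>, \<bottom>\<^bsub>B\<^esub>}"
  proof -
    have "\<phi> (tt B) \<noteq> \<phi> \<top>\<^bsub>B\<^esub>" "\<phi> (tt B) \<noteq> \<phi> \<bottom>\<^bsub>B\<^esub>"
      using points_nonempty by (simp_all add: clop_simps)
    then have "tt B \<noteq> \<top>\<^bsub>B\<^esub>" "tt B \<noteq> \<bottom>\<^bsub>B\<^esub>"
      by metis+
    then show ?thesis
      by (simp add: doubleton_eq_iff)
  qed
  show "y \<in> con B" if "x \<in> con B" "y \<in> carrier B" "y \<sqsubseteq>\<^bsub>B\<^esub> x" for x y
    using that le_B[of y x] unfolding con_B by auto
  show "y \<in> tot B" if "x \<in> tot B" "y \<in> carrier B" "x \<sqsubseteq>\<^bsub>B\<^esub> y" for x y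
    using that le_B[of x y] clop_subset[of y] unfolding tot_B by auto
  show "\<alpha> \<sqsubseteq>\<^bsub>B\<^esub> \<beta>" if "\<alpha> \<in> con B" "\<beta> \<in> tot B" "\<alpha> \<sqinter>\<^bsub>B\<^esub> tt B = \<beta> \<sqinter>\<^bsub>B\<^esub> tt B \<or> \<alpha> \<sqinter>\<^bsub>B\<^esub> ff B = \<beta> \<sqinter>\<^bsub>B\<^esub> ff B"
    for \<alpha> \<beta>
  proof -
    have c: "\<alpha> \<in> carrier B" "\<beta> \<in> carrier B"
      using that by (simp_all add: con_B tot_B)
    have "\<phi> (\<alpha> \<sqinter>\<^bsub>B\<^esub> tt B) = \<phi> (\<beta> \<sqinter>\<^bsub>B\<^esub> tt B) \<or> \<phi> (\<alpha> \<sqinter>\<^bsub>B\<^esub> ff B) = \<phi> (\<beta> \<sqinter>\<^bsub>B\<^esub> ff B)"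
      using that(3) by metis
    then have "fst (\<phi> \<alpha>) = fst (\<phi> \<beta>) \<or> snd (\<phi> \<alpha>) = snd (\<phi> \<beta>)"
      using clop_subset[OF c(1)] clop_subset[OF c(2)] c by (simp add: clop_simps Int_absorb2)
    moreover have "fst (\<phi> \<alpha>) \<inter> snd (\<phi> \<alpha>) = {}" "fst (\<phi> \<beta>) \<union> snd (\<phi> \<beta>) = points X"
      using that(1,2) by (simp_all add: con_B tot_B)
    \<comment> \<open>If the first components agree, the second one of \<open>\<alpha>\<close>
      avoids that common set and the second one of \<open>\<beta>\<close> covers its complement; the
      other case is symmetric.\<close>
    ultimately have "fst (\<phi> \<alpha>) \<subseteq> fst (\<phi> \<beta>) \<and> snd (\<phi> \<alpha>) \<subseteq> snd (\<phi> \<beta>)"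
      using clop_subset[OF c(1)] by blast
    then show ?thesis
      using c by (simp add: le_B)
  qed
  show "\<exists>a'\<in>neg_part B. a \<squnion>\<^bsub>B\<^esub> a' \<in> con B \<inter> tot B" if "a \<in> pos_part B" for a
  proof -
    have a: "a \<in> carrier B" "snd (\<phi> a) = {}"
      using that le_B[of a "tt B"] by (simp_all add: pos_part_def tt_B)
    obtain a' where a': "a' \<in> carrier B" "\<phi> a' = ({}, points X - fst (\<phi> a))"
      using clop_complement(1)[OF a(1)] by (elim bexE)
    then show ?thesis
      using a clop_subset(1)[OF a(1)]
      by (intro bexI[of _ a']) (auto simp: neg_part_def le_B clop_simps con_B tot_B)
  qed
  show "\<exists>b'\<in>pos_part B. b' \<squnion>\<^bsub>B\<^esub> b \<in> con B \<inter> tot B" if "b \<in> neg_part B" for b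
  proof -
    have b: "b \<in> carrier B" "fst (\<phi> b) = {}"
      using that le_B[of b "ff B"] by (simp_all add: neg_part_def ff_B)
    obtain b' where b': "b' \<in> carrier B" "\<phi> b' = (points X - snd (\<phi> b), {})"
      using clop_complement(2)[OF b(1)] by (elim bexE)
    then show ?thesis
      using b clop_subset(2)[OF b(1)]
      by (intro bexI[of _ b']) (auto simp: pos_part_def le_B clop_simps con_B tot_B)
  qed
qed (auto simp: con_B tot_B tt_B ff_B clop_logic_meet clop_logic_join logic_closed)

section \<open>Points of a d-Boolean space as homomorphisms on its clopen algebra\<close>

lemma pos_base:
  assumes "openin (pos_top X) U" "x \<in> U"
  obtains c where "c \<in> carrier B" "x \<in> fst (\<phi> c)" "fst (\<phi> c) \<subseteq> U" "snd (\<phi> c) = {}"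
proof -
  obtain W where "openin (pos_top X) W" "closedin (neg_top X) W" "x \<in> W" "W \<subseteq> U"
    using space assms
    unfolding d_boolean_space_def bitop_zero_dimensional_def has_base_of_closed_def
    by (metis (no_types, lifting) Sup_upper UnionE subsetD)
  then show thesis
    using clop_exists[of W "{}"] that by auto
qed

lemma neg_base:
  assumes "openin (neg_top X) V" "x \<in> V"
  obtains c where "c \<in> carrier B" "x \<in> snd (\<phi> c)" "snd (\<phi> c) \<subseteq> V" "fst (\<phi> c) = {}"
proof -
  obtain W where "openin (neg_top X) W" "closedin (pos_top X) W" "x \<in> W" "W \<subseteq> V"
    using space assms
    unfolding d_boolean_space_def bitop_zero_dimensional_def has_base_of_closed_def
    by (metis (no_types, lifting) Sup_upper UnionE subsetD)
  then show thesis
    using clop_exists[of "{}" W] that by auto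
qed

definition eps :: "'b \<Rightarrow> 'c \<Rightarrow> bool \<times> bool" where
  "eps x = (\<lambda>c\<in>carrier B. (x \<in> fst (\<phi> c), x \<in> snd (\<phi> c)))"

lemma eps_in_homs4: "x \<in> points X \<Longrightarrow> eps x \<in> homs4 B"
  by (auto simp: dlat_hom_def eps_def clop_simps con_B tot_B)

text \<open>Clopen sets form a base of each topology, so points with equal evaluations lie in the
  same open sets, which the \<open>T_0\<close> axiom forbids for distinct points.\<close>

lemma eps_inj: "inj_on eps (points X)"
proof (rule inj_onI, rule ccontr)
  fix x y assume xy: "x \<in> points X" "y \<in> points X" "x \<noteq> y" and eq: "eps x = eps y"
  have same: "x \<in> fst (\<phi> c) \<longleftrightarrow> y \<in> fst (\<phi> c)" "x \<in> snd (\<phi> c) \<longleftrightarrow> y \<in> snd (\<phi> c)" if "c \<in> carrier B" for c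
    using fun_cong[OF eq, of c] that by (auto simp: eps_def)
  have "x \<in> U \<longleftrightarrow> y \<in> U" if "openin (pos_top X) U \<or> openin (neg_top X) U" for U
    using that pos_base neg_base same by (metis subsetD)
  then show False
    using space xy by (auto simp: d_boolean_space_def bitop_T0_def)
qed

lemma eps_surj:
  assumes p: "p \<in> homs4 B"
  shows "\<exists>x\<in>points X. p = eps x"
proof (rule ccontr)
  assume none: "\<not> ?thesis"
  let ?F = "{c \<in> carrier B. p c = (False, False)}"
  let ?C = "(\<lambda>c. fst (\<phi> c)) ` ?F \<union> (\<lambda>c. snd (\<phi> c)) ` ?F"
  \<comment> \<open>A disagreement between \<open>p\<close> and evaluation at \<open>x\<close> is
    turned into a clopen pair on which \<open>p\<close> vanishes although one of its components
    contains \<open>x\<close>.\<close>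
  have misses: "\<exists>c\<in>?F. x \<in> fst (\<phi> c) \<or> x \<in> snd (\<phi> c)" if x: "x \<in> points X" for x
  proof -
    obtain c where c: "c \<in> carrier B" "p c \<noteq> (x \<in> fst (\<phi> c), x \<in> snd (\<phi> c))"
      using none x PiE_ext[OF dlat_homD(1)[OF p] dlat_homD(1)[OF eps_in_homs4[OF x]]]
      by (auto simp: eps_def)
    \<comment> \<open>Evaluation at \<open>x\<close> is itself a homomorphism, so membership of
      \<open>x\<close> in the components of \<open>mix\<close> and \<open>star\<close> follows from
      the general rules.\<close>
    have px: "p (mix a b) = (fst (p a), snd (p b))"
      "x \<in> fst (\<phi> (mix a b)) \<longleftrightarrow> x \<in> fst (\<phi> a)" "x \<in> snd (\<phi> (mix a b)) \<longleftrightarrow> x \<in> snd (\<phi> b)"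
      if "a \<in> carrier B" "b \<in> carrier B" for a b
      using homs4_mix[OF p that] homs4_mix[OF eps_in_homs4[OF x] that] mix_closed[OF that] that
      by (simp_all add: eps_def prod_eq_iff)
    have ps: "fst (p (star a)) \<longleftrightarrow> \<not> snd (p a)" "snd (p (star a)) \<longleftrightarrow> \<not> fst (p a)"
      "x \<in> fst (\<phi> (star a)) \<longleftrightarrow> x \<notin> snd (\<phi> a)" "x \<in> snd (\<phi> (star a)) \<longleftrightarrow> x \<notin> fst (\<phi> a)"
      if "a \<in> carrier B" for a
      using homs4_star[OF p that] homs4_star[OF eps_in_homs4[OF x] that] star_closed[OF that] that
      by (simp_all add: eps_def)
    let ?o = "\<bottom>\<^bsub>B\<^esub>"
    have o: "p ?o = (False, False)" "\<phi> ?o = ({}, {})" "?o \<in> carrier B"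
      using homs4_consts[OF p] clop_bottom bottom_closed by simp_all
    \<comment> \<open>Mixing with bottom isolates the coordinate of disagreement. Where
      \<open>p\<close> is true and \<open>x\<close> is outside, \<open>star\<close> first moves the
      disagreement to the other coordinate and negates both values.\<close>
    consider "\<not> fst (p c)" "x \<in> fst (\<phi> c)" | "fst (p c)" "x \<notin> fst (\<phi> c)"
      | "\<not> snd (p c)" "x \<in> snd (\<phi> c)" | "snd (p c)" "x \<notin> snd (\<phi> c)"
      using c(2) by (auto simp: prod_eq_iff)
    then show ?thesis
    proof cases
      case 1 then show ?thesis
        using px[OF c(1) o(3)] c(1) o by (intro bexI[of _ "mix c ?o"]) auto
    next
      case 2 then show ?thesis
        using px[OF o(3) star_closed[OF c(1)]] ps[OF c(1)] c(1) o
        by (intro bexI[of _ "mix ?o (star c)"]) auto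
    next
      case 3 then show ?thesis
        using px[OF o(3) c(1)] c(1) o by (intro bexI[of _ "mix ?o c"]) auto
    next
      case 4 then show ?thesis
        using px[OF star_closed[OF c(1)] o(3)] ps[OF c(1)] c(1) o
        by (intro bexI[of _ "mix (star c) ?o"]) auto
    qed
  qed
  have "points X \<subseteq> \<Union>?C"
  proof
    fix x assume "x \<in> points X"
    from misses[OF this] obtain c where "c \<in> ?F" "x \<in> fst (\<phi> c) \<or> x \<in> snd (\<phi> c)"
      by (elim bexE)
    then show "x \<in> \<Union>?C"
      by auto
  qed
  moreover have "\<forall>U\<in>?C. openin (pos_top X) U \<or> openin (neg_top X) U"
    using clop_clopen(1,3) by auto
  moreover have "bitop_compact X"
    using space by (simp add: d_boolean_space_def)
  ultimately have "\<exists>\<F>. finite \<F> \<and> \<F> \<subseteq> ?C \<and> points X \<subseteq> \<Union>\<F>"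
    unfolding bitop_compact_def by simp
  then obtain \<F> where \<F>: "finite \<F>" "\<F> \<subseteq> ?C" "points X \<subseteq> \<Union>\<F>"
    by (elim exE conjE)
  \<comment> \<open>Joining pairs on which \<open>p\<close> vanishes gives another such pair, so one
    pair absorbs the whole finite subcover and therefore belongs to \<open>tot\<close>.\<close>
  have "\<exists>c\<in>?F. \<Union>\<F> \<subseteq> fst (\<phi> c) \<union> snd (\<phi> c)"
    using \<F>(1,2)
  proof (induction \<F>)
    case empty
    then show ?case
      using homs4_consts(2)[OF p] bottom_closed by (intro bexI[of _ "\<bottom>\<^bsub>B\<^esub>"]) auto
  next
    case (insert U \<F>)
    then obtain c where c: "c \<in> ?F" "\<Union>\<F> \<subseteq> fst (\<phi> c) \<union> snd (\<phi> c)"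
      by auto
    from insert.prems obtain d where d: "d \<in> ?F" "U = fst (\<phi> d) \<or> U = snd (\<phi> d)"
      by auto
    have "c \<squnion>\<^bsub>B\<^esub> d \<in> ?F"
      using c d homs4_simps(1)[OF p, of c d] by simp
    then show ?case
      using c d by (intro bexI[of _ "c \<squnion>\<^bsub>B\<^esub> d"]) (auto simp: clop_join)
  qed
  then obtain c where c: "c \<in> carrier B" "p c = (False, False)" "points X \<subseteq> fst (\<phi> c) \<union> snd (\<phi> c)"
    using \<F>(3) by auto
  then have "c \<in> tot B"
    using clop_subset[OF c(1)] by (auto simp: tot_B)
  then show False
    using dlat_homD(10)[OF p] c(2) by fastforce
qed

lemma eps_bij: "bij_betw eps (points X) (homs4 B)"
  using eps_inj eps_in_homs4 eps_surj by (auto simp: bij_betw_def)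

end

section \<open>Homomorphisms and isomorphisms\<close>

lemma dlat_hom_compose:
  assumes "d_lattice A" "f \<in> dlat_hom A B" "g \<in> dlat_hom B D"
  shows "compose (carrier A) g f \<in> dlat_hom A D"
proof -
  interpret A: d_lattice A by fact
  have "f x \<in> carrier B" if "x \<in> carrier A" for x
    using dlat_homD(2)[OF assms(2) that] .
  moreover have "x \<in> carrier A" if "x \<in> con A \<or> x \<in> tot A" for x
    using that A.con_carrier A.tot_carrier by blast
  ultimately show ?thesis
    using dlat_homD(2-10)[OF assms(2)] dlat_homD(2-10)[OF assms(3)] A.tt_carrier A.ff_carrier
    by (auto simp: dlat_hom_def compose_def)
qed

lemma dlat_hom_id: "d_lattice A \<Longrightarrow> (\<lambda>x\<in>carrier A. x) \<in> dlat_hom A A"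
proof -
  assume "d_lattice A"
  then interpret A: d_lattice A .
  show ?thesis
    using A.con_carrier A.tot_carrier A.tt_carrier A.ff_carrier by (auto simp: dlat_hom_def)
qed

text \<open>The inverse of a bijective homomorphism respects the lattice operations automatically;
  reflection of \<open>con\<close> and \<open>tot\<close> makes it respect these two sets.\<close>

lemma dlat_isoI:
  assumes "d_lattice A" "d_lattice B" and f: "f \<in> dlat_hom A B"
    and bij: "bij_betw f (carrier A) (carrier B)"
    and con: "\<And>x. x \<in> carrier A \<Longrightarrow> f x \<in> con B \<Longrightarrow> x \<in> con A"
    and tot: "\<And>x. x \<in> carrier A \<Longrightarrow> f x \<in> tot B \<Longrightarrow> x \<in> tot A"
  shows "f \<in> dlat_iso A B"
proof -
  interpret A: d_lattice A by fact
  interpret B: d_lattice B by fact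
  define g where "g = (\<lambda>y\<in>carrier B. inv_into (carrier A) f y)"
  have gc: "g y \<in> carrier A" "f (g y) = y" if "y \<in> carrier B" for y
    using that bij_betw_inv_into_right[OF bij that] bij_betw_apply[OF bij_betw_inv_into[OF bij] that]
    by (simp_all add: g_def)
  have gf: "g (f x) = x" if "x \<in> carrier A" for x
    using that bij_betw_inv_into_left[OF bij that] dlat_homD(2)[OF f that] by (simp add: g_def)
  have geq: "g y = x" if "x \<in> carrier A" "f x = y" for x y
    using gf that by blast
  have "g \<in> dlat_hom B A"
    unfolding dlat_hom_def
  proof (intro CollectI conjI ballI subsetI)
    show "g \<in> carrier B \<rightarrow>\<^sub>E carrier A"
      using gc by (auto simp: g_def)
    show "g (x \<squnion>\<^bsub>B\<^esub> y) = g x \<squnion>\<^bsub>A\<^esub> g y" if "x \<in> carrier B" "y \<in> carrier B" for x y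
      using that gc dlat_homD(3)[OF f] by (intro geq) simp_all
    show "g (x \<sqinter>\<^bsub>B\<^esub> y) = g x \<sqinter>\<^bsub>A\<^esub> g y" if "x \<in> carrier B" "y \<in> carrier B" for x y
      using that gc dlat_homD(4)[OF f] by (intro geq) simp_all
    show "g \<top>\<^bsub>B\<^esub> = \<top>\<^bsub>A\<^esub>" "g \<bottom>\<^bsub>B\<^esub> = \<bottom>\<^bsub>A\<^esub>" "g (tt B) = tt A" "g (ff B) = ff A"
      using dlat_homD(5-8)[OF f] A.tt_carrier A.ff_carrier by (intro geq; simp)+
    show "x \<in> con A" if "x \<in> g ` con B" for x
      using that gc con B.con_carrier by (metis imageE subsetD)
    show "x \<in> tot A" if "x \<in> g ` tot B" for x
      using that gc tot B.tot_carrier by (metis imageE subsetD)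
  qed
  then show ?thesis
    using f gf gc by (auto simp: dlat_iso_def)
qed

lemma bitop_hom_apply: "f \<in> bitop_hom X Y \<Longrightarrow> x \<in> points X \<Longrightarrow> f x \<in> points Y"
  by (auto simp: bitop_hom_def points_def continuous_map_def)

lemma bitop_hom_compose:
  assumes "bitopological_space X" "f \<in> bitop_hom X Y" "g \<in> bitop_hom Y Z"
  shows "compose (points X) g f \<in> bitop_hom X Z"
proof -
  have "continuous_map (pos_top X) (pos_top Z) (g \<circ> f)" "continuous_map (neg_top X) (neg_top Z) (g \<circ> f)"
    using assms by (auto simp: bitop_hom_def intro: continuous_map_compose)
  moreover have "topspace (pos_top X) = points X" "topspace (neg_top X) = points X"
    using assms(1) by (simp_all add: bitopological_space_def points_def)
  ultimately have "continuous_map (pos_top X) (pos_top Z) (compose (points X) g f)"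
    "continuous_map (neg_top X) (neg_top Z) (compose (points X) g f)"
    by (auto elim!: continuous_map_eq simp: compose_def)
  then show ?thesis
    by (simp add: bitop_hom_def)
qed

lemma bitop_hom_id: "bitopological_space X \<Longrightarrow> (\<lambda>x\<in>points X. x) \<in> bitop_hom X X"
  by (auto simp: bitop_hom_def bitopological_space_def points_def
      intro!: continuous_map_eq[OF continuous_map_id])

lemma bitop_homI:
  assumes "bitopological_space X" "bitopological_space Y"
    and "f \<in> points X \<rightarrow>\<^sub>E points Y"
    and "\<And>V. openin (pos_top Y) V \<Longrightarrow> openin (pos_top X) (f -` V \<inter> points X)"
    and "\<And>V. openin (neg_top Y) V \<Longrightarrow> openin (neg_top X) (f -` V \<inter> points X)"
  shows "f \<in> bitop_hom X Y"
proof -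
  have "f -` V \<inter> points X = {x \<in> points X. f x \<in> V}" for V
    by auto
  then show ?thesis
    using assms by (auto simp: bitop_hom_def bitopological_space_def points_def continuous_map_def PiE_def)
qed

lemma bitop_hom_vimage:
  assumes "bitopological_space X" "f \<in> bitop_hom X Y"
  shows "openin (pos_top Y) V \<Longrightarrow> openin (pos_top X) (f -` V \<inter> points X)"
    and "openin (neg_top Y) V \<Longrightarrow> openin (neg_top X) (f -` V \<inter> points X)"
    and "closedin (pos_top Y) V \<Longrightarrow> closedin (pos_top X) (f -` V \<inter> points X)"
    and "closedin (neg_top Y) V \<Longrightarrow> closedin (neg_top X) (f -` V \<inter> points X)"
proof -
  have f: "continuous_map (pos_top X) (pos_top Y) f" "continuous_map (neg_top X) (neg_top Y) f"
    using assms(2) by (simp_all add: bitop_hom_def)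
  have eq: "f -` V \<inter> points X = {x \<in> topspace (pos_top X). f x \<in> V}"
    "f -` V \<inter> points X = {x \<in> topspace (neg_top X). f x \<in> V}" for V
    using assms(1) by (auto simp: bitopological_space_def points_def)
  show "openin (pos_top Y) V \<Longrightarrow> openin (pos_top X) (f -` V \<inter> points X)"
    "closedin (pos_top Y) V \<Longrightarrow> closedin (pos_top X) (f -` V \<inter> points X)"
    unfolding eq(1) by (fact openin_continuous_map_preimage[OF f(1)] closedin_continuous_map_preimage[OF f(1)])+
  show "openin (neg_top Y) V \<Longrightarrow> openin (neg_top X) (f -` V \<inter> points X)"
    "closedin (neg_top Y) V \<Longrightarrow> closedin (neg_top X) (f -` V \<inter> points X)"
    unfolding eq(2) by (fact openin_continuous_map_preimage[OF f(2)] closedin_continuous_map_preimage[OF f(2)])+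
qed

lemma bitop_isoI:
  assumes X: "bitopological_space X" and Y: "bitopological_space Y"
    and f: "f \<in> bitop_hom X Y" and bij: "bij_betw f (points X) (points Y)"
    and pos: "\<And>U. openin (pos_top X) U \<Longrightarrow> openin (pos_top Y) (f ` U)"
    and neg: "\<And>U. openin (neg_top X) U \<Longrightarrow> openin (neg_top Y) (f ` U)"
  shows "f \<in> bitop_iso X Y"
proof -
  define g where "g = (\<lambda>y\<in>points Y. inv_into (points X) f y)"
  have gc: "g y \<in> points X" "f (g y) = y" if "y \<in> points Y" for y
    using that bij_betw_inv_into_right[OF bij that] bij_betw_apply[OF bij_betw_inv_into[OF bij] that]
    by (simp_all add: g_def)
  have gf: "g (f x) = x" if "x \<in> points X" for x
    using that bij_betw_inv_into_left[OF bij that] bij_betw_apply[OF bij that] by (simp add: g_def)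
  have vim: "g -` U \<inter> points Y = f ` U" if "U \<subseteq> points X" for U
    using that gc gf bij_betw_apply[OF bij] by (auto simp: image_iff) (metis subsetD)
  have sub: "U \<subseteq> points X" if "openin (pos_top X) U \<or> openin (neg_top X) U" for U
    using that X openin_subset by (auto simp: bitopological_space_def points_def)
  have "g \<in> bitop_hom Y X"
  proof (rule bitop_homI[OF Y X])
    show "g \<in> points Y \<rightarrow>\<^sub>E points X"
      using gc by (auto simp: g_def)
  qed (use vim sub pos neg in auto)
  then show ?thesis
    using f gf gc by (auto simp: bitop_iso_def)
qed

lemma dclop_simps:
  "x \<in> carrier (dclop X) \<longleftrightarrow> openin (pos_top X) (fst x) \<and> closedin (neg_top X) (fst x) \<and>
     openin (neg_top X) (snd x) \<and> closedin (pos_top X) (snd x)"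
  "x \<in> con (dclop X) \<longleftrightarrow> x \<in> carrier (dclop X) \<and> fst x \<inter> snd x = {}"
  "x \<in> tot (dclop X) \<longleftrightarrow> x \<in> carrier (dclop X) \<and> fst x \<union> snd x = points X"
  "x \<sqsubseteq>\<^bsub>dclop X\<^esub> y \<longleftrightarrow> fst x \<subseteq> fst y \<and> snd x \<subseteq> snd y"
  "tt (dclop X) = (points X, {})" "ff (dclop X) = ({}, points X)" "eq (dclop X) = (=)"
  by (cases x; simp add: dclop_def)+

lemma encoded_clopens_dclop:
  assumes "d_boolean_space X"
  shows "encoded_clopens X (dclop X) (\<lambda>c. c)"
proof -
  have "topspace (pos_top X) = points X" "topspace (neg_top X) = points X"
    using assms by (simp_all add: d_boolean_space_def bitopological_space_def points_def)
  then have "openin (pos_top X) (points X)" "openin (neg_top X) (points X)"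
    "closedin (pos_top X) (points X)" "closedin (neg_top X) (points X)"
    by (metis openin_topspace closedin_topspace)+
  then show ?thesis
    using assms by unfold_locales (simp_all add: dclop_simps set_eq_iff bij_betw_def inj_on_def)
qed

context encoded_spectrum
begin

lemma space_X: "bitopological_space X"
  using d_boolean_space_spectrum by (simp add: d_boolean_space_def)

sublocale dclop: encoded_clopens X "dclop X" "\<lambda>c. c"
  by (rule encoded_clopens_dclop[OF d_boolean_space_spectrum])

lemma eta_hom: "eta \<in> dlat_hom L (dclop X)"
proof -
  have c: "eta a \<in> carrier (dclop X)" if "a \<in> carrier L" for a
    using bij_betw_apply[OF eta_bij that] .
  have a: "a \<in> carrier L" if "a \<in> con L \<or> a \<in> tot L" for a
    using that con_carrier tot_carrier by blast
  show ?thesis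
    unfolding dlat_hom_def
  proof (intro CollectI conjI ballI subsetI)
    show "eta \<in> carrier L \<rightarrow>\<^sub>E carrier (dclop X)"
      using c by (auto simp: eta_def)
    show "eta (x \<squnion> y) = eta x \<squnion>\<^bsub>dclop X\<^esub> eta y" if "x \<in> carrier L" "y \<in> carrier L" for x y
      using that dclop.clop_join[OF c c, OF that] by (simp add: eta_def sets_join)
    show "eta (x \<sqinter> y) = eta x \<sqinter>\<^bsub>dclop X\<^esub> eta y" if "x \<in> carrier L" "y \<in> carrier L" for x y
      using that dclop.clop_meet[OF c c, OF that] by (simp add: eta_def sets_meet)
    show "eta \<top> = \<top>\<^bsub>dclop X\<^esub>" "eta \<bottom> = \<bottom>\<^bsub>dclop X\<^esub>" "eta (tt L) = tt (dclop X)" "eta (ff L) = ff (dclop X)"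
      using dclop.clop_top dclop.clop_bottom dclop.tt_B(2) dclop.ff_B(2)
      by (simp_all add: eta_def sets_consts points_spectrum tt_carrier ff_carrier)
    show "y \<in> con (dclop X)" if y: "y \<in> eta ` con L" for y
    proof -
      obtain x where x: "x \<in> con L" "y = eta x"
        using y by blast
      then show ?thesis
        using c[of x] con_iff_sets[of x] a[of x]
        by (simp add: dclop_simps(2,3) points_spectrum) (simp add: eta_def)
    qed
    show "y \<in> tot (dclop X)" if y: "y \<in> eta ` tot L" for y
    proof -
      obtain x where x: "x \<in> tot L" "y = eta x"
        using y by blast
      then show ?thesis
        using c[of x] tot_iff_sets[of x] a[of x]
        by (simp add: dclop_simps(2,3) points_spectrum) (simp add: eta_def)
    qed
  qed
qed

theorem eta_iso: "eta \<in> dlat_iso L (dclop X)"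
proof (rule dlat_isoI[OF _ _ eta_hom eta_bij])
  show "d_lattice L" "d_lattice (dclop X)"
    by unfold_locales
  show "x \<in> con L" if "x \<in> carrier L" "eta x \<in> con (dclop X)" for x
    using that by (simp add: con_iff_sets dclop.con_B) (simp add: eta_def)
  show "x \<in> tot L" if "x \<in> carrier L" "eta x \<in> tot (dclop X)" for x
    using that by (simp add: tot_iff_sets dclop.tot_B points_spectrum) (simp add: eta_def)
qed

end

section \<open>The dual functors\<close>

lemma is_category_op: "is_category C \<Longrightarrow> is_category (op_cat C)"
  by (simp add: is_category_def op_cat_def)

lemma restrict_id_right: "f \<in> extensional A \<Longrightarrow> compose A f (\<lambda>x\<in>A. x) = f"
  by (auto simp: fun_eq_iff compose_def extensional_def)

lemma restrict_id_left: "f \<in> A \<rightarrow>\<^sub>E B \<Longrightarrow> compose A (\<lambda>x\<in>B. x) f = f"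
  by (auto simp: fun_eq_iff compose_def PiE_def extensional_def)

lemma d_boolean_algebraD: "d_boolean_algebra A \<Longrightarrow> d_lattice A"
  by (simp add: d_boolean_algebra_def)

lemma dBA_simps:
  "A \<in> cat_obj (dBA \<U>) \<longleftrightarrow> d_boolean_algebra A \<and> carrier A \<in> \<U>"
  "cat_hom (dBA \<U>) A B = dlat_hom A B"
  "cat_id (dBA \<U>) A = (\<lambda>x\<in>carrier A. x)"
  "cat_comp (dBA \<U>) A B D g f = compose (carrier A) g f"
  by (simp_all add: dBA_def)

lemma dBS_simps:
  "X \<in> cat_obj (dBS \<U>) \<longleftrightarrow> d_boolean_space X \<and> points X \<in> \<U>"
  "cat_hom (dBS \<U>) X Y = bitop_hom X Y"
  "cat_id (dBS \<U>) X = (\<lambda>x\<in>points X. x)"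
  "cat_comp (dBS \<U>) X Y Z g f = compose (points X) g f"
  by (simp_all add: dBS_def)

lemma op_cat_simps:
  "cat_obj (op_cat C) = cat_obj C"
  "cat_hom (op_cat C) X Y = cat_hom C Y X"
  "cat_id (op_cat C) X = cat_id C X"
  "cat_comp (op_cat C) X Y Z g f = cat_comp C Z Y X f g"
  by (simp_all add: op_cat_def)

lemma bitop_hom_PiE:
  "bitopological_space X \<Longrightarrow> f \<in> bitop_hom X Y \<Longrightarrow> f \<in> points X \<rightarrow>\<^sub>E points Y"
  using bitop_hom_apply[of f X Y] by (auto simp: bitop_hom_def PiE_def)

lemma is_category_dBA: "is_category (dBA (\<U> :: 'a set set))"
  unfolding is_category_def dBA_simps
proof (intro conjI ballI)
  fix A B D :: "'a dlat" and f g
  assume "A \<in> cat_obj (dBA \<U>)" "f \<in> dlat_hom A B" "g \<in> dlat_hom B D"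
  then show "compose (carrier A) g f \<in> dlat_hom A D"
    by (simp add: dBA_simps dlat_hom_compose d_boolean_algebraD)
next
  fix A B :: "'a dlat" and f assume "f \<in> dlat_hom A B"
  then show "compose (carrier A) f (\<lambda>x\<in>carrier A. x) = f" "compose (carrier A) (\<lambda>x\<in>carrier B. x) f = f"
    using dlat_homD(1)[of f A B] by (simp_all add: restrict_id_right restrict_id_left PiE_def)
next
  fix A B D E :: "'a dlat" and f g h assume "f \<in> dlat_hom A B"
  then show "compose (carrier A) h (compose (carrier A) g f) = compose (carrier A) (compose (carrier B) h g) f"
    using dlat_homD(2)[of f A B] by (auto simp: compose_def fun_eq_iff)
qed (simp add: dBA_simps dlat_hom_id d_boolean_algebraD)

lemma is_category_dBS: "is_category (dBS (\<U> :: 'a set set))"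
  unfolding is_category_def dBS_simps
proof (intro conjI ballI)
  fix X Y Z :: "'a bitop" and f g
  assume "X \<in> cat_obj (dBS \<U>)" "f \<in> bitop_hom X Y" "g \<in> bitop_hom Y Z"
  then show "compose (points X) g f \<in> bitop_hom X Z"
    by (intro bitop_hom_compose) (simp_all add: dBS_simps d_boolean_space_def)
next
  fix X Y :: "'a bitop" and f assume X: "X \<in> cat_obj (dBS \<U>)" and f: "f \<in> bitop_hom X Y"
  show "compose (points X) f (\<lambda>x\<in>points X. x) = f"
    using f by (simp add: bitop_hom_def restrict_id_right)
  show "compose (points X) (\<lambda>x\<in>points Y. x) f = f"
    using X f bitop_hom_PiE[of X f Y] by (simp add: dBS_simps d_boolean_space_def restrict_id_left)
next
  fix W X Y Z :: "'a bitop" and f g h assume "f \<in> bitop_hom W X"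
  then show "compose (points W) h (compose (points W) g f) = compose (points W) (compose (points X) h g) f"
    using bitop_hom_apply[of f W X] by (auto simp: compose_def fun_eq_iff)
qed (simp add: dBS_simps bitop_hom_id d_boolean_space_def)

lemma dclop_map_apply:
  "c \<in> carrier (dclop Y) \<Longrightarrow> dclop_map Y X f c = (f -` fst c \<inter> points X, f -` snd c \<inter> points X)"
  by (simp add: dclop_map_def split: prod.split)

lemma dclop_map_hom:
  assumes X: "d_boolean_space X" and Y: "d_boolean_space Y" and f: "f \<in> bitop_hom X Y"
  shows "dclop_map Y X f \<in> dlat_hom (dclop Y) (dclop X)"
proof -
  interpret X: encoded_clopens X "dclop X" "\<lambda>c. c"
    by (rule encoded_clopens_dclop[OF X])
  interpret Y: encoded_clopens Y "dclop Y" "\<lambda>c. c"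
    by (rule encoded_clopens_dclop[OF Y])
  have b: "bitopological_space X"
    using X by (simp add: d_boolean_space_def)
  have closed: "dclop_map Y X f c \<in> carrier (dclop X)" if "c \<in> carrier (dclop Y)" for c
    using that bitop_hom_vimage[OF b f] by (simp add: dclop_map_apply) (simp add: dclop_simps)
  have pts: "f -` points Y \<inter> points X = points X"
    using bitop_hom_apply[OF f] by auto
  show ?thesis
    unfolding dlat_hom_def
  proof (intro CollectI conjI ballI subsetI)
    show "dclop_map Y X f \<in> carrier (dclop Y) \<rightarrow>\<^sub>E carrier (dclop X)"
      using closed by (auto simp: dclop_map_def)
    show "dclop_map Y X f (x \<squnion>\<^bsub>dclop Y\<^esub> y) = dclop_map Y X f x \<squnion>\<^bsub>dclop X\<^esub> dclop_map Y X f y"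
      if "x \<in> carrier (dclop Y)" "y \<in> carrier (dclop Y)" for x y
      using that X.clop_join[OF closed closed, OF that] Y.clop_join[OF that]
        dclop_map_apply[OF Y.join_closed[OF that], of X f]
      by (simp add: dclop_map_apply Int_Un_distrib2)
    show "dclop_map Y X f (x \<sqinter>\<^bsub>dclop Y\<^esub> y) = dclop_map Y X f x \<sqinter>\<^bsub>dclop X\<^esub> dclop_map Y X f y"
      if "x \<in> carrier (dclop Y)" "y \<in> carrier (dclop Y)" for x y
      using that X.clop_meet[OF closed closed, OF that] Y.clop_meet[OF that]
        dclop_map_apply[OF Y.meet_closed[OF that], of X f]
      by (simp add: dclop_map_apply) auto
    show "dclop_map Y X f \<top>\<^bsub>dclop Y\<^esub> = \<top>\<^bsub>dclop X\<^esub>" "dclop_map Y X f \<bottom>\<^bsub>dclop Y\<^esub> = \<bottom>\<^bsub>dclop X\<^esub>"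
      "dclop_map Y X f (tt (dclop Y)) = tt (dclop X)" "dclop_map Y X f (ff (dclop Y)) = ff (dclop X)"
      using Y.clop_top X.clop_top Y.clop_bottom X.clop_bottom Y.tt_B X.tt_B Y.ff_B X.ff_B pts
        Y.top_closed Y.bottom_closed by (simp_all add: dclop_map_apply)
    show "c \<in> con (dclop X)" if "c \<in> dclop_map Y X f ` con (dclop Y)" for c
      using that closed by (auto simp: dclop_simps(2)) (auto simp: dclop_map_apply)
    show "c \<in> tot (dclop X)" if "c \<in> dclop_map Y X f ` tot (dclop Y)" for c
      using that closed pts by (auto simp: dclop_simps(3)) (auto simp: dclop_map_apply)
  qed
qed

lemma is_functor_dclop: "is_functor (op_cat (dBS UNIV)) (dBA UNIV) dclop dclop_map"
  unfolding is_functor_def op_cat_simps dBA_simps dBS_simps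
proof (intro conjI ballI)
  fix X :: "'a bitop" assume X: "X \<in> cat_obj (dBS UNIV)"
  then interpret encoded_clopens X "dclop X" "\<lambda>c. c"
    by (intro encoded_clopens_dclop) (simp add: dBS_simps)
  show "d_boolean_algebra (dclop X)"
    unfolding d_boolean_algebra_iff by unfold_locales
  show "carrier (dclop X) \<in> UNIV"
    by simp
  show "dclop_map X X (\<lambda>x\<in>points X. x) = (\<lambda>c\<in>carrier (dclop X). c)"
  proof
    fix c show "dclop_map X X (\<lambda>x\<in>points X. x) c = (\<lambda>c\<in>carrier (dclop X). c) c"
    proof (cases "c \<in> carrier (dclop X)")
      case True
      have "(\<lambda>x\<in>points X. x) -` U \<inter> points X = U" if "U \<subseteq> points X" for U
        using that by auto
      then show ?thesis
        using True clop_subset[OF True] by (simp add: dclop_map_apply)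
    qed (simp add: dclop_map_def)
  qed
next
  fix X Y :: "'a bitop" and f
  assume "X \<in> cat_obj (dBS UNIV)" "Y \<in> cat_obj (dBS UNIV)"
    "f \<in> bitop_hom Y X"
  then show "dclop_map X Y f \<in> dlat_hom (dclop X) (dclop Y)"
    by (simp add: dBS_simps dclop_map_hom)
next
  fix X Y Z :: "'a bitop" and f g
  assume XYZ: "X \<in> cat_obj (dBS UNIV)" "Y \<in> cat_obj (dBS UNIV)"
    "Z \<in> cat_obj (dBS UNIV)" and f: "f \<in> bitop_hom Y X" and g: "g \<in> bitop_hom Z Y"
  have "dclop_map X Y f \<in> dlat_hom (dclop X) (dclop Y)"
    using XYZ f by (simp add: dBS_simps dclop_map_hom)
  then have c: "dclop_map X Y f c \<in> carrier (dclop Y)" if "c \<in> carrier (dclop X)" for c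
    using dlat_homD(2) that by metis
  have v: "compose (points Z) f g -` U \<inter> points Z = g -` (f -` U \<inter> points Y) \<inter> points Z" for U
    using bitop_hom_apply[OF g] by (auto simp: compose_def)
  show "dclop_map X Z (compose (points Z) f g) =
      compose (carrier (dclop X)) (dclop_map Y Z g) (dclop_map X Y f)"
  proof
    fix x show "dclop_map X Z (compose (points Z) f g) x =
        compose (carrier (dclop X)) (dclop_map Y Z g) (dclop_map X Y f) x"
    proof (cases "x \<in> carrier (dclop X)")
      case True
      then show ?thesis
        using c[OF True] v by (simp add: compose_eq dclop_map_apply)
    qed (simp add: dclop_map_def compose_def)
  qed
qed (simp_all add: is_category_op is_category_dBS is_category_dBA)

section \<open>Functoriality of the spectrum with coded points\<close>

definition spectrum_map ::
  "'q set \<Rightarrow> ('q \<Rightarrow> 'b \<Rightarrow> bool \<times> bool) \<Rightarrow> 'r set \<Rightarrow> ('r \<Rightarrow> 'a \<Rightarrow> bool \<times> bool) \<Rightarrow> 'a dlat \<Rightarrow>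
   ('a \<Rightarrow> 'b) \<Rightarrow> 'q \<Rightarrow> 'r" where
  "spectrum_map Q h R k A f = (\<lambda>q\<in>Q. inv_into R k (compose (carrier A) (h q) f))"

text \<open>A homomorphism from \<open>A\<close> to \<open>B\<close> induces a map from the points
  of \<open>B\<close> to those of \<open>A\<close>; the parameters follow the direction of the
  induced map.\<close>

locale spectrum_pair = B: encoded_spectrum B Q h + A: encoded_spectrum A R k
  for B :: "'b dlat" and Q :: "'q set" and h and A :: "'a dlat" and R :: "'r set" and k
begin

lemma spectrum_map_code:
  assumes "f \<in> dlat_hom A B" "q \<in> Q"
  shows "spectrum_map Q h R k A f q \<in> R"
    and "k (spectrum_map Q h R k A f q) = compose (carrier A) (h q) f"
proof -
  have "compose (carrier A) (h q) f \<in> homs4 A"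
    by (rule dlat_hom_compose[OF A.d_lattice_axioms assms(1) B.code_hom[OF assms(2)]])
  then show "spectrum_map Q h R k A f q \<in> R"
    "k (spectrum_map Q h R k A f q) = compose (carrier A) (h q) f"
    using bij_betw_inv_into_right[OF A.code_bij] bij_betw_apply[OF bij_betw_inv_into[OF A.code_bij]] assms(2)
    by (simp_all add: spectrum_map_def)
qed

text \<open>Continuity of the induced map reduces to this computation on basic sets.\<close>

lemma spectrum_map_vimage:
  assumes "f \<in> dlat_hom A B" "a \<in> carrier A"
  shows "spectrum_map Q h R k A f -` A.pos_set a \<inter> Q = B.pos_set (f a)"
    and "spectrum_map Q h R k A f -` A.neg_set a \<inter> Q = B.neg_set (f a)"
  using spectrum_map_code[OF assms(1)] assms(2)
  by (auto simp: A.pos_set_def A.neg_set_def B.pos_set_def B.neg_set_def compose_eq)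

lemma spectrum_map_hom:
  assumes f: "f \<in> dlat_hom A B"
  shows "spectrum_map Q h R k A f \<in> bitop_hom B.X A.X"
proof (rule bitop_homI[OF B.space_X A.space_X], unfold A.points_spectrum B.points_spectrum)
  show "spectrum_map Q h R k A f \<in> Q \<rightarrow>\<^sub>E R"
    using spectrum_map_code(1)[OF f] by (auto simp: spectrum_map_def)
  show "openin (pos_top B.X) (spectrum_map Q h R k A f -` V \<inter> Q)" if "openin (pos_top A.X) V" for V
  proof -
    obtain S where S: "S \<subseteq> carrier A" "V = \<Union>(A.pos_set ` S)"
      using iffD1[OF A.openin_pos_iff \<open>openin (pos_top A.X) V\<close>] by (elim exE conjE)
    have "spectrum_map Q h R k A f -` V \<inter> Q = (\<Union>a\<in>S. spectrum_map Q h R k A f -` A.pos_set a \<inter> Q)"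
      using S(2) by auto
    also have "\<dots> = \<Union>(B.pos_set ` f ` S)"
      using S(1) spectrum_map_vimage(1)[OF f] by (auto simp: subset_iff)
    finally show ?thesis
      using S(1) dlat_homD(2)[OF f] unfolding B.openin_pos_iff by (intro exI[of _ "f ` S"]) auto
  qed
  show "openin (neg_top B.X) (spectrum_map Q h R k A f -` V \<inter> Q)" if "openin (neg_top A.X) V" for V
  proof -
    obtain S where S: "S \<subseteq> carrier A" "V = \<Union>(A.neg_set ` S)"
      using iffD1[OF A.openin_neg_iff \<open>openin (neg_top A.X) V\<close>] by (elim exE conjE)
    have "spectrum_map Q h R k A f -` V \<inter> Q = (\<Union>a\<in>S. spectrum_map Q h R k A f -` A.neg_set a \<inter> Q)"
      using S(2) by auto
    also have "\<dots> = \<Union>(B.neg_set ` f ` S)"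
      using S(1) spectrum_map_vimage(2)[OF f] by (auto simp: subset_iff)
    finally show ?thesis
      using S(1) dlat_homD(2)[OF f] unfolding B.openin_neg_iff by (intro exI[of _ "f ` S"]) auto
  qed
qed

text \<open>The points of \<open>B\<close> separate its elements; categorically, this is
  faithfulness.\<close>

lemma spectrum_map_inj:
  assumes f: "f \<in> dlat_hom A B" and g: "g \<in> dlat_hom A B"
    and eq: "spectrum_map Q h R k A f = spectrum_map Q h R k A g"
  shows "f = g"
proof (rule PiE_ext[OF dlat_homD(1)[OF f] dlat_homD(1)[OF g]])
  fix a assume a: "a \<in> carrier A"
  have "h q (f a) = h q (g a)" if "q \<in> Q" for q
    using spectrum_map_code(2)[OF f that] spectrum_map_code(2)[OF g that] a eq
    by (metis compose_eq)
  then show "f a = g a"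
    using B.eq_iff_homs4[of "f a" "g a"] dlat_homD(2)[OF f a] dlat_homD(2)[OF g a]
    by (simp add: B.ball_homs4)
qed

text \<open>Fullness. The preimage map of \<open>m\<close> between the clopen algebras is
  transported to \<open>A\<close> and \<open>B\<close> along the isomorphisms \<open>eta\<close>.
  The result induces \<open>m\<close>, because the induced point and \<open>m q\<close> code
  homomorphisms with the same value at every element.\<close>

lemma spectrum_map_surj:
  assumes m: "m \<in> bitop_hom B.X A.X"
  shows "\<exists>f\<in>dlat_hom A B. spectrum_map Q h R k A f = m"
proof -
  obtain e where e: "e \<in> dlat_hom (dclop B.X) B" "\<And>c. c \<in> carrier (dclop B.X) \<Longrightarrow> B.eta (e c) = c"
    using B.eta_iso by (auto simp: dlat_iso_def)
  let ?d = "dclop_map A.X B.X m"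
  have d: "?d \<in> dlat_hom (dclop A.X) (dclop B.X)"
    by (rule dclop_map_hom[OF B.d_boolean_space_spectrum A.d_boolean_space_spectrum m])
  define f where "f = compose (carrier A) e (compose (carrier A) ?d A.eta)"
  have f: "f \<in> dlat_hom A B"
    unfolding f_def
    by (rule dlat_hom_compose[OF A.d_lattice_axioms dlat_hom_compose[OF A.d_lattice_axioms A.eta_hom d] e(1)])
  have sets: "B.pos_set (f a) = m -` A.pos_set a \<inter> Q" "B.neg_set (f a) = m -` A.neg_set a \<inter> Q"
    if a: "a \<in> carrier A" for a
  proof -
    have ea: "A.eta a \<in> carrier (dclop A.X)"
      by (rule dlat_homD(2)[OF A.eta_hom a])
    then have "?d (A.eta a) \<in> carrier (dclop B.X)"
      by (rule dlat_homD(2)[OF d])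
    then have "B.eta (f a) = ?d (A.eta a)"
      using a e(2) by (simp add: f_def compose_eq)
    then show "B.pos_set (f a) = m -` A.pos_set a \<inter> Q" "B.neg_set (f a) = m -` A.neg_set a \<inter> Q"
      using dlat_homD(2)[OF f a] a ea
      by (simp_all add: B.eta_def dclop_map_apply B.points_spectrum) (simp_all add: A.eta_def)
  qed
  have "spectrum_map Q h R k A f q = m q" if q: "q \<in> Q" for q
  proof -
    have mq: "m q \<in> R"
      using bitop_hom_apply[OF m] q by (simp add: A.points_spectrum B.points_spectrum)
    have "k (spectrum_map Q h R k A f q) a = k (m q) a" if "a \<in> carrier A" for a
      using sets[OF that] spectrum_map_code(2)[OF f q] that q mq
      by (auto simp: compose_eq prod_eq_iff A.pos_set_def A.neg_set_def B.pos_set_def B.neg_set_def)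
    then have "k (spectrum_map Q h R k A f q) = k (m q)"
      by (rule PiE_ext[OF dlat_homD(1) dlat_homD(1), OF A.code_hom A.code_hom, OF spectrum_map_code(1)[OF f q] mq])
    then show ?thesis
      using A.code_bij spectrum_map_code(1)[OF f q] mq by (auto simp: bij_betw_def dest: inj_onD)
  qed
  moreover have "m \<in> extensional Q"
    using m by (simp add: bitop_hom_def B.points_spectrum)
  ultimately have "spectrum_map Q h R k A f = m"
    by (auto simp: fun_eq_iff spectrum_map_def extensional_def)
  then show ?thesis
    using f by blast
qed

end

text \<open>The coding may be chosen separately for each algebra; \<open>\<V>\<close> records where
  the coded point sets lie.\<close>

lemma is_functor_spectrum:
  assumes code: "\<And>A. A \<in> cat_obj (dBA \<U>) \<Longrightarrow> bij_betw (h A) (Q A) (homs4 A) \<and> Q A \<in> \<V>"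
  shows "is_functor (op_cat (dBA \<U>)) (dBS \<V>) (\<lambda>A. spectrum_via (Q A) (h A) A)
    (\<lambda>B A f. spectrum_map (Q B) (h B) (Q A) (h A) A f)"
proof -
  have enc: "encoded_spectrum A (Q A) (h A)" if "A \<in> cat_obj (dBA \<U>)" for A
    using that code[OF that]
    by (simp add: encoded_spectrum_def encoded_spectrum_axioms_def d_boolean_algebra_iff dBA_simps)
  show ?thesis
    unfolding is_functor_def op_cat_simps dBA_simps dBS_simps
  proof (intro conjI ballI)
    fix A :: "'a dlat" assume A: "A \<in> cat_obj (dBA \<U>)"
    interpret A: encoded_spectrum A "Q A" "h A"
      by (rule enc[OF A])
    show "d_boolean_space (spectrum_via (Q A) (h A) A)"
      by (rule A.d_boolean_space_spectrum)
    show "points (spectrum_via (Q A) (h A) A) \<in> \<V>"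
      using code[OF A] by (simp add: A.points_spectrum)
    show "spectrum_map (Q A) (h A) (Q A) (h A) A (\<lambda>x\<in>carrier A. x) = (\<lambda>x\<in>points (spectrum_via (Q A) (h A) A). x)"
    proof -
      have "compose (carrier A) (h A q) (\<lambda>x\<in>carrier A. x) = h A q" if "q \<in> Q A" for q
        using dlat_homD(1)[OF A.code_hom[OF that]] by (simp add: PiE_def restrict_id_right)
      then show ?thesis
        using bij_betw_inv_into_left[OF A.code_bij]
        by (auto simp: spectrum_map_def A.points_spectrum intro!: restrict_ext)
    qed
  next
    fix A B :: "'a dlat" and f
    assume AB: "A \<in> cat_obj (dBA \<U>)" "B \<in> cat_obj (dBA \<U>)"
      and f: "f \<in> dlat_hom B A"
    interpret spectrum_pair A "Q A" "h A" B "Q B" "h B"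
      by (intro spectrum_pair.intro enc AB)
    show "spectrum_map (Q A) (h A) (Q B) (h B) B f \<in>
        bitop_hom (spectrum_via (Q A) (h A) A) (spectrum_via (Q B) (h B) B)"
      by (rule spectrum_map_hom[OF f])
  next
    fix A B D :: "'a dlat" and f g
    assume ABD: "A \<in> cat_obj (dBA \<U>)" "B \<in> cat_obj (dBA \<U>)"
        "D \<in> cat_obj (dBA \<U>)"
      and f: "f \<in> dlat_hom B A" and g: "g \<in> dlat_hom D B"
    interpret AB: spectrum_pair A "Q A" "h A" B "Q B" "h B"
      by (intro spectrum_pair.intro enc ABD)
    show "spectrum_map (Q A) (h A) (Q D) (h D) D (compose (carrier D) f g) =
        compose (points (spectrum_via (Q A) (h A) A)) (spectrum_map (Q B) (h B) (Q D) (h D) D g)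
          (spectrum_map (Q A) (h A) (Q B) (h B) B f)"
    proof (rule ext)
      fix q
      show "spectrum_map (Q A) (h A) (Q D) (h D) D (compose (carrier D) f g) q =
          compose (points (spectrum_via (Q A) (h A) A)) (spectrum_map (Q B) (h B) (Q D) (h D) D g)
            (spectrum_map (Q A) (h A) (Q B) (h B) B f) q"
      proof (cases "q \<in> Q A")
        case True
        have "compose (carrier D) (h A q) (compose (carrier D) f g) =
            compose (carrier D) (compose (carrier B) (h A q) f) g"
          using dlat_homD(2)[OF g] by (auto simp: compose_def fun_eq_iff)
        then show ?thesis
          using True AB.spectrum_map_code[OF f True]
          by (simp add: compose_eq AB.B.points_spectrum) (simp add: spectrum_map_def)
      qed (simp add: spectrum_map_def compose_def AB.B.points_spectrum)
    qed
  qed (simp_all add: is_category_op is_category_dBA is_category_dBS)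
qed

lemma is_categoryD:
  assumes "is_category C"
  shows "X \<in> cat_obj C \<Longrightarrow> cat_id C X \<in> cat_hom C X X"
    and "\<lbrakk>X \<in> cat_obj C; Y \<in> cat_obj C; Z \<in> cat_obj C; f \<in> cat_hom C X Y; g \<in> cat_hom C Y Z\<rbrakk> \<Longrightarrow>
      cat_comp C X Y Z g f \<in> cat_hom C X Z"
    and "\<lbrakk>X \<in> cat_obj C; Y \<in> cat_obj C; f \<in> cat_hom C X Y\<rbrakk> \<Longrightarrow> cat_comp C X X Y f (cat_id C X) = f"
    and "\<lbrakk>X \<in> cat_obj C; Y \<in> cat_obj C; f \<in> cat_hom C X Y\<rbrakk> \<Longrightarrow> cat_comp C X Y Y (cat_id C Y) f = f"
    and "\<lbrakk>W \<in> cat_obj C; X \<in> cat_obj C; Y \<in> cat_obj C; Z \<in> cat_obj C;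
        f \<in> cat_hom C W X; g \<in> cat_hom C X Y; h \<in> cat_hom C Y Z\<rbrakk> \<Longrightarrow>
      cat_comp C W Y Z h (cat_comp C W X Y g f) = cat_comp C W X Z (cat_comp C X Y Z h g) f"
  using assms by (simp_all add: is_category_def)

lemma is_functorD:
  assumes "is_functor C D F Fm"
  shows "is_category C" "is_category D"
    and "X \<in> cat_obj C \<Longrightarrow> F X \<in> cat_obj D"
    and "\<lbrakk>X \<in> cat_obj C; Y \<in> cat_obj C; f \<in> cat_hom C X Y\<rbrakk> \<Longrightarrow> Fm X Y f \<in> cat_hom D (F X) (F Y)"
    and "X \<in> cat_obj C \<Longrightarrow> Fm X X (cat_id C X) = cat_id D (F X)"
    and "\<lbrakk>X \<in> cat_obj C; Y \<in> cat_obj C; Z \<in> cat_obj C; f \<in> cat_hom C X Y; g \<in> cat_hom C Y Z\<rbrakk> \<Longrightarrow>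
      Fm X Z (cat_comp C X Y Z g f) = cat_comp D (F X) (F Y) (F Z) (Fm Y Z g) (Fm X Y f)"
  using assms by (simp_all add: is_functor_def)

text \<open>The functor laws evaluate the arrow part on arrows only. This allows passing from
  \<open>spectrum_map\<close>, which goes through \<open>inv_into\<close>, to
  \<open>dspec_map\<close>, which agrees with it on homomorphisms.\<close>

lemma is_functor_cong:
  assumes F: "is_functor C D F Fm"
    and eq: "\<And>X Y f. X \<in> cat_obj C \<Longrightarrow> Y \<in> cat_obj C \<Longrightarrow> f \<in> cat_hom C X Y \<Longrightarrow> Fm' X Y f = Fm X Y f"
  shows "is_functor C D F Fm'"
  unfolding is_functor_def
  by (simp add: is_functorD[OF F] is_categoryD[OF is_functorD(1)[OF F]] eq)

section \<open>The functor of uncoded spectra\<close>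

lemma encoded_spectrum_dspec:
  "d_boolean_algebra A \<Longrightarrow> encoded_spectrum A (homs4 A) (\<lambda>p. p)"
  by (simp add: encoded_spectrum_def encoded_spectrum_axioms_def d_boolean_algebra_iff bij_betw_def)

lemma dspec_map_eq_spectrum_map:
  assumes "d_lattice A" "f \<in> dlat_hom A B"
  shows "dspec_map B A f = spectrum_map (homs4 B) (\<lambda>p. p) (homs4 A) (\<lambda>p. p) A f"
proof -
  have "inv_into (homs4 A) (\<lambda>p. p) (compose (carrier A) p f) = compose (carrier A) p f" if "p \<in> homs4 B" for p
    using inv_into_f_f[of "\<lambda>p. p" "homs4 A"] dlat_hom_compose[OF assms that] by simp
  then show ?thesis
    unfolding dspec_map_def spectrum_map_def by (intro restrict_ext) simp
qed

lemma is_functor_dspec: "is_functor (op_cat (dBA UNIV)) (dBS UNIV) dspec dspec_map"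
proof -
  have "is_functor (op_cat (dBA UNIV)) (dBS UNIV) (\<lambda>A. spectrum_via (homs4 A) (\<lambda>p. p) A)
      (\<lambda>B A f. spectrum_map (homs4 B) (\<lambda>p. p) (homs4 A) (\<lambda>p. p) A f)"
    by (rule is_functor_spectrum) (simp add: bij_betw_def)
  then have "is_functor (op_cat (dBA UNIV)) (dBS UNIV) dspec
      (\<lambda>B A f. spectrum_map (homs4 B) (\<lambda>p. p) (homs4 A) (\<lambda>p. p) A f)"
    by (simp add: dspec_eq_spectrum_via[abs_def])
  then show ?thesis
    by (rule is_functor_cong)
      (simp add: op_cat_simps dBA_simps dspec_map_eq_spectrum_map d_boolean_algebraD)
qed

section \<open>Unit and counit\<close>

text \<open>This is \<open>eta\<close> for the identity coding, stated outside the locale so that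
  naturality can relate two algebras.\<close>

definition dspec_unit :: "'a dlat \<Rightarrow> 'a \<Rightarrow> ('a \<Rightarrow> bool \<times> bool) set \<times> ('a \<Rightarrow> bool \<times> bool) set" where
  "dspec_unit A = (\<lambda>a\<in>carrier A. ({p \<in> homs4 A. fst (p a)}, {p \<in> homs4 A. snd (p a)}))"

lemma dspec_unit_iso:
  assumes "d_boolean_algebra A"
  shows "dspec_unit A \<in> dlat_iso A (dclop (dspec A))"
proof -
  interpret encoded_spectrum A "homs4 A" "\<lambda>p. p"
    by (rule encoded_spectrum_dspec[OF assms])
  have "eta = dspec_unit A"
    by (simp add: eta_def dspec_unit_def pos_set_def neg_set_def)
  then show ?thesis
    using eta_iso by (simp add: dspec_eq_spectrum_via)
qed

lemma dspec_unit_natural: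
  assumes A: "d_boolean_algebra A" and B: "d_boolean_algebra B" and f: "f \<in> dlat_hom A B"
  shows "compose (carrier A) (dspec_unit B) f =
    compose (carrier A) (dclop_map (dspec A) (dspec B) (dspec_map B A f)) (dspec_unit A)"
proof (rule ext)
  fix a
  interpret A: encoded_spectrum A "homs4 A" "\<lambda>p. p"
    by (rule encoded_spectrum_dspec[OF A])
  interpret B: encoded_spectrum B "homs4 B" "\<lambda>p. p"
    by (rule encoded_spectrum_dspec[OF B])
  have pts: "points (dspec B) = homs4 B"
    by (simp add: dspec_eq_spectrum_via B.points_spectrum)
  have hom: "compose (carrier A) p f \<in> homs4 A" if "p \<in> homs4 B" for p
    by (rule dlat_hom_compose[OF d_boolean_algebraD[OF A] f that])
  show "compose (carrier A) (dspec_unit B) f a =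
      compose (carrier A) (dclop_map (dspec A) (dspec B) (dspec_map B A f)) (dspec_unit A) a"
  proof (cases "a \<in> carrier A")
    case True
    have "dspec_unit A a \<in> carrier (dclop (dspec A))"
      using dspec_unit_iso[OF A] dlat_homD(2) True by (auto simp: dlat_iso_def)
    then have "dclop_map (dspec A) (dspec B) (dspec_map B A f) (dspec_unit A a) = dspec_unit B (f a)"
      using True dlat_homD(2)[OF f True] hom
      by (simp add: dclop_map_apply pts)
        (auto simp: dspec_unit_def dspec_map_def compose_eq)
    then show ?thesis
      using True by (simp add: compose_eq)
  qed (simp add: compose_def)
qed

locale clopens_spectrum = C: encoded_clopens X B \<phi> + S: encoded_spectrum B Q h
  for X :: "'b bitop" and B :: "'c dlat" and \<phi> and Q :: "'q set" and h
begin

definition counit :: "'b \<Rightarrow> 'q" where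
  "counit = (\<lambda>x\<in>points X. inv_into Q h (C.eps x))"

lemma counit_code:
  assumes "x \<in> points X"
  shows "counit x \<in> Q" "h (counit x) = C.eps x"
  using assms bij_betw_inv_into_right[OF S.code_bij] bij_betw_apply[OF bij_betw_inv_into[OF S.code_bij]]
    C.eps_in_homs4[OF assms]
  by (simp_all add: counit_def)

lemma counit_in_sets:
  assumes "x \<in> points X" "c \<in> carrier B"
  shows "counit x \<in> S.pos_set c \<longleftrightarrow> x \<in> fst (\<phi> c)" "counit x \<in> S.neg_set c \<longleftrightarrow> x \<in> snd (\<phi> c)"
  using counit_code[OF assms(1)] assms(2) by (simp_all add: S.pos_set_def S.neg_set_def C.eps_def)

lemma counit_bij: "bij_betw counit (points X) Q"
proof -
  have "bij_betw (inv_into Q h \<circ> C.eps) (points X) Q"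
    by (rule bij_betw_trans[OF C.eps_bij bij_betw_inv_into[OF S.code_bij]])
  then show ?thesis
    by (rule iffD1[OF bij_betw_cong, rotated]) (simp add: counit_def)
qed

text \<open>Openness of \<open>counit\<close> rests on this computation; the inclusion from right to
  left comes from its surjectivity.\<close>

lemma counit_image:
  assumes "c \<in> carrier B"
  shows "counit ` fst (\<phi> c) = S.pos_set c" "counit ` snd (\<phi> c) = S.neg_set c"
proof -
  have surj: "\<exists>x\<in>points X. q = counit x" if "q \<in> Q" for q
    using counit_bij that by (auto simp: bij_betw_def)
  show "counit ` fst (\<phi> c) = S.pos_set c"
  proof
    show "counit ` fst (\<phi> c) \<subseteq> S.pos_set c"
      using C.clop_subset(1)[OF assms] counit_in_sets(1)[OF _ assms] by (auto simp: subset_iff)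
    show "S.pos_set c \<subseteq> counit ` fst (\<phi> c)"
    proof
      fix q assume q: "q \<in> S.pos_set c"
      then obtain x where "x \<in> points X" "q = counit x"
        using surj S.sets_subset(1)[of c] by (meson subsetD)
      then show "q \<in> counit ` fst (\<phi> c)"
        using q counit_in_sets(1)[OF _ assms] by simp
    qed
  qed
  show "counit ` snd (\<phi> c) = S.neg_set c"
  proof
    show "counit ` snd (\<phi> c) \<subseteq> S.neg_set c"
      using C.clop_subset(2)[OF assms] counit_in_sets(2)[OF _ assms] by (auto simp: subset_iff)
    show "S.neg_set c \<subseteq> counit ` snd (\<phi> c)"
    proof
      fix q assume q: "q \<in> S.neg_set c"
      then obtain x where "x \<in> points X" "q = counit x"
        using surj S.sets_subset(2)[of c] by (meson subsetD)
      then show "q \<in> counit ` snd (\<phi> c)"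
        using q counit_in_sets(2)[OF _ assms] by simp
    qed
  qed
qed

theorem counit_iso: "counit \<in> bitop_iso X S.X"
proof -
  have X: "bitopological_space X"
    using C.space by (simp add: d_boolean_space_def)
  have hom: "counit \<in> bitop_hom X S.X"
  proof (rule bitop_homI[OF X S.space_X])
    show "counit \<in> points X \<rightarrow>\<^sub>E points S.X"
      using counit_code(1) by (auto simp: counit_def S.points_spectrum)
    show "openin (pos_top X) (counit -` V \<inter> points X)" if V: "openin (pos_top S.X) V" for V
    proof -
      obtain T where T: "T \<subseteq> carrier B" "V = \<Union>(S.pos_set ` T)"
        using iffD1[OF S.openin_pos_iff V] by (elim exE conjE)
      have "counit -` S.pos_set c \<inter> points X = fst (\<phi> c)" if "c \<in> T" for c
        using counit_in_sets(1) C.clop_subset(1) T(1) that by blast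
      then have "counit -` V \<inter> points X = \<Union>((\<lambda>c. fst (\<phi> c)) ` T)"
        using T(2) by auto
      moreover have "openin (pos_top X) (\<Union>((\<lambda>c. fst (\<phi> c)) ` T))"
        using C.clop_clopen(1) T(1) by (intro openin_Union) auto
      ultimately show ?thesis
        by simp
    qed
    show "openin (neg_top X) (counit -` V \<inter> points X)" if V: "openin (neg_top S.X) V" for V
    proof -
      obtain T where T: "T \<subseteq> carrier B" "V = \<Union>(S.neg_set ` T)"
        using iffD1[OF S.openin_neg_iff V] by (elim exE conjE)
      have "counit -` S.neg_set c \<inter> points X = snd (\<phi> c)" if "c \<in> T" for c
        using counit_in_sets(2) C.clop_subset(2) T(1) that by blast
      then have "counit -` V \<inter> points X = \<Union>((\<lambda>c. snd (\<phi> c)) ` T)"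
        using T(2) by auto
      moreover have "openin (neg_top X) (\<Union>((\<lambda>c. snd (\<phi> c)) ` T))"
        using C.clop_clopen(3) T(1) by (intro openin_Union) auto
      ultimately show ?thesis
        by simp
    qed
  qed
  show ?thesis
  proof (rule bitop_isoI[OF X S.space_X hom])
    show "bij_betw counit (points X) (points S.X)"
      by (simp add: S.points_spectrum counit_bij)
    show "openin (pos_top S.X) (counit ` U)" if U: "openin (pos_top X) U" for U
    proof -
      let ?T = "{c \<in> carrier B. fst (\<phi> c) \<subseteq> U}"
      have "x \<in> (\<Union>c\<in>?T. fst (\<phi> c))" if x: "x \<in> U" for x
      proof -
        obtain c where "c \<in> carrier B" "x \<in> fst (\<phi> c)" "fst (\<phi> c) \<subseteq> U"
          by (rule C.pos_base[OF U x])
        then show ?thesis by auto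
      qed
      then have "U = (\<Union>c\<in>?T. fst (\<phi> c))"
        by auto
      then have "counit ` U = (\<Union>c\<in>?T. counit ` fst (\<phi> c))"
        by (metis image_UN)
      also have "\<dots> = \<Union>(S.pos_set ` ?T)"
        using counit_image(1) by auto
      finally show ?thesis
        unfolding S.openin_pos_iff by (intro exI[of _ ?T]) auto
    qed
    show "openin (neg_top S.X) (counit ` U)" if U: "openin (neg_top X) U" for U
    proof -
      let ?T = "{c \<in> carrier B. snd (\<phi> c) \<subseteq> U}"
      have "x \<in> (\<Union>c\<in>?T. snd (\<phi> c))" if x: "x \<in> U" for x
      proof -
        obtain c where "c \<in> carrier B" "x \<in> snd (\<phi> c)" "snd (\<phi> c) \<subseteq> U"
          by (rule C.neg_base[OF U x])
        then show ?thesis by auto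
      qed
      then have "U = (\<Union>c\<in>?T. snd (\<phi> c))"
        by auto
      then have "counit ` U = (\<Union>c\<in>?T. counit ` snd (\<phi> c))"
        by (metis image_UN)
      also have "\<dots> = \<Union>(S.neg_set ` ?T)"
        using counit_image(2) by auto
      finally show ?thesis
        unfolding S.openin_neg_iff by (intro exI[of _ ?T]) auto
    qed
  qed
qed

end

text \<open>Evaluation at a point, that is, \<open>eps\<close> for the identity coding.\<close>

definition dclop_counit :: "'b bitop \<Rightarrow> 'b \<Rightarrow> 'b set \<times> 'b set \<Rightarrow> bool \<times> bool" where
  "dclop_counit X = (\<lambda>x\<in>points X. \<lambda>c\<in>carrier (dclop X). (x \<in> fst c, x \<in> snd c))"

lemma dclop_counit_iso:
  assumes X: "d_boolean_space X"
  shows "dclop_counit X \<in> bitop_iso X (dspec (dclop X))"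
proof -
  interpret C: encoded_clopens X "dclop X" "\<lambda>c. c"
    by (rule encoded_clopens_dclop[OF X])
  interpret clopens_spectrum X "dclop X" "\<lambda>c. c" "homs4 (dclop X)" "\<lambda>p. p"
    by (intro clopens_spectrum.intro encoded_clopens_dclop[OF X] encoded_spectrum_dspec)
      (simp add: d_boolean_algebra_iff C.d_boolean_axioms)
  have "counit x = dclop_counit X x" for x
    using counit_code(2)[of x] by (cases "x \<in> points X") (simp_all add: counit_def dclop_counit_def C.eps_def)
  then have "counit = dclop_counit X"
    by (rule ext)
  then show ?thesis
    using counit_iso by (simp add: dspec_eq_spectrum_via)
qed

lemma dclop_counit_natural:
  assumes X: "d_boolean_space X" and Y: "d_boolean_space Y" and f: "f \<in> bitop_hom X Y"
  shows "compose (points X) (dclop_counit Y) f =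
    compose (points X) (dspec_map (dclop X) (dclop Y) (dclop_map Y X f)) (dclop_counit X)"
proof (rule ext)
  fix x
  have hom: "dclop_map Y X f \<in> dlat_hom (dclop Y) (dclop X)"
    by (rule dclop_map_hom[OF X Y f])
  interpret C: encoded_clopens X "dclop X" "\<lambda>c. c"
    by (rule encoded_clopens_dclop[OF X])
  show "compose (points X) (dclop_counit Y) f x =
      compose (points X) (dspec_map (dclop X) (dclop Y) (dclop_map Y X f)) (dclop_counit X) x"
  proof (cases "x \<in> points X")
    case True
    have "dclop_counit X x \<in> homs4 (dclop X)"
      using C.eps_in_homs4[OF True] True by (simp add: dclop_counit_def C.eps_def)
    moreover have "dclop_counit Y (f x) c = compose (carrier (dclop Y)) (dclop_counit X x) (dclop_map Y X f) c" for c
      using True bitop_hom_apply[OF f True] dlat_homD(2)[OF hom, of c]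
      by (cases "c \<in> carrier (dclop Y)") (simp_all add: dclop_counit_def compose_def dclop_map_apply)
    ultimately show ?thesis
      using True by (simp add: compose_eq dspec_map_def fun_eq_iff)
  qed (simp add: compose_def)
qed

section \<open>Equivalence from a fully faithful, essentially surjective functor\<close>

text \<open>Choice gives objects \<open>G Y\<close> with isomorphisms \<open>e Y\<close> from
  \<open>Y\<close> to \<open>F (G Y)\<close> and inverses \<open>d Y\<close>. Fullness lifts each
  arrow conjugated by these isomorphisms, and faithfulness transfers equations proved in
  \<open>D\<close> back to \<open>C\<close>.\<close>

lemma equivalent_categoriesI:
  assumes F: "is_functor C D F Fm"
    and faithful: "\<And>X Y f g. \<lbrakk>X \<in> cat_obj C; Y \<in> cat_obj C; f \<in> cat_hom C X Y; g \<in> cat_hom C X Y;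
      Fm X Y f = Fm X Y g\<rbrakk> \<Longrightarrow> f = g"
    and full: "\<And>X Y k. \<lbrakk>X \<in> cat_obj C; Y \<in> cat_obj C; k \<in> cat_hom D (F X) (F Y)\<rbrakk> \<Longrightarrow>
      \<exists>f\<in>cat_hom C X Y. Fm X Y f = k"
    and ess: "\<And>Y. Y \<in> cat_obj D \<Longrightarrow> \<exists>X\<in>cat_obj C. \<exists>e. e \<in> cat_iso D Y (F X)"
  shows "equivalent_categories C D"
proof -
  note CD = is_functorD(1,2)[OF F]
  note C = is_categoryD[OF CD(1)]
  note D = is_categoryD[OF CD(2)]
  note Fo = is_functorD(3)[OF F] and Fh = is_functorD(4)[OF F]
    and Fi = is_functorD(5)[OF F] and Fc = is_functorD(6)[OF F]
  define G where "G Y = (SOME X. X \<in> cat_obj C \<and> (\<exists>e. e \<in> cat_iso D Y (F X)))" for Y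
  define e where "e Y = (SOME e. e \<in> cat_iso D Y (F (G Y)))" for Y
  define d where "d Y = (SOME d. d \<in> cat_hom D (F (G Y)) Y \<and>
     cat_comp D Y (F (G Y)) Y d (e Y) = cat_id D Y \<and>
     cat_comp D (F (G Y)) Y (F (G Y)) (e Y) d = cat_id D (F (G Y)))" for Y
  have "G Y \<in> cat_obj C \<and> (\<exists>e. e \<in> cat_iso D Y (F (G Y)))" if "Y \<in> cat_obj D" for Y
    unfolding G_def by (rule someI_ex) (use ess[OF that] in blast)
  then have Go: "G Y \<in> cat_obj C" and e_iso: "e Y \<in> cat_iso D Y (F (G Y))" if "Y \<in> cat_obj D" for Y
    using that unfolding e_def by (auto intro: someI_ex)
  have eh: "e Y \<in> cat_hom D Y (F (G Y))" if "Y \<in> cat_obj D" for Y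
    using e_iso[OF that] by (simp add: cat_iso_def)
  have "d Y \<in> cat_hom D (F (G Y)) Y \<and> cat_comp D Y (F (G Y)) Y (d Y) (e Y) = cat_id D Y \<and>
     cat_comp D (F (G Y)) Y (F (G Y)) (e Y) (d Y) = cat_id D (F (G Y))" if "Y \<in> cat_obj D" for Y
    unfolding d_def by (rule someI_ex) (use e_iso[OF that] in \<open>auto simp: cat_iso_def\<close>)
  then have dh: "d Y \<in> cat_hom D (F (G Y)) Y"
    and de: "cat_comp D Y (F (G Y)) Y (d Y) (e Y) = cat_id D Y"
    and ed: "cat_comp D (F (G Y)) Y (F (G Y)) (e Y) (d Y) = cat_id D (F (G Y))" if "Y \<in> cat_obj D" for Y
    using that by blast+
  \<comment> \<open>Conjugation of \<open>g\<close> by the chosen isomorphisms, the arrow that makes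
    \<open>e\<close> natural; \<open>conj_e\<close> records this.\<close>
  define conj where "conj Y Z g = cat_comp D (F (G Y)) Y (F (G Z)) (cat_comp D Y Z (F (G Z)) (e Z) g) (d Y)" for Y Z g
  have conj_hom: "conj Y Z g \<in> cat_hom D (F (G Y)) (F (G Z))"
    if "Y \<in> cat_obj D" "Z \<in> cat_obj D" "g \<in> cat_hom D Y Z" for Y Z g
    unfolding conj_def using that by (intro D(2) Fo Go eh dh)
  have conj_e: "cat_comp D Y (F (G Y)) (F (G Z)) (conj Y Z g) (e Y) = cat_comp D Y Z (F (G Z)) (e Z) g"
    if YZ: "Y \<in> cat_obj D" "Z \<in> cat_obj D" "g \<in> cat_hom D Y Z" for Y Z g
  proof -
    let ?k = "cat_comp D Y Z (F (G Z)) (e Z) g"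
    have k: "?k \<in> cat_hom D Y (F (G Z))"
      using YZ by (intro D(2) Fo Go eh)
    have "cat_comp D Y (F (G Y)) (F (G Z)) (conj Y Z g) (e Y) =
        cat_comp D Y Y (F (G Z)) ?k (cat_comp D Y (F (G Y)) Y (d Y) (e Y))"
      unfolding conj_def
      by (rule D(5)[symmetric]) (use YZ k in \<open>simp_all add: Fo Go eh dh\<close>)
    then show ?thesis
      using YZ k by (simp add: de D(3) Fo Go)
  qed
  \<comment> \<open>\<open>e Y\<close> is an epimorphism, since it has the right inverse
    \<open>d Y\<close>.\<close>
  have cancel: "k = l" if YW: "Y \<in> cat_obj D" "W \<in> cat_obj D" "k \<in> cat_hom D (F (G Y)) W" "l \<in> cat_hom D (F (G Y)) W"
    and eq: "cat_comp D Y (F (G Y)) W k (e Y) = cat_comp D Y (F (G Y)) W l (e Y)" for Y W k l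
  proof -
    have "m = cat_comp D (F (G Y)) Y W (cat_comp D Y (F (G Y)) W m (e Y)) (d Y)"
      if "m \<in> cat_hom D (F (G Y)) W" for m
      using D(5)[of "F (G Y)" Y "F (G Y)" W "d Y" "e Y" m] that YW D(3)[of "F (G Y)" W m]
      by (simp add: Fo Go eh dh ed)
    then show ?thesis
      using YW eq by metis
  qed
  define Gm where "Gm Y Z g = (SOME f. f \<in> cat_hom C (G Y) (G Z) \<and> Fm (G Y) (G Z) f = conj Y Z g)" for Y Z g
  have "Gm Y Z g \<in> cat_hom C (G Y) (G Z) \<and> Fm (G Y) (G Z) (Gm Y Z g) = conj Y Z g"
    if "Y \<in> cat_obj D" "Z \<in> cat_obj D" "g \<in> cat_hom D Y Z" for Y Z g
    unfolding Gm_def by (rule someI_ex) (use full[OF Go Go conj_hom] that in blast)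
  then have Gh: "Gm Y Z g \<in> cat_hom C (G Y) (G Z)" and FG: "Fm (G Y) (G Z) (Gm Y Z g) = conj Y Z g"
    if "Y \<in> cat_obj D" "Z \<in> cat_obj D" "g \<in> cat_hom D Y Z" for Y Z g
    using that by blast+
  have G: "is_functor D C G Gm"
    unfolding is_functor_def
  proof (intro conjI ballI)
    fix Y assume Y: "Y \<in> cat_obj D"
    have "conj Y Y (cat_id D Y) = cat_id D (F (G Y))"
      using Y by (simp add: conj_def D(1,3) Fo Go eh ed)
    then show "Gm Y Y (cat_id D Y) = cat_id C (G Y)"
      using Y by (intro faithful[of "G Y" "G Y"]) (simp_all add: Go Gh D(1) C(1) FG Fi)
  next
    fix X Y Z f g
    assume XYZ: "X \<in> cat_obj D" "Y \<in> cat_obj D" "Z \<in> cat_obj D"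
      and f: "f \<in> cat_hom D X Y" and g: "g \<in> cat_hom D Y Z"
    have gf: "cat_comp D X Y Z g f \<in> cat_hom D X Z"
      by (rule D(2)[OF XYZ f g])
    let ?FX = "F (G X)" and ?FY = "F (G Y)" and ?FZ = "F (G Z)"
    note o = XYZ Fo[OF Go[OF XYZ(1)]] Fo[OF Go[OF XYZ(2)]] Fo[OF Go[OF XYZ(3)]]
    \<comment> \<open>The composite of the conjugates and the conjugate of the composite agree after
      precomposition with \<open>e X\<close>, so \<open>cancel\<close> identifies them.\<close>
    have "cat_comp D X ?FX ?FZ (cat_comp D ?FX ?FY ?FZ (conj Y Z g) (conj X Y f)) (e X) =
        cat_comp D X ?FY ?FZ (conj Y Z g) (cat_comp D X ?FX ?FY (conj X Y f) (e X))"
      by (rule D(5)[symmetric]) (simp_all add: o f g conj_hom eh)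
    also have "\<dots> = cat_comp D X ?FY ?FZ (conj Y Z g) (cat_comp D X Y ?FY (e Y) f)"
      by (simp add: conj_e o f)
    also have "\<dots> = cat_comp D X Y ?FZ (cat_comp D Y ?FY ?FZ (conj Y Z g) (e Y)) f"
      by (rule D(5)) (simp_all add: o f g conj_hom eh)
    also have "\<dots> = cat_comp D X Y ?FZ (cat_comp D Y Z ?FZ (e Z) g) f"
      by (simp add: conj_e o g)
    also have "\<dots> = cat_comp D X Z ?FZ (e Z) (cat_comp D X Y Z g f)"
      by (rule D(5)[symmetric]) (simp_all add: o f g eh)
    also have "\<dots> = cat_comp D X ?FX ?FZ (conj X Z (cat_comp D X Y Z g f)) (e X)"
      by (simp add: conj_e o gf)
    finally have "conj X Z (cat_comp D X Y Z g f) = cat_comp D ?FX ?FY ?FZ (conj Y Z g) (conj X Y f)"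
      by (rule cancel[OF XYZ(1) o(6) conj_hom[OF XYZ(1,3) gf]
            D(2)[OF o(4-6) conj_hom[OF XYZ(1,2) f] conj_hom[OF XYZ(2,3) g]] sym])
    then show "Gm X Z (cat_comp D X Y Z g f) = cat_comp C (G X) (G Y) (G Z) (Gm Y Z g) (Gm X Y f)"
      using XYZ f g gf
      by (intro faithful[of "G X" "G Z"]) (simp_all add: Go Gh C(2)[of "G X" "G Y" "G Z"] FG Fc[of "G X" "G Y" "G Z"])
  qed (simp_all add: CD Go Gh)
  \<comment> \<open>The unit lifts \<open>e (F X)\<close> through \<open>F\<close>; its inverse will
    be a lift of \<open>d (F X)\<close>.\<close>
  define \<eta> where "\<eta> X = (SOME f. f \<in> cat_hom C X (G (F X)) \<and> Fm X (G (F X)) f = e (F X))" for X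
  have "\<eta> X \<in> cat_hom C X (G (F X)) \<and> Fm X (G (F X)) (\<eta> X) = e (F X)" if "X \<in> cat_obj C" for X
    unfolding \<eta>_def by (rule someI_ex) (use full[OF that Go[OF Fo[OF that]] eh[OF Fo[OF that]]] in blast)
  then have \<eta>h: "\<eta> X \<in> cat_hom C X (G (F X))" and F\<eta>: "Fm X (G (F X)) (\<eta> X) = e (F X)" if "X \<in> cat_obj C" for X
    using that by blast+
  have "is_natural_iso C C (\<lambda>X. X) (\<lambda>X Y f. f) (\<lambda>X. G (F X)) (\<lambda>X Y f. Gm (F X) (F Y) (Fm X Y f)) \<eta>"
    unfolding is_natural_iso_def
  proof (intro conjI ballI)
    fix X assume X: "X \<in> cat_obj C"
    note o = X Fo[OF X] Go[OF Fo[OF X]] Fo[OF Go[OF Fo[OF X]]]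
    obtain g where g: "g \<in> cat_hom C (G (F X)) X" "Fm (G (F X)) X g = d (F X)"
      using full[OF o(3,1) dh[OF o(2)]] by blast
    have "cat_comp C X (G (F X)) X g (\<eta> X) = cat_id C X"
      by (rule faithful[of X X])
        (simp_all add: o g \<eta>h C(1) C(2)[of X "G (F X)" X] Fc[of X "G (F X)" X] F\<eta> Fi de)
    moreover have "cat_comp C (G (F X)) X (G (F X)) (\<eta> X) g = cat_id C (G (F X))"
      by (rule faithful[of "G (F X)" "G (F X)"])
        (simp_all add: o g \<eta>h C(1) C(2)[of "G (F X)" X "G (F X)"] Fc[of "G (F X)" X "G (F X)"] F\<eta> Fi ed)
    ultimately show "\<eta> X \<in> cat_iso C X (G (F X))"
      using \<eta>h[OF X] g(1) by (auto simp: cat_iso_def)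
  next
    fix X Y f assume X: "X \<in> cat_obj C" and Y: "Y \<in> cat_obj C" and f: "f \<in> cat_hom C X Y"
    note o = X Y Fo[OF X] Go[OF Fo[OF X]] Fo[OF Go[OF Fo[OF X]]] Fo[OF Y] Go[OF Fo[OF Y]] Fo[OF Go[OF Fo[OF Y]]]
    note Ff = Fh[OF X Y f]
    show "cat_comp C X Y (G (F Y)) (\<eta> Y) f =
        cat_comp C X (G (F X)) (G (F Y)) (Gm (F X) (F Y) (Fm X Y f)) (\<eta> X)"
      by (rule faithful[of X "G (F Y)"])
        (simp_all add: o f Ff \<eta>h Gh C(2)[of X Y] C(2)[of X "G (F X)"] Fc[of X Y] Fc[of X "G (F X)"] F\<eta> FG conj_e)
  qed
  \<comment> \<open>Naturality of \<open>e\<close> is \<open>conj_e\<close>, since \<open>F\<close>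
    maps the lifted arrow to the conjugated one.\<close>
  moreover have "is_natural_iso D D (\<lambda>X. X) (\<lambda>X Y f. f) (\<lambda>X. F (G X)) (\<lambda>X Y f. Fm (G X) (G Y) (Gm X Y f)) e"
    unfolding is_natural_iso_def using e_iso by (simp add: FG conj_e)
  ultimately show ?thesis
    using F G unfolding equivalent_categories_def by blast
qed

lemma bitop_iso_cat_iso:
  assumes "bitopological_space X" "bitopological_space Y" "f \<in> bitop_iso X Y"
  shows "f \<in> cat_iso (dBS \<U>) X Y"
proof -
  obtain g where g: "f \<in> bitop_hom X Y" "g \<in> bitop_hom Y X"
    "\<forall>x\<in>points X. g (f x) = x" "\<forall>y\<in>points Y. f (g y) = y"
    using assms(3) by (auto simp: bitop_iso_def)
  have "compose (points X) g f = (\<lambda>x\<in>points X. x)" "compose (points Y) f g = (\<lambda>y\<in>points Y. y)"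
    using g by (auto simp: compose_def fun_eq_iff)
  then show ?thesis
    using g by (auto simp: cat_iso_def dBS_simps)
qed

section \<open>Small objects\<close>

text \<open>\<open>strong_limit\<close> speaks of subsets of the universe only; an injection
  transports it to sets over any type, so that it can be iterated.\<close>

lemma strong_limit_Pow:
  fixes A :: "'c set"
  assumes "strong_limit TYPE('u)" "A \<prec> (UNIV :: 'u set)"
  shows "Pow A \<prec> (UNIV :: 'u set)"
proof -
  obtain f where f: "inj_on f A" "f ` A \<subseteq> (UNIV :: 'u set)"
    using lesspoll_imp_lepoll[OF assms(2)] unfolding lepoll_def by blast
  have "A \<approx> f ` A"
    using f(1) inj_on_image_eqpoll_self[of f A] eqpoll_sym by blast
  then have "f ` A \<prec> (UNIV :: 'u set)"
    using assms(2) eq_lesspoll_trans eqpoll_sym by blast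
  then have "Pow (f ` A) \<prec> (UNIV :: 'u set)"
    using assms(1) by (simp add: strong_limit_def)
  moreover have "bij_betw (image f) (Pow A) (Pow (f ` A))"
    using f(1) by (simp add: bij_betw_Pow bij_betw_imageI)
  then have "Pow A \<approx> Pow (f ` A)"
    unfolding eqpoll_def by blast
  ultimately show ?thesis
    using eq_lesspoll_trans by blast
qed

text \<open>With Kuratowski pairs there is no need to distinguish finite and infinite sets.\<close>

lemma Times_self_lepoll_Pow_Pow: "A \<times> A \<lesssim> Pow (Pow (A :: 'a set))"
proof -
  have "x = x' \<and> y = y'" if "{{x}, {x, y}} = {{x'}, {x', y'}}" for x y x' y' :: 'a
    using that by (metis doubleton_eq_iff insert_absorb2)
  then have "inj_on (\<lambda>(x, y). {{x}, {x, y}}) (A \<times> A)"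
    by (intro inj_onI) (simp add: split_beta prod_eq_iff)
  moreover have "(\<lambda>(x, y). {{x}, {x, y}}) ` (A \<times> A) \<subseteq> Pow (Pow A)"
    by auto
  ultimately show ?thesis
    unfolding lepoll_def by blast
qed

text \<open>Turns a cardinality bound over an arbitrary type into a coding inside the
  universe.\<close>

lemma small_code:
  assumes "S \<prec> (UNIV :: 'u set)"
  obtains Q and h where "bij_betw h Q S" "Q \<in> (small :: 'u set set)"
proof -
  obtain f where f: "inj_on f S" "f ` S \<subseteq> (UNIV :: 'u set)"
    using lesspoll_imp_lepoll[OF assms] unfolding lepoll_def by blast
  have "f ` S \<prec> (UNIV :: 'u set)"
    using assms f(1) inj_on_image_eqpoll_self[of f S] eq_lesspoll_trans by blast
  then show thesis
    using that[OF bij_betw_inv_into[OF inj_on_imp_bij_betw[OF f(1)]]] by (simp add: small_def)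
qed

text \<open>By \<open>homs4_star\<close> the set where the first coordinate is true determines the
  homomorphism.\<close>

lemma (in d_boolean) homs4_lepoll: "homs4 L \<lesssim> Pow (carrier L)"
proof -
  let ?t = "\<lambda>p. {a \<in> carrier L. fst (p a)}"
  have "inj_on ?t (homs4 L)"
  proof (rule inj_onI)
    fix p q assume p: "p \<in> homs4 L" and q: "q \<in> homs4 L" and eq: "?t p = ?t q"
    have fst_eq: "fst (p a) = fst (q a)" if "a \<in> carrier L" for a
      using eq that by blast
    have "snd (p a) = snd (q a)" if "a \<in> carrier L" for a
      using fst_eq[OF star_closed[OF that]] homs4_star(1)[OF p that] homs4_star(1)[OF q that] by simp
    then show "p = q"
      using fst_eq by (intro PiE_ext[OF dlat_homD(1)[OF p] dlat_homD(1)[OF q]]) (simp add: prod_eq_iff)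
  qed
  then show ?thesis
    unfolding lepoll_def by blast
qed

text \<open>One power set accounts for the components of a pair and two more for the
  pairing.\<close>

lemma dclop_lepoll: "carrier (dclop X) \<lesssim> Pow (Pow (Pow (points X)))"
proof -
  have "carrier (dclop X) \<subseteq> Pow (points X) \<times> Pow (points X)"
    by (auto simp: dclop_def points_def dest!: openin_subset closedin_subset)
  then show ?thesis
    by (rule lepoll_trans[OF subset_imp_lepoll Times_self_lepoll_Pow_Pow])
qed

text \<open>Order, constants, \<open>con\<close> and \<open>tot\<close> of the clopen algebra are
  transported along \<open>\<phi>\<close> to the set \<open>C\<close>.\<close>

lemma encoded_clopens_exists:
  fixes \<phi> :: "'c \<Rightarrow> 'b set \<times> 'b set"
  assumes X: "d_boolean_space X" and \<phi>: "bij_betw \<phi> C (carrier (dclop X))"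
  obtains B where "encoded_clopens X B \<phi>" "carrier B = C"
proof -
  interpret X: encoded_clopens X "dclop X" "\<lambda>c. c"
    by (rule encoded_clopens_dclop[OF X])
  have inv: "inv_into C \<phi> c \<in> C" "\<phi> (inv_into C \<phi> c) = c" if "c \<in> carrier (dclop X)" for c
    using bij_betw_inv_into_right[OF \<phi> that] bij_betw_apply[OF bij_betw_inv_into[OF \<phi>] that] by simp_all
  define B :: "'c dlat" where "B = \<lparr>carrier = C, eq = (=),
     le = (\<lambda>x y. fst (\<phi> x) \<subseteq> fst (\<phi> y) \<and> snd (\<phi> x) \<subseteq> snd (\<phi> y)),
     tt = inv_into C \<phi> (tt (dclop X)), ff = inv_into C \<phi> (ff (dclop X)),
     con = {c \<in> C. fst (\<phi> c) \<inter> snd (\<phi> c) = {}}, tot = {c \<in> C. fst (\<phi> c) \<union> snd (\<phi> c) = points X}\<rparr>"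
  have "encoded_clopens X B \<phi>"
    using X \<phi> inv[OF X.tt_B(1)] inv[OF X.ff_B(1)] X.tt_B(2) X.ff_B(2)
    by unfold_locales (simp_all add: B_def)
  then show thesis
    using that by (simp add: B_def)
qed

lemma dually_equivalent_small:
  assumes lim: "strong_limit TYPE('u)"
  shows "dually_equivalent (dBA (small :: 'u set set)) (dBS (small :: 'u set set))"
proof -
  \<comment> \<open>The spectrum has at most as many points as the algebra has subsets, so a small
    set codes it; the choice of codings defines the functor on objects.\<close>
  have "\<exists>Q h. bij_betw h Q (homs4 A) \<and> Q \<in> (small :: 'u set set)"
    if A: "A \<in> cat_obj (dBA (small :: 'u set set))" for A
  proof -
    interpret d_boolean A
      using A by (simp add: dBA_simps d_boolean_algebra_iff)
    have "Pow (carrier A) \<prec> (UNIV :: 'u set)"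
      using A by (intro strong_limit_Pow[OF lim]) (simp add: dBA_simps small_def)
    then have "homs4 A \<prec> (UNIV :: 'u set)"
      using homs4_lepoll lesspoll_trans1 by blast
    then show ?thesis
      using small_code by metis
  qed
  then obtain Q h where code: "bij_betw (h A) (Q A) (homs4 A) \<and> Q A \<in> (small :: 'u set set)"
    if "A \<in> cat_obj (dBA (small :: 'u set set))" for A
    by metis
  let ?F = "\<lambda>A. spectrum_via (Q A) (h A) A"
  let ?Fm = "\<lambda>B A f. spectrum_map (Q B) (h B) (Q A) (h A) A f"
  have enc: "encoded_spectrum A (Q A) (h A)" if "A \<in> cat_obj (dBA (small :: 'u set set))" for A
    using that code[OF that]
    by (simp add: encoded_spectrum_def encoded_spectrum_axioms_def d_boolean_algebra_iff dBA_simps)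
  have "equivalent_categories (op_cat (dBA (small :: 'u set set))) (dBS (small :: 'u set set))"
  proof (rule equivalent_categoriesI)
    show "is_functor (op_cat (dBA small)) (dBS small) ?F ?Fm"
      by (rule is_functor_spectrum[OF code])
  next
    fix B A :: "'u dlat" and f g
    assume *: "B \<in> cat_obj (op_cat (dBA small))" "A \<in> cat_obj (op_cat (dBA small))"
      "f \<in> cat_hom (op_cat (dBA small)) B A" "g \<in> cat_hom (op_cat (dBA small)) B A" "?Fm B A f = ?Fm B A g"
    interpret spectrum_pair B "Q B" "h B" A "Q A" "h A"
      using * by (intro spectrum_pair.intro enc) (simp_all add: op_cat_simps)
    show "f = g"
      using spectrum_map_inj[of f g] * by (simp add: op_cat_simps dBA_simps)
  next
    fix B A :: "'u dlat" and k
    assume *: "B \<in> cat_obj (op_cat (dBA small))" "A \<in> cat_obj (op_cat (dBA small))"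
      "k \<in> cat_hom (dBS small) (?F B) (?F A)"
    interpret spectrum_pair B "Q B" "h B" A "Q A" "h A"
      using * by (intro spectrum_pair.intro enc) (simp_all add: op_cat_simps)
    show "\<exists>f\<in>cat_hom (op_cat (dBA small)) B A. ?Fm B A f = k"
      using spectrum_map_surj[of k] * by (simp add: op_cat_simps dBA_simps dBS_simps)
  next
    \<comment> \<open>Essential surjectivity: \<open>X\<close> is isomorphic, by
      \<open>counit\<close>, to the coded spectrum of a small copy \<open>B\<close> of its clopen
      algebra.\<close>
    fix X :: "'u bitop" assume X: "X \<in> cat_obj (dBS small)"
    then have "Pow (Pow (Pow (points X))) \<prec> (UNIV :: 'u set)"
      by (intro strong_limit_Pow[OF lim]) (simp add: dBS_simps small_def)
    then have "carrier (dclop X) \<prec> (UNIV :: 'u set)"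
      using dclop_lepoll lesspoll_trans1 by blast
    then obtain C :: "'u set" and \<phi> where C: "bij_betw \<phi> C (carrier (dclop X))" "C \<in> small"
      by (rule small_code)
    have sX: "d_boolean_space X"
      using X by (simp add: dBS_simps)
    obtain B where B: "encoded_clopens X B \<phi>" "carrier B = C"
      by (rule encoded_clopens_exists[OF sX C(1)])
    interpret B: encoded_clopens X B \<phi>
      by (rule B(1))
    have Bo: "B \<in> cat_obj (dBA small)"
      using B(2) C(2) B.d_boolean_axioms by (simp add: dBA_simps d_boolean_algebra_iff)
    interpret clopens_spectrum X B \<phi> "Q B" "h B"
      by (intro clopens_spectrum.intro B enc Bo)
    have "counit \<in> cat_iso (dBS small) X (?F B)"
      using sX by (intro bitop_iso_cat_iso counit_iso S.space_X) (simp add: d_boolean_space_def)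
    then show "\<exists>A\<in>cat_obj (op_cat (dBA small)). \<exists>e. e \<in> cat_iso (dBS small) X (?F A)"
      using Bo by (intro bexI[of _ B]) (auto simp: op_cat_simps)
  qed
  then show ?thesis
    by (simp add: dually_equivalent_def)
qed

theorem theorem5p19:
  shows "(strong_limit TYPE('u) \<longrightarrow>
            dually_equivalent (dBA (small :: 'u set set)) (dBS (small :: 'u set set))) \<and>
         is_functor (op_cat (dBA (UNIV :: 'a set set))) (dBS UNIV) dspec dspec_map \<and>
         is_functor (op_cat (dBS (UNIV :: 'b set set))) (dBA UNIV) dclop dclop_map \<and>
         (\<exists>\<eta>. (\<forall>A\<in>cat_obj (dBA (UNIV :: 'a set set)). \<eta> A \<in> dlat_iso A (dclop (dspec A))) \<and>
              (\<forall>A\<in>cat_obj (dBA UNIV). \<forall>B\<in>cat_obj (dBA UNIV). \<forall>f\<in>cat_hom (dBA UNIV) A B.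
                 compose (carrier A) (\<eta> B) f =
                 compose (carrier A) (dclop_map (dspec A) (dspec B) (dspec_map B A f)) (\<eta> A))) \<and>
         (\<exists>\<epsilon>. (\<forall>X\<in>cat_obj (dBS (UNIV :: 'b set set)). \<epsilon> X \<in> bitop_iso X (dspec (dclop X))) \<and>
              (\<forall>X\<in>cat_obj (dBS UNIV). \<forall>Y\<in>cat_obj (dBS UNIV). \<forall>f\<in>cat_hom (dBS UNIV) X Y.
                 compose (points X) (\<epsilon> Y) f =
                 compose (points X) (dspec_map (dclop X) (dclop Y) (dclop_map Y X f)) (\<epsilon> X)))"
proof (intro conjI impI)
  show "\<exists>\<eta>. (\<forall>A\<in>cat_obj (dBA (UNIV :: 'a set set)). \<eta> A \<in> dlat_iso A (dclop (dspec A))) \<and>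
              (\<forall>A\<in>cat_obj (dBA UNIV). \<forall>B\<in>cat_obj (dBA UNIV). \<forall>f\<in>cat_hom (dBA UNIV) A B.
                 compose (carrier A) (\<eta> B) f =
                 compose (carrier A) (dclop_map (dspec A) (dspec B) (dspec_map B A f)) (\<eta> A))"
    by (intro exI[of _ dspec_unit]) (simp add: dBA_simps dspec_unit_iso dspec_unit_natural)
  show "\<exists>\<epsilon>. (\<forall>X\<in>cat_obj (dBS (UNIV :: 'b set set)). \<epsilon> X \<in> bitop_iso X (dspec (dclop X))) \<and>
              (\<forall>X\<in>cat_obj (dBS UNIV). \<forall>Y\<in>cat_obj (dBS UNIV). \<forall>f\<in>cat_hom (dBS UNIV) X Y.
                 compose (points X) (\<epsilon> Y) f =
                 compose (points X) (dspec_map (dclop X) (dclop Y) (dclop_map Y X f)) (\<epsilon> X))"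
    by (intro exI[of _ dclop_counit]) (simp add: dBS_simps dclop_counit_iso dclop_counit_natural)
qed (simp_all add: dually_equivalent_small is_functor_dspec is_functor_dclop)

end
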